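(* Let $F:\Sigma\to\Sigma$, $F(x,y)=(f(x),G(x,y))$, be a transformation with $f\in\mathcal{T}$ and $G$ satisfying (H1). Then $F$ has a unique invariant probability measure in $S^1$; that is, there is exactly one probability measure $\mu_0\in S^1$ with $F_*\mu_0=\mu_0$.
   Context: Setting. $I=[0,1]$, $m$ is Lebesgue measure on $I$, $d_1$ the Euclidean distance on $I$; $(K,d_2)$ is a compact metric space with $\operatorname{diam}(K)=1$; $\Sigma=I\times K$ with metric $d_1+d_2$. The map $F=(f,G)$ is assumed Borel measurable, with $f:I\to I$, $G:\Sigma\to K$. Class $\mathcal{T}$. There is a countably infinite family $\mathcal P=\{I_i=(a_i,b_i)\}_{i\ge1}$ of pairwise disjoint open subintervals of $I$ with $m(I\setminus\bigcup_i I_i)=0$. $f\in\mathcal T$ means that $f:\bigcup_i I_i\to I$ satisfies: (1) each $f_i=f|_{I_i}$ is increasing, convex and differentiable with $\lim_{x\to a_i^+}f_i(x)=0$ (the values $f_i(a_i)=0$, $f_i(b_i)$ and $f_i'(a_i)$ are defined by continuity); (2) $\sum_{i\ge1}1/f_i'(a_i)<\infty$; (3) if $0$ is not a limit point of the partition points, then $f'(0)=1/\beta>1$ for some $0<\beta<1$. On the $m$-null set $I\setminus\bigcup_i I_i$, $f$ is given arbitrary (Borel) values. (H1): there is $0\le\alpha<1$ such that for $m$-a.e. $x\in I$, $d_2(G(x,z_1),G(x,z_2))\le\alpha d_2(z_1,z_2)$ for all $z_1,z_2\in K$. Measures. $\pi_1(x,y)=x$. $\mathcal{AB}$ is the set of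 finite signed Borel measures $\mu$ on $\Sigma$, with Jordan decomposition $\mu=\mu^+-\mu^-$, such that $\pi_{1*}\mu^{\pm}\ll m$. For positive $\mu\in\mathcal{AB}$, disintegrate (Rokhlin) along the fibers $\gamma=\{x\}\times K$ (identified with $x\in I$) as $\mu=\int\mu_\gamma\,\phi_1(\gamma)\,dm(\gamma)$ with $\mu_\gamma$ probabilities on $\gamma$ and $\phi_1=d(\pi_{1*}\mu)/dm$; let $\mu|_\gamma$ be the positive measure on $K$ obtained by projecting $\phi_1(\gamma)\mu_\gamma$ to $K$. For signed $\mu\in\mathcal{AB}$, $\mu|_\gamma=\mu^+|_\gamma-\mu^-|_\gamma$ and $\phi_1=\phi_1^+-\phi_1^-=d(\pi_{1*}\mu)/dm$. For a signed measure $\nu$ on $K$, $\|\nu\|_W=\sup\{|\int h\,d\nu|: h:K\to\mathbb R \text{ Lipschitz}, L(h)\le1, |h|_\infty\le1\}$, $L(h)$ being the best Lipschitz constant. $\mathcal L^1=\{\mu\in\mathcal{AB}:\|\mu\|_1:=\int\|\mu|_\gamma\|_W\,dm(\gamma)<\infty\}$. $BV_m$: for $h\in L^1_m$, $V(h)$ is the infimum, over all representatives $h^*$ of $h$, of the total variation of $h^*$ on $I$; $BV_m=\{h\in L^1_m: V(h)<\infty\}$. $S^1=\{\mu\in\mathcal L^1:\phi_1\in BV_m\}$. The transfer operator is $[F_*\mu](E)=\mu(F^{-1}(E))$. *)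

theory Defs
  imports "HOL-Probability.Probability"
begin

text \<open>
  The compact metric space \<open>K\<close> is the universe of a type of class \<^class>\<open>metric_space\<close>.
  Only the Borel sets of \<open>[0,1] \<times> K\<close> are used; the library's product metric generates the same
  topology, hence the same Borel sets, as the sum of the two metrics.
\<close>

definition unit_leb :: "real measure" where
  "unit_leb = restrict_space lborel {0..1}"

definition skew_space :: "(real \<times> 'k::metric_space) measure" where
  "skew_space = restrict_space borel ({0..1} \<times> UNIV)"


subsection \<open>The base maps\<close>

text \<open>The one-sided derivative \<open>f'(c)\<close> defined by continuity; the limit exists for a convex
  differentiable function on an interval \<open>(c,d)\<close>.\<close>

definition left_end_deriv :: "(real \<Rightarrow> real) \<Rightarrow> real \<Rightarrow> real" where
  "left_end_deriv f c = Lim (at_right c) (deriv f)"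

text \<open>The slopes \<open>f'(a\<^sub>i)\<close> are required to be positive because division by zero gives \<open>0\<close> in HOL:
  a vanishing slope makes the sum of reciprocals infinite in the usual reading.\<close>

definition class_T :: "(real \<Rightarrow> real) set" where
  "class_T = {f. \<exists>a b :: nat \<Rightarrow> real.
     (\<forall>i. a i < b i \<and> {a i<..<b i} \<subseteq> {0..1}) \<and>
     disjoint_family (\<lambda>i. {a i<..<b i}) \<and>
     emeasure lborel ({0..1} - (\<Union>i. {a i<..<b i})) = 0 \<and>
     (\<forall>i. f ` {a i<..<b i} \<subseteq> {0..1}) \<and>
     (\<forall>i. mono_on {a i<..<b i} f \<and> convex_on {a i<..<b i} f \<and>
          (\<forall>x\<in>{a i<..<b i}. f differentiable (at x)) \<and>
          (f \<longlongrightarrow> 0) (at_right (a i))) \<and>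
     (\<forall>i. 0 < left_end_deriv f (a i)) \<and> summable (\<lambda>i. 1 / left_end_deriv f (a i)) \<and>
     (\<not> 0 islimpt (range a \<union> range b) \<longrightarrow>
        (\<exists>\<beta>. 0 < \<beta> \<and> \<beta> < 1 \<and> left_end_deriv f 0 = 1 / \<beta>))}"


subsection \<open>Contraction along the fibers\<close>

definition fiber_contraction :: "(real \<times> 'k::metric_space \<Rightarrow> 'k) \<Rightarrow> bool" where
  "fiber_contraction G \<longleftrightarrow> (\<exists>\<alpha>. 0 \<le> \<alpha> \<and> \<alpha> < 1 \<and>
     (AE x in unit_leb. \<forall>z1 z2. dist (G (x, z1)) (G (x, z2)) \<le> \<alpha> * dist z1 z2))"


subsection \<open>Finite signed measures and their Jordan decomposition\<close>

definition signed_measure_on :: "'a measure \<Rightarrow> ('a set \<Rightarrow> real) \<Rightarrow> bool" where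
  "signed_measure_on M \<nu> \<longleftrightarrow> \<nu> {} = 0 \<and>
     (\<forall>A :: nat \<Rightarrow> 'a set. range A \<subseteq> sets M \<longrightarrow> disjoint_family A \<longrightarrow>
        (\<lambda>i. \<nu> (A i)) sums \<nu> (\<Union>i. A i))"

definition jordan_decomposition ::
  "'a measure \<Rightarrow> ('a set \<Rightarrow> real) \<Rightarrow> 'a measure \<Rightarrow> 'a measure \<Rightarrow> bool" where
  "jordan_decomposition M \<nu> P N \<longleftrightarrow>
     finite_measure P \<and> finite_measure N \<and> sets P = sets M \<and> sets N = sets M \<and>
     (\<forall>E\<in>sets M. \<nu> E = measure P E - measure N E) \<and>
     (\<exists>D\<in>sets M. emeasure P (space M - D) = 0 \<and> emeasure N D = 0)"

definition pos_part :: "'a measure \<Rightarrow> ('a set \<Rightarrow> real) \<Rightarrow> 'a measure" where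
  "pos_part M \<nu> = (THE P. \<exists>N. jordan_decomposition M \<nu> P N)"

definition neg_part :: "'a measure \<Rightarrow> ('a set \<Rightarrow> real) \<Rightarrow> 'a measure" where
  "neg_part M \<nu> = (THE N. \<exists>P. jordan_decomposition M \<nu> P N)"


subsection \<open>Marginals and disintegration along the fibers\<close>

definition marginal :: "(real \<times> 'k::metric_space) measure \<Rightarrow> real measure" where
  "marginal \<mu> = distr \<mu> unit_leb fst"

definition marginal_density :: "(real \<times> 'k::metric_space) measure \<Rightarrow> real \<Rightarrow> ennreal" where
  "marginal_density \<mu> = RN_deriv unit_leb (marginal \<mu>)"

definition disintegration ::
  "(real \<times> 'k::metric_space) measure \<Rightarrow> (real \<Rightarrow> 'k measure) \<Rightarrow> bool" where
  "disintegration \<mu> \<kappa> \<longleftrightarrow> \<kappa> \<in> unit_leb \<rightarrow>\<^sub>M prob_algebra borel \<and>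
     (\<forall>E\<in>sets skew_space.
        emeasure \<mu> E = (\<integral>\<^sup>+x. emeasure (\<kappa> x) {y. (x, y) \<in> E} * marginal_density \<mu> x \<partial>unit_leb))"

text \<open>The restriction of a positive measure to the fiber over \<open>x\<close>, projected to \<open>K\<close>. It does not
  depend, for almost every \<open>x\<close>, on the chosen disintegration.\<close>

definition fiber_measure ::
  "(real \<times> 'k::metric_space) measure \<Rightarrow> real \<Rightarrow> 'k measure" where
  "fiber_measure \<mu> x = scale_measure (marginal_density \<mu> x) ((SOME \<kappa>. disintegration \<mu> \<kappa>) x)"

definition AB :: "((real \<times> 'k::metric_space) set \<Rightarrow> real) set" where
  "AB = {\<mu>. signed_measure_on skew_space \<mu> \<and>
     absolutely_continuous unit_leb (marginal (pos_part skew_space \<mu>)) \<and>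
     absolutely_continuous unit_leb (marginal (neg_part skew_space \<mu>))}"

definition signed_density :: "((real \<times> 'k::metric_space) set \<Rightarrow> real) \<Rightarrow> real \<Rightarrow> real" where
  "signed_density \<mu> x =
     enn2real (marginal_density (pos_part skew_space \<mu>) x) -
     enn2real (marginal_density (neg_part skew_space \<mu>) x)"


subsection \<open>The norms\<close>

text \<open>The dual Lipschitz norm of the signed measure \<open>P - N\<close>, for positive measures \<open>P\<close> and \<open>N\<close>.\<close>

definition W_norm :: "'k::metric_space measure \<Rightarrow> 'k measure \<Rightarrow> ennreal" where
  "W_norm P N = (SUP h\<in>{h :: 'k \<Rightarrow> real. 1-lipschitz_on UNIV h \<and> (\<forall>y. \<bar>h y\<bar> \<le> 1)}.
     ennreal \<bar>(\<integral>y. h y \<partial>P) - (\<integral>y. h y \<partial>N)\<bar>)"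

definition L1_norm :: "((real \<times> 'k::metric_space) set \<Rightarrow> real) \<Rightarrow> ennreal" where
  "L1_norm \<mu> = (\<integral>\<^sup>+x. W_norm (fiber_measure (pos_part skew_space \<mu>) x)
                             (fiber_measure (neg_part skew_space \<mu>) x) \<partial>unit_leb)"

definition L1_space :: "((real \<times> 'k::metric_space) set \<Rightarrow> real) set" where
  "L1_space = {\<mu> \<in> AB. L1_norm \<mu> < \<infinity>}"

definition total_variation :: "(real \<Rightarrow> real) \<Rightarrow> ennreal" where
  "total_variation g = (SUP (n, t) \<in> UNIV \<times> {t :: nat \<Rightarrow> real. incseq t \<and> range t \<subseteq> {0..1}}.
     \<Sum>k<n. ennreal \<bar>g (t (Suc k)) - g (t k)\<bar>)"

definition essential_variation :: "(real \<Rightarrow> real) \<Rightarrow> ennreal" where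
  "essential_variation h = (INF g\<in>{g. AE x in unit_leb. g x = h x}. total_variation g)"

definition BV_m :: "(real \<Rightarrow> real) set" where
  "BV_m = {h. integrable unit_leb h \<and> essential_variation h < \<infinity>}"

definition S1_space :: "((real \<times> 'k::metric_space) set \<Rightarrow> real) set" where
  "S1_space = {\<mu> \<in> L1_space. signed_density \<mu> \<in> BV_m}"

end

(*
  The first marginal of an invariant measure is invariant under f, and its density has bounded variation.
  A distribution function H that is concave on [0,1] has density at most H'(0). The transfer operator
  H |-> sum_i (H o psi_i - H(a_i)), psi_i being the inverse branches, preserves concavity because f is
  convex on each branch, and sum_i 1/f'(a_i) < infinity together with the slope condition at 0 gives a
  Lasota-Yorke bound for H'(0). Cesaro averages and Arzela-Ascoli yield a fixed point, i.e. an
  invariant probability measure with decreasing bounded density.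
  If two invariant densities of bounded variation differ, the positive and the negative part of their
  difference are invariant and each is bounded below on some interval. Intervals inside a branch are
  expanded by f in the logarithmic length |d ln(x + e)|, so after finitely many steps they contain a
  left end point a_i, and one more step gives a lower bound on a neighbourhood of 0. This is impossible
  for two mutually singular measures.
  Contraction along the fibers makes an invariant measure determined by its marginal. Conversely, with
  x distributed by the invariant marginal and x = x_0, x_1, x_2, ... a random backward orbit, the limit
  Y of G(x_1, G(x_2, ... G(x_n, y))) exists, and the law of (x, Y) is invariant; the conditional law of
  Y given x is its disintegration.
*)
theory Submission
  imports Defs "HOL-Complex_Analysis.Great_Picard"
begin

text \<open>Away from 0 the slopes of \<open>f\<close> may be smaller than 1. Expansion is available
  only on branches that start below some \<open>d\<close>, where the reciprocal slopes sum to less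
  than 1: they form a small tail of the series if partition points accumulate at 0, and reduce to
  the single number \<beta> otherwise. A branch with \<open>a i >= d\<close> helps in another way,
  since its image starts at 0. Convexity and the limit 0 at \<open>a i\<close> give
  \<open>f x <= deriv f x * (x - a i)\<close>, hence
  \<open>deriv f x * (x + e) >= f x + deriv f x * (a i + e)\<close>. The last term exceeds
  \<open>e\<close> by a fixed factor, because of the slope if \<open>a i < d\<close> and because of
  the size of \<open>a i\<close> otherwise, once \<open>e\<close> is small. The same dichotomy
  yields the bound for the slope of \<open>H\<close> at 0. Concavity makes the class of distribution
  functions both stable and compact: a single number, the slope at 0, bounds every other slope. The
  measure that is found has a decreasing density, but its competitors in \<open>S1_space\<close>
  only have densities of bounded variation. Uniqueness therefore starts from a common continuity
  point of two densities, and not from monotonicity.\<close>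

section \<open>Finite measures on the unit interval\<close>

lemma space_unit_leb [simp]: "space unit_leb = {0..1}"
  by (simp add: unit_leb_def space_restrict_space)

lemma sets_unit_leb: "sets unit_leb = sets (restrict_space borel {0..1})"
  unfolding unit_leb_def by (simp cong: sets_restrict_space_cong)

lemma sets_unit_leb_iff: "A \<in> sets unit_leb \<longleftrightarrow> A \<in> sets borel \<and> A \<subseteq> {0..1}"
  unfolding sets_unit_leb by (subst sets_restrict_space_iff) auto

lemma emeasure_unit_leb: "A \<subseteq> {0..1} \<Longrightarrow> emeasure unit_leb A = emeasure lborel A"
  unfolding unit_leb_def by (rule emeasure_restrict_space) auto

lemma prob_space_unit_leb: "prob_space unit_leb"
  by standard (simp add: emeasure_unit_leb)

lemma id_measurable_unit_leb: "(\<lambda>x. x) \<in> unit_leb \<rightarrow>\<^sub>M borel"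
  by (rule measurableI) (auto simp: sets_unit_leb_iff)

lemma measure_unit_eqI:
  assumes M: "finite_measure M" "sets M = sets unit_leb"
    and N: "finite_measure N" "sets N = sets unit_leb"
    and eq: "\<And>x. x \<in> {0..1} \<Longrightarrow> measure M {0..x} = measure N {0..x}"
  shows "M = N"
proof -
  have sp: "space M = {0..1}" "space N = {0..1}"
    using sets_eq_imp_space_eq[OF M(2)] sets_eq_imp_space_eq[OF N(2)] by simp_all
  have meas: "(\<lambda>x. x) \<in> M \<rightarrow>\<^sub>M borel" "(\<lambda>x. x) \<in> N \<rightarrow>\<^sub>M borel"
    using id_measurable_unit_leb by (simp_all add: measurable_cong_sets[OF M(2) refl] measurable_cong_sets[OF N(2) refl])
  have fb: "finite_borel_measure (distr M borel (\<lambda>x. x))" "finite_borel_measure (distr N borel (\<lambda>x. x))"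
    using finite_measure.finite_measure_distr[OF M(1) meas(1)] finite_measure.finite_measure_distr[OF N(1) meas(2)]
    by (auto simp: finite_borel_measure_def finite_borel_measure_axioms_def)
  have "cdf (distr M borel (\<lambda>x. x)) x = cdf (distr N borel (\<lambda>x. x)) x" for x
  proof -
    have vi: "(\<lambda>x. x) -` {..x} \<inter> {0..1} = (if x < 0 then {} else {0..min x 1})" by auto
    show ?thesis
      using eq[of "min x 1"] unfolding cdf_def by (cases "x < 0") (simp_all add: measure_distr meas sp vi)
  qed
  then have eqd: "distr M borel (\<lambda>x. x) = distr N borel (\<lambda>x. x)"
    by (intro cdf_unique'[OF fb]) auto
  show ?thesis
  proof (rule measure_eqI)
    show "sets M = sets N" using M N by simp
    fix A assume "A \<in> sets M"
    then have A: "A \<in> sets borel" "A \<subseteq> {0..1}" unfolding M sets_unit_leb_iff by auto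
    have vi: "A \<inter> {0..1} = A" using A by auto
    show "emeasure M A = emeasure N A"
      using arg_cong[OF eqd, of "\<lambda>M. emeasure M A"] A meas by (simp add: emeasure_distr sp vi)
  qed
qed

text \<open>An inequality between measures does not pass to complements, so a generator argument
  cannot be applied to it directly. The difference of the two distribution functions is monotone and
  right continuous, hence belongs to a measure \<open>X\<close>, and the equality M + X = N does
  extend from intervals to all Borel sets.\<close>

lemma measure_unit_leI:
  assumes M: "finite_measure M" "sets M = sets unit_leb"
    and N: "finite_measure N" "sets N = sets unit_leb"
    and le: "\<And>u v. 0 \<le> u \<Longrightarrow> u \<le> v \<Longrightarrow> v \<le> 1 \<Longrightarrow> measure M {u<..v} \<le> measure N {u<..v}"
    and le0: "measure M {0} \<le> measure N {0}"
    and A: "A \<in> sets unit_leb"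
  shows "measure M A \<le> measure N A"
proof -
  interpret M: finite_measure M by fact
  interpret N: finite_measure N by fact
  have sp: "space M = {0..1}" "space N = {0..1}"
    using sets_eq_imp_space_eq[OF M(2)] sets_eq_imp_space_eq[OF N(2)] by simp_all
  have meas: "(\<lambda>x. x) \<in> M \<rightarrow>\<^sub>M borel" "(\<lambda>x. x) \<in> N \<rightarrow>\<^sub>M borel"
    using id_measurable_unit_leb by (simp_all add: measurable_cong_sets[OF M(2) refl] measurable_cong_sets[OF N(2) refl])
  define M' where "M' = distr M borel (\<lambda>x. x)"
  define N' where "N' = distr N borel (\<lambda>x. x)"
  have fb: "finite_borel_measure M'" "finite_borel_measure N'" unfolding M'_def N'_def
    using finite_measure.finite_measure_distr[OF M(1) meas(1)] finite_measure.finite_measure_distr[OF N(1) meas(2)]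
    by (auto simp: finite_borel_measure_def finite_borel_measure_axioms_def)
  interpret M': finite_borel_measure M' by fact
  interpret N': finite_borel_measure N' by fact
  have MM: "measure M' A = measure M (A \<inter> {0..1})" "measure N' A = measure N (A \<inter> {0..1})" if "A \<in> sets borel" for A
    using that meas by (simp_all add: M'_def N'_def measure_distr sp)
  define D where "D x = cdf N' x - cdf M' x" for x
  have Ioc: "measure M' {u<..v} \<le> measure N' {u<..v}" if "u \<le> v" for u v
  proof -
    consider "v < 0" | "u > 1" | "u < 0" "v \<ge> 0" | "0 \<le> u" "u \<le> 1" using \<open>u \<le> v\<close> by linarith
    then show ?thesis
    proof cases
      case 1
      then have "{u<..v} \<inter> {0..1} = {}" by auto
      then show ?thesis by (simp add: MM)
    next
      case 2
      then have "{u<..v} \<inter> {0..1} = {}" by auto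
      then show ?thesis by (simp add: MM)
    next
      case 3
      then have eq: "{u<..v} \<inter> {0..1} = {0} \<union> {0<..min v 1}" by auto
      have "measure M ({0} \<union> {0<..min v 1}) = measure M {0} + measure M {0<..min v 1}"
        by (rule M.finite_measure_Union) (auto simp: M sets_unit_leb_iff)
      moreover have "measure N ({0} \<union> {0<..min v 1}) = measure N {0} + measure N {0<..min v 1}"
        by (rule N.finite_measure_Union) (auto simp: N sets_unit_leb_iff)
      ultimately show ?thesis using le0 le[of 0 "min v 1"] 3 by (simp add: MM eq)
    next
      case 4
      then have eq: "{u<..v} \<inter> {0..1} = {u<..min v 1}" by auto
      show ?thesis using le[of u "min v 1"] 4 that by (simp add: MM eq)
    qed
  qed
  have D_mono: "D u \<le> D v" if "u \<le> v" for u v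
    using Ioc[OF that] that M'.cdf_diff_eq[of u v] N'.cdf_diff_eq[of u v]
    by (cases "u = v") (auto simp: D_def)
  have D_rc: "continuous (at_right x) D" for x
    unfolding D_def by (intro continuous_intros M'.cdf_is_right_cont N'.cdf_is_right_cont)
  define X where "X = interval_measure D"
  have key: "emeasure M' A + emeasure X A = emeasure N' A"
    if "A \<in> sigma_sets UNIV (range (\<lambda>(a, b). {a<..b::real}))" for A
  proof -
    have Dlim: "(D \<longlongrightarrow> 0) at_bot" "(D \<longlongrightarrow> measure N' UNIV - measure M' UNIV) at_top"
      using tendsto_diff[OF N'.cdf_lim_at_bot M'.cdf_lim_at_bot] tendsto_diff[OF N'.cdf_lim_at_top M'.cdf_lim_at_top]
      unfolding D_def by (simp_all add: N'.borel_UNIV M'.borel_UNIV)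
    have Dnn: "0 \<le> measure N' UNIV - measure M' UNIV"
    proof (rule tendsto_lowerbound[OF Dlim(2)])
      have "0 \<le> D x" for x
        by (rule tendsto_upperbound[OF Dlim(1)]) (auto simp: eventually_at_bot_linorder intro!: D_mono exI[of _ x])
      then show "\<forall>\<^sub>F x in at_top. 0 \<le> D x" by simp
    qed simp
    have XU: "emeasure X UNIV = ennreal (measure N' UNIV - measure M' UNIV)"
      unfolding X_def by (rule interval_measure_UNIV[OF D_mono D_rc Dlim Dnn])
    have "Int_stable (range (\<lambda>(a, b). {a<..b::real}))" by (auto simp: Int_stable_def)
    moreover have "range (\<lambda>(a, b). {a<..b::real}) \<subseteq> Pow UNIV" by simp
    ultimately show ?thesis using that
    proof (induction rule: sigma_sets_induct_disjoint)
      case (basic A)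
      then obtain u v where A: "A = {u<..v}" by auto
      show ?case
      proof (cases "u \<le> v")
        case True
        show ?thesis unfolding A X_def
          using Ioc[OF True] True D_mono[OF True] M'.cdf_diff_eq[of u v] N'.cdf_diff_eq[of u v]
          by (cases "u = v") (auto simp: emeasure_interval_measure_Ioc[OF _ D_mono D_rc] M'.emeasure_eq_measure N'.emeasure_eq_measure D_def
               simp flip: ennreal_plus)
      qed (simp add: A)
    next
      case empty show ?case by simp
    next
      case (compl A)
      have A: "A \<in> sets borel" using compl by (simp add: borel_sigma_sets_Ioc)
      have fX: "finite_measure X" using XU by (intro finite_measureI) (simp add: X_def)
      have sX: "sets X = sets borel" "space X = UNIV" by (simp_all add: X_def)
      have *: "emeasure M' (UNIV - A) = ennreal (measure M' UNIV - measure M' A)"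
        "emeasure N' (UNIV - A) = ennreal (measure N' UNIV - measure N' A)"
        "emeasure X (UNIV - A) = ennreal (measure X UNIV - measure X A)"
        using A N'.finite_measure_compl[of A] M'.finite_measure_compl[of A] finite_measure.finite_measure_compl[OF fX, of A]
        by (simp_all add: M'.emeasure_eq_measure N'.emeasure_eq_measure N'.borel_UNIV M'.borel_UNIV finite_measure.emeasure_eq_measure[OF fX] sX M'.M_is_borel N'.M_is_borel)
      have "measure X UNIV = measure N' UNIV - measure M' UNIV" using XU Dnn by (simp add: measure_def)
      moreover have "measure M' A + measure X A = measure N' A"
        using compl(2) by (simp add: M'.emeasure_eq_measure N'.emeasure_eq_measure finite_measure.emeasure_eq_measure[OF fX] flip: ennreal_plus)
      moreover have "measure M' A \<le> measure M' UNIV" "measure X A \<le> measure X UNIV"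
        using M'.bounded_measure[of A] finite_measure.bounded_measure[OF fX, of A] by (simp_all add: M'.borel_UNIV X_def)
      ultimately show ?case unfolding * by (simp flip: ennreal_plus)
    next
      case (union A)
      have "range A \<subseteq> sets borel" using union by (simp add: borel_sigma_sets_Ioc)
      then have "emeasure M' (\<Union>i. A i) = (\<Sum>i. emeasure M' (A i))" "emeasure N' (\<Union>i. A i) = (\<Sum>i. emeasure N' (A i))"
        "emeasure X (\<Union>i. A i) = (\<Sum>i. emeasure X (A i))"
        using union by (auto intro!: suminf_emeasure[symmetric] simp: X_def)
      then show ?case using union by (simp add: suminf_add)
    qed
  qed
  have "A \<in> sets borel" "A \<inter> {0..1} = A" using A by (auto simp: sets_unit_leb_iff)
  moreover from this have "emeasure M' A + emeasure X A = emeasure N' A"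
    by (intro key) (simp add: borel_sigma_sets_Ioc)
  then have "emeasure M' A \<le> emeasure N' A"
    unfolding le_iff_add by metis
  ultimately show ?thesis using MM[of A]
    by (simp add: M'.emeasure_eq_measure N'.emeasure_eq_measure)
qed

section \<open>Convex branches\<close>

lemma mult_cSup_le:
  fixes u B :: real
  assumes "S \<noteq> {}" "0 \<le> u" "\<And>s. s \<in> S \<Longrightarrow> u * s \<le> B"
  shows "u * Sup S \<le> B"
proof (cases "u = 0")
  case True
  then show ?thesis using assms by force
next
  case False
  then have "Sup S \<le> B / u"
    using assms by (intro cSup_least) (auto simp: field_simps)
  then show ?thesis using False assms by (simp add: field_simps)
qed

text \<open>At the end points \<open>a i\<close>, \<open>b i\<close> the map has arbitrary values in
  the unit interval, so every argument stays inside the open branches and reaches the end points by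
  one-sided limits or discards them as null sets.\<close>

locale branched_map =
  fixes f :: "real \<Rightarrow> real" and a b :: "nat \<Rightarrow> real"
  assumes a_less_b: "a i < b i"
    and branch_subset: "{a i<..<b i} \<subseteq> {0..1}"
    and branch_disjoint: "disjoint_family (\<lambda>i. {a i<..<b i})"
    and branch_full: "emeasure lborel ({0..1} - (\<Union>i. {a i<..<b i})) = 0"
    and f_mono: "mono_on {a i<..<b i} f"
    and f_convex: "convex_on {a i<..<b i} f"
    and f_diff: "x \<in> {a i<..<b i} \<Longrightarrow> f differentiable (at x)"
    and f_lim: "(f \<longlongrightarrow> 0) (at_right (a i))"
    and slope_pos: "0 < left_end_deriv f (a i)"
    and slope_summable: "summable (\<lambda>i. 1 / left_end_deriv f (a i))"
    and slope_zero: "\<not> 0 islimpt (range a \<union> range b) \<Longrightarrow>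
        \<exists>\<beta>. 0 < \<beta> \<and> \<beta> < 1 \<and> left_end_deriv f 0 = 1 / \<beta>"
    and f_measurable [measurable]: "f \<in> unit_leb \<rightarrow>\<^sub>M unit_leb"
begin

abbreviation branch :: "nat \<Rightarrow> real set" where
  "branch i \<equiv> {a i<..<b i}"

definition slope :: "nat \<Rightarrow> real" where
  "slope i = left_end_deriv f (a i)"

text \<open>The inverse of the \<open>i\<close>-th branch, extended to all arguments: branches need
  not be onto, so it stays at \<open>b i\<close> beyond the image of the branch, and the inserted
  \<open>a i\<close> is its value where no point of the branch is admissible.\<close>

definition psi :: "nat \<Rightarrow> real \<Rightarrow> real" where
  "psi i x = Sup (insert (a i) {t \<in> branch i. f t \<le> x})"

lemma slope_gt0: "0 < slope i" and summable_slope: "summable (\<lambda>i. 1 / slope i)"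
  using slope_pos slope_summable by (auto simp: slope_def)

lemma a_ge_0: "0 \<le> a i" and b_le_1: "b i \<le> 1"
  using branch_subset[of i] a_less_b[of i]
  by (auto simp: greaterThanLessThan_subseteq_atLeastAtMost_iff)

lemma f_range: "x \<in> {0..1} \<Longrightarrow> 0 \<le> f x \<and> f x \<le> 1"
  using measurable_space[OF f_measurable, of x] by auto

lemma branch_in_unit: "x \<in> branch i \<Longrightarrow> x \<in> {0..1}"
  using branch_subset by blast

lemma f_deriv: "x \<in> branch i \<Longrightarrow> (f has_real_derivative deriv f x) (at x)"
  using f_diff by (simp add: DERIV_deriv_iff_real_differentiable)

lemma tangent:
  assumes "x \<in> branch i" "y \<in> branch i"
  shows "deriv f x * (y - x) \<le> f y - f x"
proof (rule convex_on_imp_above_tangent[OF f_convex[of i]])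
  show "(f has_real_derivative deriv f x) (at x within branch i)"
    by (rule has_field_derivative_at_within[OF f_deriv[OF assms(1)]])
qed (use assms in \<open>auto simp: interior_open\<close>)

lemma deriv_mono:
  assumes "x \<in> branch i" "y \<in> branch i" "x \<le> y"
  shows "deriv f x \<le> deriv f y"
proof (cases "x = y")
  case False
  have "deriv f x * (y - x) \<le> deriv f y * (y - x)"
    using tangent[OF assms(1,2)] tangent[OF assms(2,1)] by (simp add: algebra_simps)
  then show ?thesis using False assms by simp
qed simp

lemma deriv_nonneg:
  assumes "x \<in> branch i"
  shows "0 \<le> deriv f x"
proof -
  define y where "y = (a i + x) / 2"
  have y: "y \<in> branch i" "y < x" using assms by (auto simp: y_def)
  have "f y \<le> f x" using f_mono[of i] y assms by (auto simp: mono_on_def)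
  then have "0 \<le> deriv f x * (x - y)" using tangent[OF y(1) assms]  tangent[OF assms y(1)]
    by (simp add: algebra_simps)
  then show ?thesis using y by (simp add: zero_le_mult_iff)
qed

lemma eventually_branch: "p \<in> branch i \<Longrightarrow> eventually (\<lambda>t. t \<in> branch i \<and> t < p) (at_right (a i))"
  by (subst eventually_at_right[of _ p]) (auto intro!: exI[of _ p])

text \<open>\<open>left_end_deriv\<close> is a \<open>Lim\<close> and says something only if the
  limit exists. The derivative is nonnegative and, by convexity, nondecreasing on the branch, so it
  tends to its infimum.\<close>

lemma deriv_tendsto: "(deriv f \<longlongrightarrow> slope i) (at_right (a i))"
proof -
  define L where "L = Inf (deriv f ` branch i)"
  have bdd: "bdd_below (deriv f ` branch i)"
    by (rule bdd_belowI[of _ 0]) (auto intro: deriv_nonneg[of _ i])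
  have ne: "deriv f ` branch i \<noteq> {}" using a_less_b[of i] by simp
  have "(deriv f \<longlongrightarrow> L) (at_right (a i))"
  proof (rule order_tendstoI)
    fix e assume "e < L"
    have "eventually (\<lambda>t. t \<in> branch i) (at_right (a i))"
      using eventually_branch[of "(a i + b i)/2" i] a_less_b[of i] by (auto elim: eventually_mono)
    then show "eventually (\<lambda>t. e < deriv f t) (at_right (a i))"
    proof eventually_elim
      case (elim t)
      then show ?case using cInf_lower[OF _ bdd, of "deriv f t"] \<open>e < L\<close> by (auto simp: L_def)
    qed
  next
    fix e assume "L < e"
    then obtain p where p: "p \<in> branch i" "deriv f p < e"
      using cInf_lessD[OF ne, of e] by (auto simp: L_def)
    from eventually_branch[OF p(1)]
    show "eventually (\<lambda>t. deriv f t < e) (at_right (a i))"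
    proof eventually_elim
      case (elim t)
      then show ?case using deriv_mono[of t i p] p by auto
    qed
  qed
  then show ?thesis
    unfolding slope_def left_end_deriv_def by (simp add: tendsto_Lim)
qed

lemma slope_le_deriv:
  assumes "x \<in> branch i"
  shows "slope i \<le> deriv f x"
  by (rule tendsto_upperbound[OF deriv_tendsto])
     (use eventually_branch[OF assms] in \<open>auto elim!: eventually_mono intro: deriv_mono[OF _ assms]\<close>)

lemma slope_diff:
  assumes "s \<in> branch i" "t \<in> branch i" "s \<le> t"
  shows "slope i * (t - s) \<le> f t - f s"
  using tangent[OF assms(1,2)] mult_right_mono[OF slope_le_deriv[OF assms(1)], of "t - s"] assms by linarith

lemma f_strict_mono: "s \<in> branch i \<Longrightarrow> t \<in> branch i \<Longrightarrow> s < t \<Longrightarrow> f s < f t"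
  using slope_diff[of s i t] mult_pos_pos[OF slope_gt0[of i], of "t - s"] by auto

lemma f_less_iff: "s \<in> branch i \<Longrightarrow> t \<in> branch i \<Longrightarrow> f s < f t \<longleftrightarrow> s < t"
  using f_strict_mono by (metis linorder_less_linear order_less_asym)

lemma f_le_iff: "s \<in> branch i \<Longrightarrow> t \<in> branch i \<Longrightarrow> f s \<le> f t \<longleftrightarrow> s \<le> t"
  using f_less_iff by (meson linorder_not_less)

lemma slope_le_f:
  assumes "t \<in> branch i"
  shows "slope i * (t - a i) \<le> f t"
proof -
  have "((\<lambda>s. slope i * (t - s) + f s) \<longlongrightarrow> slope i * (t - a i) + 0) (at_right (a i))"
    by (intro tendsto_intros f_lim)
  then have "slope i * (t - a i) + 0 \<le> f t"
  proof (rule tendsto_upperbound)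
    show "\<forall>\<^sub>F s in at_right (a i). slope i * (t - s) + f s \<le> f t"
      using eventually_branch[OF assms]
    proof eventually_elim
      case (elim s)
      then show ?case using slope_diff[OF _ assms, of s] by auto
    qed
  qed simp
  then show ?thesis by simp
qed

lemma f_pos: "t \<in> branch i \<Longrightarrow> 0 < f t"
  using slope_le_f[of t i] mult_pos_pos[OF slope_gt0[of i], of "t - a i"] by auto

text \<open>The tangent at \<open>t\<close> lies below the graph; this is read off at the left end
  point, where \<open>f\<close> tends to 0. It is the inequality behind
  \<open>log_expansion\<close>.\<close>

lemma f_le_deriv:
  assumes "t \<in> branch i"
  shows "f t \<le> deriv f t * (t - a i)"
proof -
  have "((\<lambda>s. deriv f t * (t - s) + f s) \<longlongrightarrow> deriv f t * (t - a i) + 0) (at_right (a i))"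
    by (intro tendsto_intros f_lim)
  then have "f t \<le> deriv f t * (t - a i) + 0"
    by (rule tendsto_lowerbound)
       (use eventually_branch[OF assms] tangent[OF assms] in \<open>auto elim!: eventually_mono simp: algebra_simps\<close>)
  then show ?thesis by simp
qed

text \<open>Says without division that the chord slope \<open>f t / (t - a i)\<close> from the end
  point is nondecreasing. It is convexity with one point at \<open>a i\<close>, where
  \<open>f\<close> has a limit but no prescribed value.\<close>

lemma f_star:
  assumes "w \<in> branch i" "t \<in> branch i" "w \<le> t"
  shows "f w * (t - a i) \<le> f t * (w - a i)"
proof -
  have "f w * (t - w) \<le> deriv f w * (w - a i) * (t - w)"
    using f_le_deriv[OF assms(1)] assms by (intro mult_right_mono) auto
  also have "\<dots> = deriv f w * (t - w) * (w - a i)" by simp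
  also have "\<dots> \<le> (f t - f w) * (w - a i)"
    using tangent[OF assms(1,2)] assms by (intro mult_right_mono) auto
  finally show ?thesis by (simp add: algebra_simps)
qed

lemma isCont_f: "t \<in> branch i \<Longrightarrow> isCont f t"
  using f_deriv DERIV_isCont by blast

lemma psi_ge: "a i \<le> psi i x" and psi_le_b: "psi i x \<le> b i"
  and psi_upper: "t \<in> branch i \<Longrightarrow> f t \<le> x \<Longrightarrow> t \<le> psi i x"
proof -
  have bdd: "bdd_above (insert (a i) {t \<in> branch i. f t \<le> x})"
    by (rule bdd_aboveI[of _ "b i"]) (use a_less_b[of i] in auto)
  show "a i \<le> psi i x" unfolding psi_def by (rule cSup_upper[OF _ bdd]) simp
  show "psi i x \<le> b i" unfolding psi_def by (rule cSup_least) (use a_less_b[of i] in auto)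
  show "t \<le> psi i x" if "t \<in> branch i" "f t \<le> x" unfolding psi_def by (rule cSup_upper[OF _ bdd]) (use that in simp)
qed

lemma psi_in_unit: "psi i x \<in> {0..1}"
  using psi_ge[of i x] psi_le_b[of i x] a_ge_0[of i] b_le_1[of i] by auto

lemma less_psi: "t \<in> branch i \<Longrightarrow> t < psi i x \<Longrightarrow> f t \<le> x"
proof -
  assume t: "t \<in> branch i" "t < psi i x"
  then obtain s where "s \<in> insert (a i) {t \<in> branch i. f t \<le> x}" "t < s"
    unfolding psi_def using less_cSupE by blast
  then show ?thesis using t f_strict_mono[of t i s] by auto
qed

lemma psi_iff:
  assumes t: "t \<in> branch i"
  shows "f t \<le> x \<longleftrightarrow> t \<le> psi i x"
proof
  assume le: "t \<le> psi i x"
  \<comment> \<open>The point \<open>t\<close> may be the supremum \<open>psi i x\<close> itself, so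
    the bound, known strictly below the supremum, is carried to \<open>t\<close> by continuity from
    the left.\<close>
  have "(f \<longlongrightarrow> f t) (at_left t)"
    using isCont_f[OF t] by (simp add: isCont_def filterlim_at_split)
  then show "f t \<le> x"
  proof (rule tendsto_upperbound)
    have "eventually (\<lambda>s. s \<in> branch i \<and> s < t) (at_left t)"
      by (subst eventually_at_left[of "a i"]) (use t in \<open>auto intro!: exI[of _ "a i"]\<close>)
    then show "eventually (\<lambda>s. f s \<le> x) (at_left t)"
      by eventually_elim (use le less_psi in auto)
  qed simp
qed (rule psi_upper[OF t])

lemma psi_f: "t \<in> branch i \<Longrightarrow> psi i (f t) = t"
  using psi_upper[of t i "f t"] less_psi[of "(t + psi i (f t)) / 2" i "f t"] psi_le_b[of i "f t"]
    f_less_iff[of t i "(t + psi i (f t)) / 2"]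
  by (cases "t < psi i (f t)") auto

lemma psi_mono: "x \<le> y \<Longrightarrow> psi i x \<le> psi i y"
  unfolding psi_def
  by (rule cSup_subset_mono) (use a_less_b[of i] in \<open>auto intro!: bdd_aboveI[of _ "b i"]\<close>)

lemma psi_diff_le: "0 \<le> x \<Longrightarrow> psi i x - a i \<le> x / slope i"
proof -
  assume x: "0 \<le> x"
  have "psi i x \<le> a i + x / slope i"
    unfolding psi_def
  proof (rule cSup_least)
    fix t assume "t \<in> insert (a i) {t \<in> branch i. f t \<le> x}"
    then show "t \<le> a i + x / slope i"
      using slope_le_f[of t i] slope_gt0[of i] x by (auto simp: field_simps)
  qed simp
  then show ?thesis by simp
qed

lemma psi_0: "psi i 0 = a i"
  using psi_diff_le[of 0 i] psi_ge[of i 0] by simp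

text \<open>The inverse of an increasing convex function is concave, and cutting it off at
  \<open>b i\<close> preserves this. Both facts are treated at once: convex combinations of
  admissible points for \<open>x\<close> and \<open>y\<close> are admissible for the combined
  argument, and suprema are taken in one variable after the other.\<close>

lemma psi_concave: "concave_on {0..1} (psi i)"
  unfolding concave_on_iff
proof (intro conjI ballI allI impI)
  show "convex {0..1::real}" by simp
  fix x y u v :: real
  assume *: "x \<in> {0..1}" "y \<in> {0..1}" "0 \<le> u" "0 \<le> v" "u + v = 1"
  define z where "z = u * x + v * y"
  let ?S = "\<lambda>x. insert (a i) {t \<in> branch i. f t \<le> x}"
  \<comment> \<open>If one of the two admissible points is the inserted \<open>a i\<close>,
    convexity on the open branch does not apply and \<open>f_star\<close> takes its place.\<close>
  have mixed: "v * t + u * a i \<le> psi i (u * x + v * y)"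
    if "t \<in> branch i" "f t \<le> y" "0 \<le> x" "0 \<le> y" "0 \<le> u" "0 \<le> v" "u + v = 1" for t u v x y
  proof (cases "v = 0")
    case True
    then show ?thesis using psi_ge[of i "u * x + v * y"] that by simp
  next
    case False
    define w where "w = v * t + u * a i"
    have wa: "w - a i = v * (t - a i)" using that by (simp add: w_def algebra_simps) (metis distrib_left mult.commute mult_1)
    have "v * (t - a i) > 0" using False that by auto
    moreover have "v * (t - a i) \<le> 1 * (t - a i)" using that by (intro mult_right_mono) auto
    ultimately have w: "w \<in> branch i" "w \<le> t" using wa that by auto
    have "f w * (t - a i) \<le> (f t * v) * (t - a i)"
      using f_star[OF w(1) that(1) w(2)] by (simp add: wa mult.assoc)
    then have "f w \<le> f t * v" using that by auto
    also have "\<dots> \<le> y * v" using that by (intro mult_right_mono) auto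
    also have "\<dots> \<le> u * x + v * y" using that by (simp add: mult.commute)
    finally show ?thesis using psi_upper[OF w(1)] by (simp add: w_def)
  qed
  have le: "u * s + v * t \<le> psi i z" if "s \<in> ?S x" "t \<in> ?S y" for s t
  proof -
    consider "s = a i" "t = a i" | "s = a i" "t \<in> branch i" "f t \<le> y" | "t = a i" "s \<in> branch i" "f s \<le> x"
      | "s \<in> branch i" "f s \<le> x" "t \<in> branch i" "f t \<le> y" using \<open>s \<in> ?S x\<close> \<open>t \<in> ?S y\<close> by auto
    then show ?thesis
    proof cases
      case 1
      then have "u * s + v * t = a i" using * by (metis distrib_right mult_1)
      then show ?thesis using psi_ge by simp
    next
      case 2
      then show ?thesis using mixed[of t y x u v] * by (simp add: z_def)
    next
      case 3
      then show ?thesis using mixed[of s x y v u] * by (simp add: z_def add.commute)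
    next
      case 4
      have "u * s + v * t \<in> branch i"
        using convexD[OF convex_real_interval(8)] 4 * by (metis real_scaleR_def)
      moreover have "f (u * s + v * t) \<le> u * f s + v * f t"
        using f_convex[of i] 4 * by (auto simp: convex_on_def)
      moreover have "u * f s + v * f t \<le> z" unfolding z_def
        by (intro add_mono mult_left_mono) (use 4 * in auto)
      ultimately show ?thesis using psi_upper[of "u * s + v * t" i z] by linarith
    qed
  qed
  have "u * s \<le> psi i z - v * t" if "s \<in> ?S x" "t \<in> ?S y" for s t
    using le[OF that] by linarith
  then have le': "u * psi i x \<le> psi i z - v * t" if "t \<in> ?S y" for t
    unfolding psi_def[of i x] using that * by (intro mult_cSup_le) auto
  have "v * t \<le> psi i z - u * psi i x" if "t \<in> ?S y" for t
    using le'[OF that] by linarith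
  then have "v * psi i y \<le> psi i z - u * psi i x"
    unfolding psi_def[of i y] using * by (intro mult_cSup_le) auto
  then show "u * psi i x + v * psi i y \<le> psi i (u *\<^sub>R x + v *\<^sub>R y)"
    by (simp add: z_def)
qed

lemma branch_unique: "x \<in> branch i \<Longrightarrow> x \<in> branch j \<Longrightarrow> i = j"
  using branch_disjoint unfolding disjoint_family_on_def by blast

lemma endpoint_notin_branch: "a j \<notin> branch i" "b j \<notin> branch i"
proof -
  show "a j \<notin> branch i"
  proof
    assume *: "a j \<in> branch i"
    then have "i \<noteq> j" by auto
    moreover have "(a j + min (b i) (b j)) / 2 \<in> branch i" "(a j + min (b i) (b j)) / 2 \<in> branch j"
      using * a_less_b[of j] by auto
    ultimately show False using branch_unique by blast
  qed
  show "b j \<notin> branch i"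
  proof
    assume *: "b j \<in> branch i"
    then have "i \<noteq> j" by auto
    moreover have "(b j + max (a i) (a j)) / 2 \<in> branch i" "(b j + max (a i) (a j)) / 2 \<in> branch j"
      using * a_less_b[of j] by auto
    ultimately show False using branch_unique by blast
  qed
qed

lemma branch_meets:
  assumes "p < q" "0 \<le> p" "q \<le> 1"
  shows "\<exists>i x. x \<in> branch i \<and> p < x \<and> x < q"
proof (rule ccontr)
  assume "\<not> ?thesis"
  then have "{p<..<q} \<subseteq> {0..1} - (\<Union>i. branch i)" using assms by force
  then have "emeasure lborel {p<..<q} \<le> emeasure lborel ({0..1} - (\<Union>i. branch i))"
    by (rule emeasure_mono) auto
  then show False using assms branch_full by simp
qed

section \<open>Where the expansion comes from\<close>

text \<open>This is where the condition at 0 enters. If partition points accumulate at 0, only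
  branches far out in the enumeration can start close to 0, and their reciprocal slopes form a small
  tail. Otherwise exactly one branch starts near 0; it starts at 0 and has slope 1 /
  \<beta>.\<close>

lemma small_slopes:
  obtains d l where "0 < d" "0 < l" "l < 1" "(\<Sum>i. if a i < d then 1 / slope i else 0) \<le> l"
    "\<And>i. a i < d \<Longrightarrow> 1 / slope i \<le> l"
proof -
  have nn: "0 \<le> 1 / slope i" for i using slope_gt0[of i] by simp
  have summ: "summable (\<lambda>i. if a i < d then 1 / slope i else 0)" for d
    by (rule summable_comparison_test[OF _ summable_slope]) (use nn in auto)
  have sel: "1 / slope i \<le> l" if "a i < d" "(\<Sum>i. if a i < d then 1 / slope i else 0) \<le> l" for i d l
    using sum_le_suminf[OF summ[of d], of "{i}"] that nn by force
  have "\<exists>d>0. \<exists>l>0. l < 1 \<and> (\<Sum>i. if a i < d then 1 / slope i else 0) \<le> l"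
  proof (cases "0 islimpt (range a \<union> range b)")
    case True
    \<comment> \<open>A branch starting at 0 would keep a whole right neighbourhood of 0 free of
      partition points.\<close>
    have apos: "0 < a i" for i
    proof (rule ccontr)
      assume "\<not> 0 < a i"
      then have a0: "a i = 0" using a_ge_0[of i] by simp
      then have "0 < b i" using a_less_b[of i] by simp
      then obtain y where y: "y \<in> range a \<union> range b" "y \<noteq> 0" "dist y 0 < b i"
        using True unfolding islimpt_approachable by blast
      have "0 \<le> b j" for j using a_ge_0[of j] a_less_b[of j] by linarith
      then have "0 \<le> y" using y a_ge_0 by auto
      then have "y \<in> branch i" using y a0 by auto
      then show False using y endpoint_notin_branch by auto
    qed
    obtain N where N: "norm (\<Sum>i. 1 / slope (i + N)) < 1/2"
      using suminf_exist_split[OF _ summable_slope, of "1/2"] by auto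
    \<comment> \<open>With this \<open>d\<close>, the first \<open>N\<close> branches start at
      \<open>d\<close> or later and drop out of the sum.\<close>
    define d where "d = Min (insert 1 (a ` {..<N}))"
    have d: "0 < d" unfolding d_def using apos by (subst Min_gr_iff) auto
    have dN: "d \<le> a i" if "i < N" for i unfolding d_def using that by (intro Min_le) auto
    have "(\<Sum>i. if a i < d then 1 / slope i else 0) = (\<Sum>i. if a (i + N) < d then 1 / slope (i + N) else 0) + (\<Sum>i<N. if a i < d then 1 / slope i else 0)"
      by (rule suminf_split_initial_segment[OF summ])
    also have "(\<Sum>i<N. if a i < d then 1 / slope i else 0) = 0"
    proof (intro sum.neutral ballI)
      fix i assume "i \<in> {..<N}"
      then show "(if a i < d then 1 / slope i else 0) = 0" using dN[of i] by simp
    qed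
    also have "(\<Sum>i. if a (i + N) < d then 1 / slope (i + N) else 0) \<le> (\<Sum>i. 1 / slope (i + N))"
      by (rule suminf_le) (use nn summ[of d] summable_slope in \<open>auto intro: summable_ignore_initial_segment[where f = "\<lambda>i. if a i < d then 1 / slope i else 0"] summable_ignore_initial_segment[where f = "\<lambda>i. 1 / slope i"]\<close>)
    also have "\<dots> \<le> 1/2" using N by simp
    finally show ?thesis using d by (intro exI[of _ d] conjI exI[of _ "1/2"]) auto
  next
    case False
    then obtain \<beta> where \<beta>: "0 < \<beta>" "\<beta> < 1" "left_end_deriv f 0 = 1 / \<beta>" using slope_zero by blast
    \<comment> \<open>No partition point other than 0 lies within \<open>e\<close> of 0, so a branch
      that starts below \<open>e\<close> starts at 0; disjointness leaves room for only one.\<close>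
    obtain e where e: "e > 0" "\<And>y. y \<in> range a \<union> range b \<Longrightarrow> y \<noteq> 0 \<Longrightarrow> e \<le> dist y 0"
      using False unfolding islimpt_approachable by (meson not_less)
    have a0: "a i = 0" if "a i < e" for i using e(2)[of "a i"] that a_ge_0[of i] by force
    obtain j x where j: "x \<in> branch j" "0 < x" "x < min e 1" using branch_meets[of 0 "min e 1"] e by auto
    then have aj: "a j = 0" by (intro a0) auto
    have uniq: "i = j" if "a i < e" for i
    proof -
      have "min (b i) (b j) / 2 \<in> branch i" "min (b i) (b j) / 2 \<in> branch j"
        using a0[OF that] aj a_less_b[of i] a_less_b[of j] by auto
      then show ?thesis by (rule branch_unique)
    qed
    have "(\<lambda>i. if a i < e then 1 / slope i else 0) = (\<lambda>i. if i = j then \<beta> else 0)"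
      using uniq aj e \<beta> by (auto simp: fun_eq_iff slope_def)
    then have "(\<Sum>i. if a i < e then 1 / slope i else 0) = \<beta>"
      using sums_unique[OF sums_single[of j "\<lambda>_. \<beta>"]] by simp
    then show ?thesis using e \<beta> by auto
  qed
  then show thesis using that sel by blast
qed

text \<open>In the metric dx / (x + e) the local expansion factor is
  \<open>deriv f x * (x + e) / (f x + e)\<close>. It is at least \<open>k\<close> at every point of
  every branch, although \<open>deriv f\<close> itself may be below 1.\<close>

lemma log_expansion:
  obtains e k :: real where "0 < e" "1 < k"
    "\<And>i p q. p \<in> branch i \<Longrightarrow> q \<in> branch i \<Longrightarrow> p < q \<Longrightarrow>
       k * (ln (q + e) - ln (p + e)) \<le> ln (f q + e) - ln (f p + e)"
proof -
  obtain d l where dl: "0 < d" "0 < l" "l < 1" "\<And>i. a i < d \<Longrightarrow> 1 / slope i \<le> l"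
    by (rule small_slopes) blast
  define S where "S = (\<Sum>i. 1 / slope i)"
  have nn: "0 < 1 / slope i" for i using slope_gt0[of i] by simp
  have S: "1 / slope i \<le> S" for i
    using sum_le_suminf[OF summable_slope, of "{i}"] nn by (force simp: S_def intro: less_imp_le)
  have Spos: "0 < S" using S[of 0] nn[of 0] by linarith
  \<comment> \<open>A lower bound for all slopes at once, since each reciprocal slope is at most the
    whole sum.\<close>
  define c where "c = 1 / S"
  have c: "0 < c" "c \<le> slope i" for i
    using S[of i] Spos slope_gt0[of i] by (auto simp: c_def field_simps)
  \<comment> \<open>Chosen with \<open>2 * e <= c * d\<close>, so that a branch with
    \<open>a i >= d\<close> satisfies \<open>deriv f x * (a i + e) >= 2 * e\<close>.\<close>
  define e where "e = min 1 (c * d / 2)"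
  have e: "0 < e" "e \<le> 1" "2 * e \<le> c * d" using c dl by (auto simp: e_def)
  \<comment> \<open>The surplus obtained in both cases is \<open>e * (1 - l)\<close>, while
    \<open>f x + e\<close> is at most 2; hence the half.\<close>
  define k where "k = 1 + e * (1 - l) / 2"
  have k: "1 < k" using e dl by (simp add: k_def)
  have main: "k * (f x + e) \<le> deriv f x * (x + e)" if x: "x \<in> branch i" for i x
  proof -
    have f01: "0 \<le> f x" "f x \<le> 1" using f_range[OF branch_in_unit[OF x]] by auto
    have "(k - 1) * (f x + e) \<le> (k - 1) * 2" using k f01 e by (intro mult_left_mono) auto
    then have k1: "(k - 1) * (f x + e) \<le> e * (1 - l)" by (simp add: k_def)
    have "deriv f x * (x + e) = deriv f x * (x - a i) + deriv f x * (a i + e)" by (simp add: algebra_simps)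
    moreover have "f x \<le> deriv f x * (x - a i)" by (rule f_le_deriv[OF x])
    moreover have "e + e * (1 - l) \<le> deriv f x * (a i + e)"
    proof (cases "a i < d")
      case True
      \<comment> \<open>Here the slope alone suffices: it gives \<open>e / l\<close>, and
        \<open>1 / l >= 2 - l\<close> turns this into \<open>e + e * (1 - l)\<close>.\<close>
      have "1 / l \<le> deriv f x"
        using dl(4)[OF True] slope_le_deriv[OF x] slope_gt0[of i] dl by (auto simp: field_simps intro: order_trans)
      then have "1 / l * e \<le> deriv f x * (a i + e)"
        using a_ge_0[of i] e dl by (intro mult_mono) (auto intro: deriv_nonneg[OF x])
      moreover have "e + e * (1 - l) \<le> 1 / l * e"
      proof -
        have "(2 - l) * l \<le> 1" using zero_le_power2[of "1 - l"] by (simp add: power2_eq_square algebra_simps)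
        then have "2 - l \<le> 1 / l" using dl by (simp add: field_simps)
        then have "(2 - l) * e \<le> 1 / l * e" using e by (intro mult_right_mono) auto
        then show ?thesis by (simp add: algebra_simps)
      qed
      ultimately show ?thesis by linarith
    next
      case False
      have "c * d \<le> deriv f x * (a i + e)"
        using False c slope_le_deriv[OF x] e dl by (intro mult_mono) (auto intro: order_trans deriv_nonneg[OF x])
      moreover have "e * (1 - l) \<le> e * 1" using e dl by (intro mult_left_mono) auto
      ultimately show ?thesis using e by linarith
    qed
    ultimately show ?thesis using k1 by (simp add: algebra_simps)
  qed
  show thesis
  proof (rule that[OF e(1) k])
    fix i p q assume pq: "p \<in> branch i" "q \<in> branch i" "p < q"
    define g where "g x = ln (f x + e) - k * ln (x + e)" for x
    have "g p \<le> g q"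
    proof (rule DERIV_nonneg_imp_nondecreasing[where f = g])
      fix x assume "p \<le> x" "x \<le> q"
      then have x: "x \<in> branch i" using pq by auto
      then have pos: "0 < f x + e" "0 < x + e" using f_pos[OF x] e a_ge_0[of i] by auto
      have "(g has_real_derivative (1 / (f x + e) * deriv f x - k * (1 / (x + e)))) (at x)"
        unfolding g_def using pos by (auto intro!: derivative_eq_intros f_deriv[OF x])
      moreover have "0 \<le> 1 / (f x + e) * deriv f x - k * (1 / (x + e))"
      proof -
        have "k \<le> deriv f x * (x + e) / (f x + e)"
          using main[OF x] pos by (simp only: pos_le_divide_eq)
        then have "k / (x + e) \<le> deriv f x / (f x + e)"
          using pos by (simp add: pos_divide_le_eq)
        then show ?thesis by simp
      qed
      ultimately show "\<exists>y. (g has_real_derivative y) (at x) \<and> y \<ge> 0" by blast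
    qed (use pq in auto)
    then show "k * (ln (q + e) - ln (p + e)) \<le> ln (f q + e) - ln (f p + e)"
      by (simp add: g_def algebra_simps)
  qed
qed

end

section \<open>Invariant densities of the base map\<close>

lemma concave_slope_antimono:
  fixes H :: "real \<Rightarrow> real"
  assumes H: "concave_on S H" and S: "x1 \<in> S" "y1 \<in> S" "x2 \<in> S" "y2 \<in> S"
    and lt: "x1 < y1" "x2 < y2" "x1 \<le> x2" "y1 \<le> y2"
  shows "(H y2 - H x2) / (y2 - x2) \<le> (H y1 - H x1) / (y1 - x1)"
proof -
  have cv: "convex_on S (\<lambda>x. - H x)" using H by (simp add: concave_on_def)
  have flip: "(- H u - - H v) / (u - v) = - ((H v - H u) / (v - u))" for u v
    by (metis minus_diff_eq minus_diff_minus minus_divide_divide minus_divide_left)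
  have "(H y2 - H x1) / (y2 - x1) \<le> (H y1 - H x1) / (y1 - x1)"
    using convex_on_slope_le(1)[OF cv S(1,4), of y1] lt unfolding flip by (cases "y1 = y2") auto
  moreover have "(H y2 - H x2) / (y2 - x2) \<le> (H y2 - H x1) / (y2 - x1)"
    using convex_on_slope_le(2)[OF cv S(1,4), of x2] lt unfolding flip by (cases "x1 = x2") auto
  ultimately show ?thesis by linarith
qed

lemma concave_on_mono_compose:
  fixes H g :: "real \<Rightarrow> real"
  assumes H: "concave_on T H" "mono_on T H" and g: "concave_on S g" "g ` S \<subseteq> T"
  shows "concave_on S (\<lambda>x. H (g x))"
  unfolding concave_on_iff
proof (intro conjI ballI allI impI)
  show "convex S" using g by (simp add: concave_on_iff)
  fix x y u v :: real assume *: "x \<in> S" "y \<in> S" "0 \<le> u" "0 \<le> v" "u + v = 1"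
  have T: "g x \<in> T" "g y \<in> T" using * g by auto
  have S: "u * x + v * y \<in> S" using convexD[OF \<open>convex S\<close>] * by (metis real_scaleR_def)
  have uT: "u * g x + v * g y \<in> T"
    using H(1) T * convexD[of T "g x" "g y" u v] by (simp add: concave_on_iff)
  have "u * H (g x) + v * H (g y) \<le> H (u * g x + v * g y)"
    using H(1) T * by (simp add: concave_on_iff)
  also have "\<dots> \<le> H (g (u * x + v * y))"
    using g S uT * by (intro mono_onD[OF H(2)]) (auto simp: concave_on_iff)
  finally show "u * H (g x) + v * H (g y) \<le> H (g (u *\<^sub>R x + v *\<^sub>R y))" by simp
qed

text \<open>The distribution functions of probability measures on the unit interval whose density is
  nonincreasing and at most \<open>R\<close>. The steepest chords start at 0, so the bound
  \<open>H x <= R * x\<close> controls all of them. Stated without densities, the conditions survive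
  pointwise limits.\<close>

definition concave_cdfs :: "real \<Rightarrow> (real \<Rightarrow> real) set" where
  "concave_cdfs R = {H. concave_on {0..1} H \<and> mono_on {0..1} H \<and> H 0 = 0 \<and> H 1 = 1 \<and> (\<forall>x\<in>{0..1}. H x \<le> R * x)}"

lemma concave_cdfsD:
  assumes "H \<in> concave_cdfs R"
  shows "concave_on {0..1} H" "mono_on {0..1} H" "H 0 = 0" "H 1 = 1" "1 \<le> R"
    "x \<in> {0..1} \<Longrightarrow> H x \<le> R * x" "x \<in> {0..1} \<Longrightarrow> 0 \<le> H x" "x \<in> {0..1} \<Longrightarrow> H x \<le> 1"
proof -
  show "concave_on {0..1} H" and m: "mono_on {0..1} H" and "H 0 = 0" "H 1 = 1" "x \<in> {0..1} \<Longrightarrow> H x \<le> R * x"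
    using assms by (auto simp: concave_cdfs_def)
  show "1 \<le> R" using assms by (auto simp: concave_cdfs_def dest!: bspec[of _ _ 1])
  show "x \<in> {0..1} \<Longrightarrow> 0 \<le> H x" "x \<in> {0..1} \<Longrightarrow> H x \<le> 1"
    using mono_onD[OF m, of 0 x] mono_onD[OF m, of x 1] \<open>H 0 = 0\<close> \<open>H 1 = 1\<close> by auto
qed

lemma concave_cdfs_ratio:
  assumes "H \<in> concave_cdfs R" "0 \<le> x" "x \<le> y" "y \<le> 1"
  shows "x * H y \<le> y * H x"
proof (cases "x = 0 \<or> x = y")
  case False
  then have "(H y - H 0) / (y - 0) \<le> (H x - H 0) / (x - 0)"
    using assms concave_cdfsD(1)[OF assms(1)] by (intro concave_slope_antimono) auto
  then show ?thesis using False assms concave_cdfsD(3)[OF assms(1)] by (simp add: field_simps)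
qed (use concave_cdfsD(3)[OF assms(1)] in auto)

text \<open>The chord over \<open>[x, y]\<close> is no steeper than the chord over
  \<open>[0, y]\<close>, whose slope is at most \<open>R\<close>.\<close>

lemma concave_cdfs_lipschitz:
  assumes H: "H \<in> concave_cdfs R" and "0 \<le> x" "x \<le> y" "y \<le> 1"
  shows "H y - H x \<le> R * (y - x)"
proof (cases "y = 0")
  case False
  have "y * (H y - H x) \<le> (y - x) * H y"
    using concave_cdfs_ratio[OF assms] by (simp add: algebra_simps)
  also have "\<dots> \<le> (y - x) * (R * y)"
    using concave_cdfsD(6)[OF H, of y] assms by (intro mult_left_mono) auto
  finally have "y * (H y - H x) \<le> y * (R * (y - x))" by (simp add: algebra_simps)
  then show ?thesis using False assms by simp
qed (use assms in auto)

lemma concave_cdfs_abs_lipschitz: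
  assumes H: "H \<in> concave_cdfs R" and "x \<in> {0..1}" "y \<in> {0..1}"
  shows "\<bar>H x - H y\<bar> \<le> R * \<bar>x - y\<bar>"
  using concave_cdfs_lipschitz[OF H, of x y] concave_cdfs_lipschitz[OF H, of y x]
    mono_onD[OF concave_cdfsD(2)[OF H], of x y] mono_onD[OF concave_cdfsD(2)[OF H], of y x] assms
  by (cases "x \<le> y") auto

text \<open>For a concave function the forward difference quotients increase as the step shrinks.
  Their limit is the density: each quotient is integrated exactly by means of an antiderivative, and
  monotone convergence passes the integrals to the limit.\<close>

lemma concave_cdfs_density:
  assumes H: "H \<in> concave_cdfs R"
  obtains h :: "real \<Rightarrow> real" where "h \<in> borel_measurable borel" "\<And>x. 0 \<le> h x" "\<And>x. h x \<le> R"
    "antimono_on {0..1} h"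
    "\<And>x. x \<in> {0..1} \<Longrightarrow> emeasure (density unit_leb (\<lambda>x. ennreal (h x))) {0..x} = ennreal (H x)"
proof -
  note D = concave_cdfsD[OF H]
  \<comment> \<open>The constant extension of \<open>H\<close> makes
    \<open>E (x + 1 / Suc n)\<close> meaningful up to the right end; it remains concave on the half
    line.\<close>
  define E where "E x = H (max 0 (min 1 x))" for x
  have lip: "\<bar>E x - E y\<bar> \<le> R * \<bar>x - y\<bar>" for x y
  proof -
    have "\<bar>E x - E y\<bar> \<le> R * \<bar>max 0 (min 1 x) - max 0 (min 1 y)\<bar>"
      unfolding E_def by (rule concave_cdfs_abs_lipschitz[OF H]) auto
    also have "\<dots> \<le> R * \<bar>x - y\<bar>" using D(5) by (intro mult_left_mono) auto
    finally show ?thesis .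
  qed
  have E_cont: "continuous_on A E" for A
  proof -
    have "R-lipschitz_on A E"
      using lip D(5) by (auto simp: lipschitz_on_def dist_real_def)
    then show ?thesis by (rule lipschitz_on_continuous_on)
  qed
  have E_mono: "E x \<le> E y" if "x \<le> y" for x y
    unfolding E_def using that by (intro mono_onD[OF D(2)]) auto
  have "concave_on {0..} (\<lambda>x::real. max 0 (min 1 x))"
    unfolding concave_on_iff
  proof (intro conjI ballI allI impI)
    fix x y u v :: real assume *: "x \<in> {0..}" "y \<in> {0..}" "0 \<le> u" "0 \<le> v" "u + v = 1"
    have "u * min 1 x + v * min 1 y \<le> u * x + v * y" using * by (intro add_mono mult_left_mono) auto
    moreover have "u * min 1 x + v * min 1 y \<le> u * 1 + v * 1" using * by (intro add_mono mult_left_mono) auto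
    moreover have "max 0 (min 1 x) = min 1 x" "max 0 (min 1 y) = min 1 y" using * by auto
    ultimately show "u * max 0 (min 1 x) + v * max 0 (min 1 y) \<le> max 0 (min 1 (u *\<^sub>R x + v *\<^sub>R y))"
      using * by simp
  qed (rule convex_real_interval)
  then have E_conc: "concave_on {0..} E"
    unfolding E_def by (rule concave_on_mono_compose[OF D(1,2)]) auto
  define s where "s n x = real (Suc n) * (E (x + 1 / Suc n) - E x)" for n x
  have s_alt: "s n x = (E (x + 1 / Suc n) - E x) / ((x + 1 / Suc n) - x)" for n x
    by (simp add: s_def)
  have s_anti: "s n y \<le> s n x" if "0 \<le> x" "x \<le> y" for n x y
    unfolding s_alt by (rule concave_slope_antimono[OF E_conc]) (use that in auto)
  have s_inc: "s m x \<le> s n x" if "0 \<le> x" "m \<le> n" for m n x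
    unfolding s_alt by (rule concave_slope_antimono[OF E_conc]) (use that in \<open>auto simp: field_simps\<close>)
  have s_0: "0 \<le> s n x" for n x unfolding s_def by (intro mult_nonneg_nonneg) (auto intro: E_mono)
  have s_R: "s n x \<le> R" for n x
  proof -
    have "E (x + 1 / Suc n) - E x \<le> R * (1 / Suc n)" using lip[of "x + 1 / Suc n" x] by simp
    then show ?thesis by (simp add: s_def field_simps)
  qed
  \<comment> \<open>The clipping \<open>max 0 x\<close> makes the limit exist for all real
    arguments: the quotients are known to be monotone in \<open>n\<close> only for nonnegative
    ones.\<close>
  define h where "h x = lim (\<lambda>n. s n (max 0 x))" for x
  have s_lim: "(\<lambda>n. s n (max 0 x)) \<longlonglongrightarrow> h x" for x
  proof -
    have "Bseq (\<lambda>n. s n (max 0 x))" by (rule BseqI'[of _ R]) (use s_0 s_R in auto)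
    then have "convergent (\<lambda>n. s n (max 0 x))"
      by (rule Bseq_mono_convergent) (auto intro: s_inc)
    then show ?thesis unfolding h_def by (simp add: convergent_LIMSEQ_iff)
  qed
  have E_meas[measurable]: "E \<in> borel_measurable borel" using E_cont by (intro borel_measurable_continuous_onI)
  have s_meas[measurable]: "s n \<in> borel_measurable borel" for n unfolding s_def by measurable
  have h_meas[measurable]: "h \<in> borel_measurable borel"
    by (rule borel_measurable_LIMSEQ_real[OF s_lim]) measurable
  have h0: "0 \<le> h x" for x by (rule LIMSEQ_le_const[OF s_lim]) (auto intro: s_0)
  have hR: "h x \<le> R" for x by (rule LIMSEQ_le_const2[OF s_lim]) (auto intro: s_R)
  have h_anti: "antimono_on {0..1} h"
    by (auto intro!: monotone_onI LIMSEQ_le[OF s_lim s_lim] exI[of _ 0] s_anti)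
  \<comment> \<open>An antiderivative of \<open>E\<close> on a window that contains every point
    \<open>x + 1 / Suc n\<close> with \<open>x\<close> in the unit interval; its own difference
    quotients are antiderivatives of the functions \<open>s n\<close>.\<close>
  define Q where "Q t = integral {-1..t} E" for t
  have Q: "(Q has_real_derivative E t) (at t)" if "-1 < t" "t < 3" for t
    using integral_has_real_derivative[of "-1" 3 E t] E_cont that
    unfolding Q_def by (simp add: at_within_Icc_at)
  have cdf: "emeasure (density unit_leb (\<lambda>x. ennreal (h x))) {0..y} = ennreal (H y)" if y: "y \<in> {0..1}" for y
  proof -
    define F where "F n t = real (Suc n) * (Q (t + 1 / Suc n) - Q t)" for n t
    have int: "(\<integral>\<^sup>+x. ennreal (s n x) * indicator {0..y} x \<partial>lborel) = ennreal (F n y - F n 0)" for n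
    proof (rule nn_integral_FTC_Icc[where F = "F n"])
      fix x assume "x \<in> {0..y}"
      then have x: "0 \<le> x" "x \<le> y" by auto
      have "0 < 1 / real (Suc n)" "1 / real (Suc n) \<le> 1" by simp_all
      then have lt: "-1 < x + 1 / real (Suc n)" "x + 1 / real (Suc n) < 3"
        using x y unfolding atLeastAtMost_iff by linarith+
      have "((\<lambda>x. Q (x + 1 / Suc n)) has_real_derivative E (x + 1 / Suc n) * 1) (at x)"
        by (rule DERIV_chain2[where f = Q]) (use lt in \<open>auto intro!: Q derivative_eq_intros simp del: of_nat_Suc\<close>)
      moreover have "(Q has_real_derivative E x) (at x)" using x y by (intro Q) auto
      ultimately show "(F n has_real_derivative s n x) (at x)"
        unfolding F_def s_def by (auto intro!: derivative_eq_intros)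
    qed (use y s_0 in auto)
    \<comment> \<open>The difference quotients of \<open>Q\<close> converge to its derivative
      \<open>E\<close>, so the integrals of \<open>s n\<close> over \<open>[0, y]\<close> converge
      to \<open>E y - E 0\<close>.\<close>
    have quot: "(\<lambda>n. F n t) \<longlonglongrightarrow> E t" if "0 \<le> t" "t \<le> 1" for t
    proof -
      have "((\<lambda>h. (Q (t + h) - Q t) / h) \<longlongrightarrow> E t) (at 0)" using Q[of t] that by (simp add: DERIV_def)
      moreover have "filterlim (\<lambda>n. 1 / real (Suc n)) (at 0) sequentially"
        using LIMSEQ_inverse_real_of_nat by (intro filterlim_atI) (auto simp: inverse_eq_divide)
      ultimately have "(\<lambda>n. (Q (t + 1 / real (Suc n)) - Q t) / (1 / real (Suc n))) \<longlonglongrightarrow> E t"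
        by (rule filterlim_compose)
      then show ?thesis by (simp add: F_def mult.commute)
    qed
    have "(\<lambda>n. ennreal (F n y - F n 0)) \<longlonglongrightarrow> ennreal (E y - E 0)"
      using y by (intro tendsto_ennrealI tendsto_diff quot) auto
    moreover have "E y - E 0 = H y"
    proof -
      have "max 0 (min 1 y) = y" using y by auto
      then show ?thesis by (simp add: E_def D(3))
    qed
    moreover have "(\<lambda>n. \<integral>\<^sup>+x. ennreal (s n (max 0 x)) * indicator {0..y} x \<partial>lborel) \<longlonglongrightarrow> (\<integral>\<^sup>+x. ennreal (h x) * indicator {0..y} x \<partial>lborel)"
    proof (rule nn_integral_LIMSEQ)
      show "incseq (\<lambda>n x. ennreal (s n (max 0 x)) * indicator {0..y} x)"
        by (auto simp: incseq_def le_fun_def intro!: mult_right_mono ennreal_leI s_inc)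
      show "(\<lambda>n. ennreal (s n (max 0 x)) * indicator {0..y} x) \<longlonglongrightarrow> ennreal (h x) * indicator {0..y} x" for x
        using tendsto_ennrealI[OF s_lim[of x]] by (cases "x \<in> {0..y}") auto
    qed measurable
    moreover have "(\<integral>\<^sup>+x. ennreal (s n (max 0 x)) * indicator {0..y} x \<partial>lborel) = ennreal (F n y - F n 0)" for n
      unfolding int[symmetric] by (intro nn_integral_cong) (auto simp: indicator_def)
    ultimately have "(\<integral>\<^sup>+x. ennreal (h x) * indicator {0..y} x \<partial>lborel) = ennreal (H y)"
      using LIMSEQ_unique by force
    moreover have "emeasure (density unit_leb (\<lambda>x. ennreal (h x))) {0..y} = (\<integral>\<^sup>+x. ennreal (h x) * indicator {0..y} x \<partial>unit_leb)"
    proof (rule emeasure_density)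
      show "(\<lambda>x. ennreal (h x)) \<in> borel_measurable unit_leb"
        using measurable_compose[OF id_measurable_unit_leb h_meas] by simp
    qed (use y in \<open>auto simp: sets_unit_leb_iff\<close>)
    moreover have "\<dots> = (\<integral>\<^sup>+x. ennreal (h x) * indicator {0..y} x * indicator {0..1} x \<partial>lborel)"
      unfolding unit_leb_def by (rule nn_integral_restrict_space) auto
    moreover have "\<dots> = (\<integral>\<^sup>+x. ennreal (h x) * indicator {0..y} x \<partial>lborel)"
      using y by (intro nn_integral_cong) (auto simp: indicator_def)
    ultimately show ?thesis by simp
  qed
  show thesis by (rule that[OF h_meas h0 hR h_anti cdf])
qed

section \<open>The transfer operator on concave distribution functions, and its fixed point\<close>

context branched_map
begin

lemma measure_sums_branch:
  assumes nu: "finite_measure \<nu>" "sets \<nu> = sets unit_leb" "absolutely_continuous unit_leb \<nu>"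
    and A: "A \<in> sets unit_leb"
  shows "(\<lambda>i. measure \<nu> (A \<inter> branch i)) sums measure \<nu> A"
proof -
  interpret finite_measure \<nu> by fact
  have br: "branch i \<in> sets unit_leb" for i using branch_subset[of i] by (simp add: sets_unit_leb_iff)
  have AB: "A \<inter> branch i \<in> sets \<nu>" for i using A br nu by auto
  have U: "(\<Union>i. branch i) \<in> sets unit_leb" using br by auto
  have null: "{0..1} - (\<Union>i. branch i) \<in> null_sets unit_leb"
    using branch_full U sets.compl_sets[OF U] by (auto simp: null_sets_def emeasure_unit_leb)
  have "A - (\<Union>i. branch i) \<subseteq> {0..1} - (\<Union>i. branch i)" using A by (auto simp: sets_unit_leb_iff)
  then have "A - (\<Union>i. branch i) \<in> null_sets unit_leb"
    using A U by (intro null_sets_subset[OF null]) auto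
  then have "A - (\<Union>i. branch i) \<in> null_sets \<nu>" using nu by (auto simp: absolutely_continuous_def)
  then have "measure \<nu> (A - (A - (\<Union>i. branch i))) = measure \<nu> A"
    by (intro measure_Diff_null_set) (use A nu in auto)
  moreover have "A - (A - (\<Union>i. branch i)) = (\<Union>i. A \<inter> branch i)" by auto
  moreover have "(\<lambda>i. measure \<nu> (A \<inter> branch i)) sums measure \<nu> (\<Union>i. A \<inter> branch i)"
  proof (rule finite_measure_UNION)
    show "disjoint_family (\<lambda>i. A \<inter> branch i)"
      unfolding disjoint_family_on_def using branch_unique by blast
  qed (use AB in auto)
  ultimately show ?thesis by simp
qed

definition transfer :: "(real \<Rightarrow> real) \<Rightarrow> real \<Rightarrow> real" where
  "transfer H x = (\<Sum>i. H (psi i x) - H (a i))"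

lemma vimage_branch:
  assumes "0 \<le> x"
  shows "f -` {0..x} \<inter> branch i = {..psi i x} \<inter> branch i"
  using psi_iff[of _ i x] less_imp_le[OF f_pos[of _ i]] by auto

lemma a_in_unit: "a i \<in> {0..1}"
  using a_ge_0[of i] b_le_1[of i] a_less_b[of i] by auto

lemma transfer_cdf:
  assumes nu: "finite_measure \<nu>" "sets \<nu> = sets unit_leb" "absolutely_continuous unit_leb \<nu>"
    and H: "\<And>x. x \<in> {0..1} \<Longrightarrow> measure \<nu> {0..x} = H x"
    and x: "x \<in> {0..1}"
  shows "(\<lambda>i. H (psi i x) - H (a i)) sums measure (distr \<nu> unit_leb f) {0..x}"
proof -
  interpret finite_measure \<nu> by fact
  have sp: "space \<nu> = {0..1}" using sets_eq_imp_space_eq[OF nu(2)] by simp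
  have f: "f \<in> \<nu> \<rightarrow>\<^sub>M unit_leb" using f_measurable by (simp add: measurable_cong_sets[OF nu(2) refl])
  have A: "f -` {0..x} \<inter> {0..1} \<in> sets unit_leb"
    using measurable_sets[OF f_measurable, of "{0..x}"] x by (simp add: sets_unit_leb_iff)
  have "measure (distr \<nu> unit_leb f) {0..x} = measure \<nu> (f -` {0..x} \<inter> {0..1})"
    using x by (simp add: measure_distr[OF f] sp sets_unit_leb_iff)
  moreover have "measure \<nu> (f -` {0..x} \<inter> {0..1} \<inter> branch i) = H (psi i x) - H (a i)" for i
  proof -
    have "f -` {0..x} \<inter> {0..1} \<inter> branch i = {..psi i x} \<inter> branch i"
      using vimage_branch[of x i] x branch_subset[of i] by auto
    \<comment> \<open>The value \<open>psi i x\<close> may be \<open>b i\<close>, which is not in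
      the branch; absolute continuity makes this point null.\<close>
    also have "measure \<nu> \<dots> = measure \<nu> {a i<..psi i x}"
    proof -
      have "{b i} \<in> null_sets unit_leb"
        using a_less_b[of i] a_ge_0[of i] b_le_1[of i] by (auto simp: null_sets_def sets_unit_leb_iff emeasure_unit_leb)
      then have "{b i} \<in> null_sets \<nu>" using nu by (auto simp: absolutely_continuous_def)
      moreover have "{..psi i x} \<inter> branch i = {a i<..psi i x} - {b i}"
        using psi_le_b[of i x] by auto
      moreover have "{a i<..psi i x} \<in> sets \<nu>"
        using psi_in_unit[of i x] a_ge_0[of i] by (auto simp: nu sets_unit_leb_iff)
      ultimately show ?thesis by (simp add: measure_Diff_null_set)
    qed
    also have "\<dots> = measure \<nu> ({0..psi i x} - {0..a i})"
      using a_ge_0[of i] by (intro arg_cong[where f = "measure \<nu>"]) auto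
    also have "\<dots> = H (psi i x) - H (a i)"
      using psi_in_unit[of i x] a_in_unit[of i] psi_ge[of i x]
      by (subst finite_measure_Diff) (auto simp: nu sets_unit_leb_iff H)
    finally show ?thesis .
  qed
  ultimately show ?thesis using measure_sums_branch[OF nu A] by simp
qed

lemma transfer_term:
  assumes "H \<in> concave_cdfs R" "x \<in> {0..1}"
  shows "0 \<le> H (psi i x) - H (a i)" "H (psi i x) - H (a i) \<le> R * (1 / slope i)"
    "H (psi i x) - H (a i) \<le> R * (x / slope i)"
proof -
  show "0 \<le> H (psi i x) - H (a i)"
    using mono_onD[OF concave_cdfsD(2)[OF assms(1)] a_in_unit psi_in_unit psi_ge, of i x] by simp
  have "H (psi i x) - H (a i) \<le> R * (psi i x - a i)"
    using concave_cdfs_lipschitz[OF assms(1), of "a i" "psi i x"] a_in_unit[of i] psi_in_unit[of i x] psi_ge[of i x] by auto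
  also have "\<dots> \<le> R * (x / slope i)"
    using psi_diff_le[of x i] assms concave_cdfsD(5)[OF assms(1)] by (intro mult_left_mono) auto
  finally show *: "H (psi i x) - H (a i) \<le> R * (x / slope i)" .
  also have "\<dots> \<le> R * (1 / slope i)"
    using assms concave_cdfsD(5)[OF assms(1)] slope_gt0[of i] by (intro mult_left_mono divide_right_mono) auto
  finally show "H (psi i x) - H (a i) \<le> R * (1 / slope i)" .
qed

lemma transfer_summable:
  assumes "H \<in> concave_cdfs R" "x \<in> {0..1}"
  shows "summable (\<lambda>i. H (psi i x) - H (a i))"
  by (rule summable_comparison_test[OF _ summable_mult[OF summable_slope, of R]])
     (use transfer_term[OF assms] in auto)

text \<open>The bound \<open>R * x\<close> reproduces itself. Branches with \<open>a i < d\<close>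
  contribute at most \<open>l * R * x\<close>. On the others concavity bounds the slope of
  \<open>H\<close> to the right of \<open>a i\<close> by \<open>H (a i) / a i <= 1 / d\<close>,
  independently of \<open>R\<close>, which adds at most \<open>S * x / d\<close>.\<close>

lemma transfer_concave_cdfs:
  obtains R where "1 \<le> R" "\<And>H. H \<in> concave_cdfs R \<Longrightarrow> transfer H \<in> concave_cdfs R"
proof -
  obtain d l where dl: "0 < d" "0 < l" "l < 1" "(\<Sum>i. if a i < d then 1 / slope i else 0) \<le> l"
    by (rule small_slopes) blast
  define S where "S = (\<Sum>i. 1 / slope i)"
  \<comment> \<open>A solution of \<open>l * R + S / d <= R\<close>, raised to 1 so that the
    identity lies in the class.\<close>
  define R where "R = max 1 (S / d / (1 - l))"
  have R: "1 \<le> R" "l * R + S / d \<le> R"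
  proof -
    have "S / d / (1 - l) \<le> R" by (simp add: R_def)
    then have "S / d \<le> R * (1 - l)" using dl by (simp only: pos_divide_le_eq)
    then show "l * R + S / d \<le> R" by (simp add: algebra_simps)
  qed (simp add: R_def)
  have nn: "0 \<le> 1 / slope i" for i using slope_gt0[of i] by simp
  have summ: "summable (\<lambda>i. if a i < d then 1 / slope i else 0)"
    by (rule summable_comparison_test[OF _ summable_slope]) (use nn in auto)
  have "transfer H \<in> concave_cdfs R" if H: "H \<in> concave_cdfs R" for H
  proof -
    note D = concave_cdfsD[OF H]
    note sm = transfer_summable[OF H]
    have "concave_on {0..1} (transfer H)"
      unfolding concave_on_iff
    proof (intro conjI ballI allI impI)
      show "convex {0..1::real}" by simp
      fix x y u v :: real assume *: "x \<in> {0..1}" "y \<in> {0..1}" "0 \<le> u" "0 \<le> v" "u + v = 1"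
      have z: "u * x + v * y \<in> {0..1}"
        using convexD[OF convex_real_interval(5), of x 0 1 y u v] * by simp
      have "u * transfer H x + v * transfer H y = (\<Sum>i. u * (H (psi i x) - H (a i)) + v * (H (psi i y) - H (a i)))"
        unfolding transfer_def using sm[of x] sm[of y] *
        by (simp add: suminf_add[symmetric] suminf_mult summable_mult)
      also have "\<dots> \<le> (\<Sum>i. H (psi i (u * x + v * y)) - H (a i))"
      proof (rule suminf_le)
        fix i
        have "concave_on {0..1} (\<lambda>x. H (psi i x))"
          by (rule concave_on_mono_compose[OF D(1,2) psi_concave]) (use psi_in_unit in auto)
        then have "u * H (psi i x) + v * H (psi i y) \<le> H (psi i (u * x + v * y))"
          using * by (simp add: concave_on_iff)
        moreover have "u * H (a i) + v * H (a i) = H (a i)" using * by (metis distrib_right mult_1)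
        ultimately show "u * (H (psi i x) - H (a i)) + v * (H (psi i y) - H (a i)) \<le> H (psi i (u * x + v * y)) - H (a i)"
          by (simp add: algebra_simps)
      qed (use sm * z in \<open>auto intro!: summable_add summable_mult\<close>)
      finally show "u * transfer H x + v * transfer H y \<le> transfer H (u *\<^sub>R x + v *\<^sub>R y)"
        by (simp add: transfer_def)
    qed
    moreover have "mono_on {0..1} (transfer H)"
      unfolding transfer_def
      by (intro mono_onI suminf_le diff_mono sm order_refl mono_onD[OF D(2)] psi_in_unit psi_mono) auto
    moreover have "transfer H 0 = 0" by (simp add: transfer_def psi_0)
    \<comment> \<open>Conservation of mass is obtained by going through the measure with
      distribution function \<open>H\<close>: the series at 1 is the mass of its image under
      \<open>f\<close>.\<close>
    moreover have "transfer H 1 = 1"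
    proof -
      obtain h where h: "h \<in> borel_measurable borel" "\<And>x. x \<in> {0..1} \<Longrightarrow> emeasure (density unit_leb (\<lambda>x. ennreal (h x))) {0..x} = ennreal (H x)"
        by (rule concave_cdfs_density[OF H]) blast
      define \<nu> where "\<nu> = density unit_leb (\<lambda>x. ennreal (h x))"
      have "(\<lambda>x. ennreal (h x)) \<in> borel_measurable unit_leb"
        using measurable_compose[OF id_measurable_unit_leb h(1)] by simp
      then have ac: "absolutely_continuous unit_leb \<nu>" unfolding \<nu>_def by (rule absolutely_continuousI_density)
      have cdf: "measure \<nu> {0..x} = H x" if "x \<in> {0..1}" for x
        using h(2)[OF that] D(7)[OF that] by (simp add: \<nu>_def measure_def)
      have fin: "finite_measure \<nu>"
        using h(2)[of 1] by (intro finite_measureI) (simp add: \<nu>_def)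
      have s: "sets \<nu> = sets unit_leb" "space \<nu> = {0..1}" by (simp_all add: \<nu>_def)
      have f: "f \<in> \<nu> \<rightarrow>\<^sub>M unit_leb" using f_measurable by (simp add: measurable_cong_sets[OF s(1) refl])
      have "f -` {0..1} \<inter> {0..1} = {0..1}" using f_range by auto
      then have "measure (distr \<nu> unit_leb f) {0..1} = measure \<nu> {0..1}"
        by (simp add: measure_distr[OF f] s sets_unit_leb_iff)
      then show ?thesis using transfer_cdf[OF fin s(1) ac cdf, of 1] cdf[of 1] D(4)
        by (simp add: transfer_def sums_iff)
    qed
    moreover have "transfer H x \<le> R * x" if x: "x \<in> {0..1}" for x
    proof -
      have "H (psi i x) - H (a i) \<le> R * x * (if a i < d then 1 / slope i else 0) + x / d * (1 / slope i)" for i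
      proof (cases "a i < d")
        case True
        have "0 \<le> x / d * (1 / slope i)" using x dl nn[of i] by (intro mult_nonneg_nonneg) auto
        then show ?thesis using transfer_term(3)[OF H x, of i] True by simp
      next
        case False
        \<comment> \<open>The chord over \<open>[a i, psi i x]\<close> is no steeper than the chord
          over \<open>[0, a i]\<close>.\<close>
        have "a i * (H (psi i x) - H (a i)) \<le> (psi i x - a i) * H (a i)"
          using concave_cdfs_ratio[OF H, of "a i" "psi i x"] a_in_unit[of i] psi_in_unit[of i x] psi_ge[of i x]
          by (auto simp: algebra_simps)
        also have "\<dots> \<le> (psi i x - a i) * 1"
          using D(8)[OF a_in_unit[of i]] psi_ge[of i x] by (intro mult_left_mono) auto
        also have "\<dots> \<le> x / slope i" using psi_diff_le[of x i] x by simp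
        finally have 1: "a i * (H (psi i x) - H (a i)) \<le> x / slope i" .
        have "d * (H (psi i x) - H (a i)) \<le> a i * (H (psi i x) - H (a i))"
          using False transfer_term(1)[OF H x, of i] by (intro mult_right_mono) auto
        then have "d * (H (psi i x) - H (a i)) \<le> x / slope i" using 1 by linarith
        then have "H (psi i x) - H (a i) \<le> x / slope i / d" using dl by (simp only: pos_le_divide_eq mult.commute)
        then show ?thesis using False by (simp add: mult.commute)
      qed
      then have "transfer H x \<le> (\<Sum>i. R * x * (if a i < d then 1 / slope i else 0) + x / d * (1 / slope i))"
        unfolding transfer_def by (intro suminf_le sm x summable_add summable_mult summ summable_slope)
      also have "\<dots> = R * x * (\<Sum>i. if a i < d then 1 / slope i else 0) + x / d * S"
        unfolding S_def by (subst suminf_add[symmetric]) (simp_all only: suminf_mult summable_mult summ summable_slope)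
      also have "\<dots> \<le> R * x * l + x / d * S"
        using R x dl by (intro add_mono mult_left_mono) auto
      also have "\<dots> = x * (l * R + S / d)" by (simp add: algebra_simps)
      also have "\<dots> \<le> x * R" using R x by (intro mult_left_mono) auto
      finally show ?thesis by (simp add: mult.commute)
    qed
    ultimately show ?thesis by (simp add: concave_cdfs_def)
  qed
  then show thesis using that R by blast
qed

lemma concave_fixed_point:
  obtains R H where "H \<in> concave_cdfs R" "\<And>x. x \<in> {0..1} \<Longrightarrow> transfer H x = H x"
proof -
  obtain R where R: "1 \<le> R" "\<And>H. H \<in> concave_cdfs R \<Longrightarrow> transfer H \<in> concave_cdfs R"
    by (rule transfer_concave_cdfs) blast
  define Hs where "Hs k = (transfer ^^ k) (\<lambda>x. x)" for k
  have "(\<lambda>x. x) \<in> concave_cdfs R"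
    using R(1) by (auto simp: concave_cdfs_def concave_on_iff mono_on_def mult_le_cancel_right1)
  then have Hs: "Hs k \<in> concave_cdfs R" for k
    by (induction k) (auto simp: Hs_def intro: R(2))
  note D = concave_cdfsD[OF Hs]
  define A where "A n x = (\<Sum>k<Suc n. Hs k x) / real (Suc n)" for n x
  have A: "A n \<in> concave_cdfs R" for n
  proof -
    have "concave_on {0..1} (A n)"
      unfolding concave_on_iff
    proof (intro conjI ballI allI impI)
      fix x y u v :: real assume *: "x \<in> {0..1}" "y \<in> {0..1}" "0 \<le> u" "0 \<le> v" "u + v = 1"
      have "u * A n x + v * A n y = (\<Sum>k<Suc n. u * Hs k x + v * Hs k y) / real (Suc n)"
        unfolding A_def sum.distrib sum_distrib_left[symmetric]
        by (simp add: add_divide_distrib del: sum.lessThan_Suc of_nat_Suc)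
      also have "\<dots> \<le> A n (u *\<^sub>R x + v *\<^sub>R y)"
        unfolding A_def using * D(1) by (intro divide_right_mono sum_mono) (auto simp: concave_on_iff)
      finally show "u * A n x + v * A n y \<le> A n (u *\<^sub>R x + v *\<^sub>R y)" .
    qed simp
    moreover have "mono_on {0..1} (A n)"
      unfolding A_def by (intro mono_onI divide_right_mono sum_mono mono_onD[OF D(2)]) auto
    moreover have "A n 0 = 0" unfolding A_def by (simp add: D(3))
    moreover have "A n 1 = 1" unfolding A_def by (simp add: D(4) del: sum.lessThan_Suc)
    moreover have "A n x \<le> R * x" if "x \<in> {0..1}" for x
    proof -
      have "(\<Sum>k<Suc n. Hs k x) \<le> (\<Sum>k<Suc n. R * x)" using that by (intro sum_mono D(6))
      then show ?thesis unfolding A_def by (simp add: pos_divide_le_eq mult.commute del: sum.lessThan_Suc of_nat_Suc)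
    qed
    ultimately show ?thesis by (simp add: concave_cdfs_def)
  qed
  note DA = concave_cdfsD[OF A]
  \<comment> \<open>The Cesaro mean fails to be fixed only by a telescoped difference divided by
    \<open>n + 1\<close>.\<close>
  have tA: "transfer (A n) x - A n x = (Hs (Suc n) x - x) / real (Suc n)" if x: "x \<in> {0..1}" for n x
  proof -
    have "transfer (A n) x = (\<Sum>i. (\<Sum>k<Suc n. Hs k (psi i x) - Hs k (a i)) / real (Suc n))"
      unfolding transfer_def A_def sum_subtractf by (simp add: diff_divide_distrib del: sum.lessThan_Suc of_nat_Suc)
    also have "\<dots> = (\<Sum>i. \<Sum>k<Suc n. Hs k (psi i x) - Hs k (a i)) / real (Suc n)"
      using transfer_summable[OF Hs x] by (intro suminf_divide summable_sum)
    also have "(\<Sum>i. \<Sum>k<Suc n. Hs k (psi i x) - Hs k (a i)) = (\<Sum>k<Suc n. transfer (Hs k) x)"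
      unfolding transfer_def by (intro suminf_sum transfer_summable[OF Hs x])
    also have "\<dots> = (\<Sum>k<Suc n. Hs (Suc k) x)" by (simp add: Hs_def)
    finally have "transfer (A n) x - A n x = (\<Sum>k<Suc n. Hs (Suc k) x - Hs k x) / real (Suc n)"
      unfolding A_def sum_subtractf by (simp add: diff_divide_distrib del: sum.lessThan_Suc of_nat_Suc)
    also have "(\<Sum>k<Suc n. Hs (Suc k) x - Hs k x) = Hs (Suc n) x - Hs 0 x" by (rule sum_lessThan_telescope)
    finally show ?thesis by (simp add: Hs_def)
  qed
  have bound: "norm (A n x) \<le> 1" if "x \<in> {0..1}" for n x
    using DA(7,8)[OF that] by simp
  have equi: "\<exists>d>0. \<forall>n y. y \<in> {0..1} \<and> norm (x - y) < d \<longrightarrow> norm (A n x - A n y) < e"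
    if x: "x \<in> {0..1}" and e: "0 < e" for x e
  proof (intro exI[of _ "e / R"] conjI allI impI)
    show "0 < e / R" using e R by simp
    fix n y assume y: "y \<in> {0..1} \<and> norm (x - y) < e / R"
    then have "\<bar>A n x - A n y\<bar> \<le> R * \<bar>x - y\<bar>" using x by (intro concave_cdfs_abs_lipschitz[OF A]) auto
    also have "\<dots> < R * (e / R)" using y R by (intro mult_strict_left_mono) auto
    also have "\<dots> = e" using R by simp
    finally show "norm (A n x - A n y) < e" by simp
  qed
  obtain g k where g: "strict_mono (k :: nat \<Rightarrow> nat)"
    "\<And>e. 0 < e \<Longrightarrow> \<exists>N. \<forall>n x. n \<ge> N \<and> x \<in> {0..1} \<longrightarrow> norm (A (k n) x - g x) < e"
    by (rule Arzela_Ascoli[of "{0..1}" A 1, OF compact_Icc bound equi]) blast+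
  have lim: "(\<lambda>n. A (k n) x) \<longlonglongrightarrow> g x" if "x \<in> {0..1}" for x
    unfolding LIMSEQ_iff using g(2) that by blast
  have gC: "g \<in> concave_cdfs R"
  proof -
    have "concave_on {0..1} g"
      unfolding concave_on_iff
    proof (intro conjI ballI allI impI)
      fix x y u v :: real assume *: "x \<in> {0..1}" "y \<in> {0..1}" "0 \<le> u" "0 \<le> v" "u + v = 1"
      have z: "u * x + v * y \<in> {0..1}"
        using convexD[OF convex_real_interval(5), of x 0 1 y u v] * by simp
      have "u * g x + v * g y \<le> g (u * x + v * y)"
      proof (rule LIMSEQ_le)
        show "(\<lambda>n. u * A (k n) x + v * A (k n) y) \<longlonglongrightarrow> u * g x + v * g y"
          using * by (intro tendsto_intros lim) auto
        show "(\<lambda>n. A (k n) (u * x + v * y)) \<longlonglongrightarrow> g (u * x + v * y)" by (rule lim[OF z])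
        show "\<exists>N. \<forall>n\<ge>N. u * A (k n) x + v * A (k n) y \<le> A (k n) (u * x + v * y)"
          using * DA(1) by (simp add: concave_on_iff)
      qed
      then show "u * g x + v * g y \<le> g (u *\<^sub>R x + v *\<^sub>R y)" by simp
    qed simp
    moreover have "mono_on {0..1} g"
    proof (rule mono_onI)
      fix x y :: real assume "x \<in> {0..1}" "y \<in> {0..1}" "x \<le> y"
      then show "g x \<le> g y"
        by (intro LIMSEQ_le[OF lim lim]) (auto intro!: exI[of _ 0] mono_onD[OF DA(2)])
    qed
    moreover have "g 0 = 0" using lim[of 0] by (simp add: DA(3) LIMSEQ_const_iff)
    moreover have "g 1 = 1" using lim[of 1] by (simp add: DA(4) LIMSEQ_const_iff)
    moreover have "g x \<le> R * x" if "x \<in> {0..1}" for x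
      by (rule LIMSEQ_le_const2[OF lim[OF that]]) (auto intro!: DA(6)[OF that])
    ultimately show ?thesis by (simp add: concave_cdfs_def)
  qed
  have "transfer g x = g x" if x: "x \<in> {0..1}" for x
  proof -
    \<comment> \<open>The series is dominated termwise by \<open>R / slope i\<close>, uniformly in
      \<open>n\<close>, so \<open>transfer\<close> commutes with the limit.\<close>
    have "(\<lambda>n. \<Sum>i. A (k n) (psi i x) - A (k n) (a i)) \<longlonglongrightarrow> (\<Sum>i. g (psi i x) - g (a i))"
    proof -
      have "norm (A (k n) (psi i x) - A (k n) (a i)) \<le> R * (1 / slope i)" for i n
        using transfer_term[OF A x, of "k n" i] by simp
      then have ev: "\<forall>\<^sub>F (i, n) in at_top \<times>\<^sub>F sequentially. norm (A (k n) (psi i x) - A (k n) (a i)) \<le> R * (1 / slope i)"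
        by (intro always_eventually) auto
      have "(\<lambda>n. A (k n) (psi i x) - A (k n) (a i)) \<longlonglongrightarrow> g (psi i x) - g (a i)" for i
        by (intro tendsto_diff lim psi_in_unit a_in_unit)
      from tannerys_theorem[OF this ev summable_mult[OF summable_slope]] show ?thesis by simp
    qed
    then have "(\<lambda>n. transfer (A (k n)) x - A (k n) x) \<longlonglongrightarrow> transfer g x - g x"
      unfolding transfer_def by (intro tendsto_diff lim x)
    moreover have "(\<lambda>n. transfer (A (k n)) x - A (k n) x) \<longlonglongrightarrow> 0"
    proof -
      have "(\<lambda>n. (Hs (Suc n) x - x) / real (Suc n)) \<longlonglongrightarrow> 0"
      proof (rule Lim_null_comparison)
        show "\<forall>\<^sub>F n in sequentially. norm ((Hs (Suc n) x - x) / real (Suc n)) \<le> 1 / real (Suc n)"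
        proof (intro always_eventually allI)
          fix n
          have "\<bar>Hs (Suc n) x - x\<bar> \<le> 1" using D(7,8)[OF x, of "Suc n"] x by auto
          then show "norm ((Hs (Suc n) x - x) / real (Suc n)) \<le> 1 / real (Suc n)"
            by (simp add: divide_right_mono)
        qed
        show "(\<lambda>n. 1 / real (Suc n)) \<longlonglongrightarrow> 0"
          using LIMSEQ_inverse_real_of_nat by (simp add: inverse_eq_divide)
      qed
      from LIMSEQ_subseq_LIMSEQ[OF this g(1)] show ?thesis by (simp add: tA[OF x] o_def)
    qed
    ultimately show ?thesis using LIMSEQ_unique by fastforce
  qed
  then show thesis using gC that by blast
qed

lemma acim_exists:
  obtains h :: "real \<Rightarrow> real" and R where "h \<in> borel_measurable borel" "\<And>x. 0 \<le> h x" "\<And>x. h x \<le> R"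
    "antimono_on {0..1} h"
    "prob_space (density unit_leb (\<lambda>x. ennreal (h x)))"
    "distr (density unit_leb (\<lambda>x. ennreal (h x))) unit_leb f = density unit_leb (\<lambda>x. ennreal (h x))"
proof -
  obtain R H where H: "H \<in> concave_cdfs R" "\<And>x. x \<in> {0..1} \<Longrightarrow> transfer H x = H x"
    by (rule concave_fixed_point) blast
  note D = concave_cdfsD[OF H(1)]
  obtain h where h: "h \<in> borel_measurable borel" "\<And>x. 0 \<le> h x" "\<And>x. h x \<le> R" "antimono_on {0..1} h"
    "\<And>x. x \<in> {0..1} \<Longrightarrow> emeasure (density unit_leb (\<lambda>x. ennreal (h x))) {0..x} = ennreal (H x)"
    by (rule concave_cdfs_density[OF H(1)]) blast
  define \<nu> where "\<nu> = density unit_leb (\<lambda>x. ennreal (h x))"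
  have "(\<lambda>x. ennreal (h x)) \<in> borel_measurable unit_leb"
    using measurable_compose[OF id_measurable_unit_leb h(1)] by simp
  then have ac: "absolutely_continuous unit_leb \<nu>" unfolding \<nu>_def by (rule absolutely_continuousI_density)
  have cdf: "measure \<nu> {0..x} = H x" if "x \<in> {0..1}" for x
    using h(5)[OF that] D(7)[OF that] by (simp add: \<nu>_def measure_def)
  have pr: "prob_space \<nu>"
    using h(5)[of 1] D(4) by (intro prob_spaceI) (simp add: \<nu>_def)
  then have fin: "finite_measure \<nu>" by (rule prob_space.axioms)
  have s: "sets \<nu> = sets unit_leb" "space \<nu> = {0..1}" by (simp_all add: \<nu>_def)
  have f: "f \<in> \<nu> \<rightarrow>\<^sub>M unit_leb" using f_measurable by (simp add: measurable_cong_sets[OF s(1) refl])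
  have "distr \<nu> unit_leb f = \<nu>"
  proof (rule measure_unit_eqI)
    show "finite_measure (distr \<nu> unit_leb f)" by (rule finite_measure.finite_measure_distr[OF fin f])
    show "measure (distr \<nu> unit_leb f) {0..x} = measure \<nu> {0..x}" if x: "x \<in> {0..1}" for x
      using transfer_cdf[OF fin s(1) ac cdf x] H(2)[OF x] cdf[OF x] by (simp add: transfer_def sums_iff)
  qed (use fin s in simp_all)
  then show thesis using that h pr unfolding \<nu>_def by blast
qed

end

section \<open>Continuity points of functions of bounded variation\<close>

text \<open>The variation \<open>W x\<close> up to \<open>x\<close> is monotone and dominates the
  increments of \<open>g\<close>. So \<open>g\<close> is continuous wherever \<open>W\<close> is,
  and a monotone function has only countably many discontinuities.\<close>

lemma countable_discontinuities:
  fixes g :: "real \<Rightarrow> real"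
  assumes fin: "total_variation g < \<infinity>"
  shows "countable {x \<in> {0<..<1}. \<not> isCont g x}"
proof -
  \<comment> \<open>Stopping the argument at \<open>x\<close> expresses the variation over
    \<open>[0, x]\<close> through \<open>total_variation\<close>, which always refers to the whole
    unit interval.\<close>
  define TV where "TV x = total_variation (\<lambda>t. g (min x t))" for x
  define W where "W x = enn2real (TV x)" for x
  have ge: "(\<Sum>k<n. ennreal \<bar>G (t (Suc k)) - G (t k)\<bar>) \<le> total_variation G"
    if "incseq t" "range t \<subseteq> {0..1}" for G n t
    unfolding total_variation_def using that by (intro SUP_upper2[of "(n, t)"]) auto
  have fin_TV: "TV x < \<infinity>" if "0 \<le> x" for x
  proof -
    have "TV x \<le> total_variation g"
      unfolding TV_def total_variation_def[of "\<lambda>t. g (min x t)"]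
    proof (rule SUP_least, clarify)
      fix n and t :: "nat \<Rightarrow> real" assume t: "incseq t" "range t \<subseteq> {0..1}"
      show "(\<Sum>k<n. ennreal \<bar>g (min x (t (Suc k))) - g (min x (t k))\<bar>) \<le> total_variation g"
        using ge[of "\<lambda>k. min x (t k)" g n] t that by (auto simp: incseq_def image_subset_iff min_le_iff_disj)
    qed
    then show ?thesis using fin by (rule le_less_trans)
  qed
  have step: "TV x + ennreal \<bar>g y - g x\<bar> \<le> TV y" if xy: "0 \<le> x" "x \<le> y" "y \<le> 1" for x y
  proof -
    have "TV x \<le> TV y - ennreal \<bar>g y - g x\<bar>"
      unfolding TV_def[of x] total_variation_def
    proof (rule SUP_least, clarify)
      fix n and t :: "nat \<Rightarrow> real" assume t: "incseq t" "range t \<subseteq> {0..1}"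
      \<comment> \<open>The given partition is stopped at \<open>x\<close> and continued by
        \<open>x\<close> and \<open>y\<close>. The extra increment from its last point to
        \<open>x\<close> is discarded; the one from \<open>x\<close> to \<open>y\<close> is the
        gain.\<close>
      define t' where "t' k = (if k \<le> n then min x (t k) else if k = Suc n then x else y)" for k
      have t'_le: "t' k \<le> y" for k using xy by (auto simp: t'_def)
      have "incseq t'"
      proof (rule incseq_SucI)
        fix k show "t' k \<le> t' (Suc k)"
          using xy incseq_SucD[OF t(1), of k] by (auto simp: t'_def min_le_iff_disj)
      qed
      moreover have "range t' \<subseteq> {0..1}" using xy t by (auto simp: t'_def image_subset_iff min_le_iff_disj)
      ultimately have "(\<Sum>k<Suc (Suc n). ennreal \<bar>g (min y (t' (Suc k))) - g (min y (t' k))\<bar>) \<le> TV y"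
        unfolding TV_def by (rule ge)
      moreover have "(\<Sum>k<n. ennreal \<bar>g (min y (t' (Suc k))) - g (min y (t' k))\<bar>) =
         (\<Sum>k<n. ennreal \<bar>g (min x (t (Suc k))) - g (min x (t k))\<bar>)"
        using t'_le by (intro sum.cong refl) (auto simp: min_absorb2, auto simp: t'_def)
      moreover have "min y (t' (Suc n)) = x" "min y (t' (Suc (Suc n))) = y" using xy by (auto simp: t'_def)
      ultimately have "(\<Sum>k<n. ennreal \<bar>g (min x (t (Suc k))) - g (min x (t k))\<bar>) +
          ennreal \<bar>g x - g (min y (t' n))\<bar> + ennreal \<bar>g y - g x\<bar> \<le> TV y"
        by (simp only: sum.lessThan_Suc)
      moreover have "u + z \<le> u + w + z" for u w z :: ennreal
        by (intro add_right_mono) (metis add.right_neutral add_left_mono zero_le)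
      ultimately have "(\<Sum>k<n. ennreal \<bar>g (min x (t (Suc k))) - g (min x (t k))\<bar>) + ennreal \<bar>g y - g x\<bar> \<le> TV y"
        by (rule order_trans[rotated])
      then show "(\<Sum>k<n. ennreal \<bar>g (min x (t (Suc k))) - g (min x (t k))\<bar>) \<le> TV y - ennreal \<bar>g y - g x\<bar>"
        by (simp add: ennreal_le_minus_iff add.commute)
    qed
    moreover have "ennreal \<bar>g y - g x\<bar> \<le> TV y"
      using ge[of "\<lambda>k. if k = 0 then x else y" "\<lambda>t. g (min y t)" 1] xy
      by (auto simp: TV_def incseq_def image_subset_iff)
    ultimately show ?thesis using fin_TV[of x] fin_TV[of y] xy
      by (metis add.commute ennreal_le_minus_iff ennreal_minus_le_iff diff_add_cancel_ennreal add_right_mono)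
  qed
  have W: "\<bar>g y - g x\<bar> \<le> W y - W x" if xy: "0 \<le> x" "x \<le> y" "y \<le> 1" for x y
  proof -
    have "ennreal (W x + \<bar>g y - g x\<bar>) \<le> ennreal (W y)"
      using step[OF xy] fin_TV[of x] fin_TV[of y] xy by (simp add: W_def)
    then show ?thesis by (subst (asm) ennreal_le_iff) (simp_all add: W_def)
  qed
  have "mono_on {0<..<1} W"
  proof (rule mono_onI)
    fix r s :: real assume "r \<in> {0<..<1}" "s \<in> {0<..<1}" "r \<le> s"
    then show "W r \<le> W s" using W[of r s] by auto
  qed
  then have cW: "countable {x \<in> {0<..<1}. \<not> isCont W x}" by (intro mono_on_ctble_discont_open) auto
  have "isCont g x" if "isCont W x" "x \<in> {0<..<1}" for x
  proof -
    have "((\<lambda>y. g y - g x) \<longlongrightarrow> 0) (at x)"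
    proof (rule Lim_null_comparison)
      have "\<forall>\<^sub>F y in at x. y \<in> {0<..<1}"
        using that by (intro eventually_at_in_open') auto
      then show "\<forall>\<^sub>F y in at x. norm (g y - g x) \<le> \<bar>W y - W x\<bar>"
      proof eventually_elim
        case (elim y)
        then show ?case using W[of x y] W[of y x] that by (cases "x \<le> y") auto
      qed
      have "((\<lambda>y. W y - W x) \<longlongrightarrow> W x - W x) (at x)" using that(1) unfolding isCont_def by (intro tendsto_intros)
      then show "((\<lambda>y. \<bar>W y - W x\<bar>) \<longlongrightarrow> 0) (at x)" by (simp add: tendsto_rabs_zero_iff)
    qed
    then show ?thesis by (simp add: isCont_def LIM_zero_iff)
  qed
  then have "{x \<in> {0<..<1}. \<not> isCont g x} \<subseteq> {x \<in> {0<..<1}. \<not> isCont W x}" by blast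
  then show ?thesis using cW by (rule countable_subset)
qed

text \<open>This is what uniqueness draws from bounded variation: two densities that differ on a set
  of positive measure can be compared at a common continuity point, hence on an interval.\<close>

lemma BV_m_AE_isCont:
  assumes "h \<in> BV_m"
  obtains g where "AE x in unit_leb. g x = h x" "AE x in unit_leb. isCont g x"
proof -
  obtain g where g: "AE x in unit_leb. g x = h x" "total_variation g < \<infinity>"
    using assms by (auto simp: BV_m_def essential_variation_def INF_less_iff)
  have "countable ({x \<in> {0<..<1}. \<not> isCont g x} \<union> {0, 1})" (is "countable ?N")
    using countable_discontinuities[OF g(2)] by simp
  then have "?N \<in> null_sets lborel" by (rule countable_imp_null_set_lborel)
  moreover have sub: "?N \<subseteq> {0..1}" by auto
  ultimately have "?N \<in> null_sets unit_leb"
    using emeasure_unit_leb[OF sub] by (intro null_setsI) (auto dest: null_setsD1 null_setsD2 simp: sets_unit_leb_iff)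
  then have "AE x in unit_leb. isCont g x"
    by (rule AE_I') auto
  then show thesis using g that by blast
qed

section \<open>Lower bounds on intervals, and how they spread to 0\<close>

text \<open>A form of "density at least t on [p, q]" that mentions no density and tests intervals
  only, so that it is easily carried along by \<open>f\<close>.\<close>

definition lower_bounded_on :: "real measure \<Rightarrow> real \<Rightarrow> real \<Rightarrow> bool" where
  "lower_bounded_on \<nu> p q \<longleftrightarrow> 0 \<le> p \<and> p < q \<and> q \<le> 1 \<and>
     (\<exists>t>0. \<forall>u v. p \<le> u \<longrightarrow> u \<le> v \<longrightarrow> v \<le> q \<longrightarrow> t * (v - u) \<le> measure \<nu> {u<..v})"

context branched_map
begin

text \<open>The preimage of the image interval contains the interval itself, and further branches
  only add mass; invariance turns this inclusion into an inequality.\<close>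

lemma measure_image_Ioc:
  assumes nu: "finite_measure \<nu>" "sets \<nu> = sets unit_leb" "distr \<nu> unit_leb f = \<nu>"
    and st: "s \<in> branch i" "t \<in> branch i" "s \<le> t"
  shows "measure \<nu> {s<..t} \<le> measure \<nu> {f s<..f t}"
proof -
  interpret finite_measure \<nu> by (rule nu(1))
  have sp: "space \<nu> = {0..1}" using sets_eq_imp_space_eq[OF nu(2)] by simp
  have f: "f \<in> \<nu> \<rightarrow>\<^sub>M unit_leb" using f_measurable by (simp add: measurable_cong_sets[OF nu(2) refl])
  have E: "{f s<..f t} \<in> sets unit_leb"
    using f_range[OF branch_in_unit[OF st(1)]] f_range[OF branch_in_unit[OF st(2)]] by (auto simp: sets_unit_leb_iff)
  have "{s<..t} \<subseteq> f -` {f s<..f t} \<inter> {0..1}"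
  proof
    fix x assume "x \<in> {s<..t}"
    then have "x \<in> branch i" "s < x" "x \<le> t" using st by auto
    then show "x \<in> f -` {f s<..f t} \<inter> {0..1}"
      using f_less_iff[OF st(1), of x] f_le_iff[of x i t] st branch_in_unit[of x i] by auto
  qed
  then have "measure \<nu> {s<..t} \<le> measure \<nu> (f -` {f s<..f t} \<inter> {0..1})"
    by (rule finite_measure_mono) (use measurable_sets[OF f E] sp in auto)
  also have "\<dots> = measure (distr \<nu> unit_leb f) {f s<..f t}"
    by (simp add: measure_distr[OF f E] sp)
  finally show ?thesis by (simp add: nu(3))
qed

text \<open>By convexity \<open>deriv f q\<close> is the largest expansion to the left of
  \<open>q\<close> in the branch, so the constant drops from \<open>t\<close> to
  \<open>t / deriv f q\<close>. Only \<open>u\<close> has to lie in the branch: in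
  \<open>lower_bounded_on_zero\<close> the lemma is applied with \<open>a i\<close> for
  \<open>p\<close>.\<close>

lemma lower_bound_image:
  assumes nu: "finite_measure \<nu>" "sets \<nu> = sets unit_leb" "distr \<nu> unit_leb f = \<nu>"
    and q: "q \<in> branch i" "p < q"
    and t: "0 < t" "\<And>u v. p \<le> u \<Longrightarrow> u \<le> v \<Longrightarrow> v \<le> q \<Longrightarrow> t * (v - u) \<le> measure \<nu> {u<..v}"
  obtains c where "0 < c" "\<And>u v. u \<in> branch i \<Longrightarrow> p \<le> u \<Longrightarrow> u \<le> v \<Longrightarrow> v \<le> q \<Longrightarrow> c * (f v - f u) \<le> measure \<nu> {f u<..f v}"
proof
  have M: "0 < deriv f q" using slope_le_deriv[OF q(1)] slope_gt0[of i] by linarith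
  show "0 < t / deriv f q" using t M by simp
  fix u v assume uv: "u \<in> branch i" "p \<le> u" "u \<le> v" "v \<le> q"
  then have v: "v \<in> branch i" using q by auto
  have "f v - f u \<le> deriv f v * (v - u)" using tangent[OF v uv(1)] by (simp add: algebra_simps)
  also have "\<dots> \<le> deriv f q * (v - u)" using deriv_mono[OF v q(1)] uv by (intro mult_right_mono) auto
  finally have "t / deriv f q * (f v - f u) \<le> t / deriv f q * (deriv f q * (v - u))"
    using t M by (intro mult_left_mono) auto
  also have "\<dots> = t * (v - u)" using M by simp
  also have "\<dots> \<le> measure \<nu> {u<..v}" using t(2) uv by simp
  also have "\<dots> \<le> measure \<nu> {f u<..f v}" by (rule measure_image_Ioc[OF nu uv(1) v uv(3)])
  finally show "t / deriv f q * (f v - f u) \<le> measure \<nu> {f u<..f v}" .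
qed

lemma branch_IVT:
  assumes "p \<in> branch i" "q \<in> branch i" "p \<le> q" "f p \<le> y" "y \<le> f q"
  obtains x where "p \<le> x" "x \<le> q" "f x = y"
proof -
  have "\<forall>x. p \<le> x \<and> x \<le> q \<longrightarrow> isCont f x" using assms isCont_f[of _ i] by auto
  from IVT[of f p y q, OF _ _ _ this] assms show thesis using that by auto
qed

lemma lower_bounded_on_image:
  assumes nu: "finite_measure \<nu>" "sets \<nu> = sets unit_leb" "distr \<nu> unit_leb f = \<nu>"
    and g: "lower_bounded_on \<nu> p q" and pq: "p \<in> branch i" "q \<in> branch i"
  shows "lower_bounded_on \<nu> (f p) (f q)"
proof -
  obtain t where t: "0 < t" "\<And>u v. p \<le> u \<Longrightarrow> u \<le> v \<Longrightarrow> v \<le> q \<Longrightarrow> t * (v - u) \<le> measure \<nu> {u<..v}" and lt: "p < q"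
    using g by (auto simp: lower_bounded_on_def)
  obtain c where c: "0 < c" "\<And>u v. u \<in> branch i \<Longrightarrow> p \<le> u \<Longrightarrow> u \<le> v \<Longrightarrow> v \<le> q \<Longrightarrow> c * (f v - f u) \<le> measure \<nu> {f u<..f v}"
    by (rule lower_bound_image[OF nu pq(2) lt t]) blast+
  have "c * (v - u) \<le> measure \<nu> {u<..v}" if uv: "f p \<le> u" "u \<le> v" "v \<le> f q" for u v
  proof -
    obtain x where x: "p \<le> x" "x \<le> q" "f x = u" using branch_IVT[OF pq, of u] uv lt by auto
    then have xb: "x \<in> branch i" using pq by auto
    obtain y where y: "x \<le> y" "y \<le> q" "f y = v" using branch_IVT[OF xb pq(2), of v] uv x by auto
    show ?thesis using c(2)[OF xb x(1) y(1,2)] x y by simp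
  qed
  then show ?thesis unfolding lower_bounded_on_def
    using c(1) f_strict_mono[OF pq lt] f_range[OF branch_in_unit[OF pq(1)]] f_range[OF branch_in_unit[OF pq(2)]] by auto
qed

text \<open>Since \<open>f\<close> tends to 0 at \<open>a i\<close>, it maps a right neighbourhood
  of \<open>a i\<close> onto a right neighbourhood of 0, and the lower bound goes with it.\<close>

lemma lower_bounded_on_zero:
  assumes nu: "finite_measure \<nu>" "sets \<nu> = sets unit_leb" "distr \<nu> unit_leb f = \<nu>"
    and g: "lower_bounded_on \<nu> p q" and ai: "p \<le> a i" "a i < q"
  shows "\<exists>s. lower_bounded_on \<nu> 0 s"
proof -
  interpret finite_measure \<nu> by (rule nu(1))
  obtain t where t: "0 < t" "\<And>u v. p \<le> u \<Longrightarrow> u \<le> v \<Longrightarrow> v \<le> q \<Longrightarrow> t * (v - u) \<le> measure \<nu> {u<..v}"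
    using g by (auto simp: lower_bounded_on_def)
  define r where "r = (a i + min (b i) q) / 2"
  have r: "r \<in> branch i" "r < q" using ai a_less_b[of i] by (auto simp: r_def)
  have ar: "a i < r" using r by auto
  obtain c where c: "0 < c" "\<And>u v. u \<in> branch i \<Longrightarrow> a i \<le> u \<Longrightarrow> u \<le> v \<Longrightarrow> v \<le> r \<Longrightarrow> c * (f v - f u) \<le> measure \<nu> {f u<..f v}"
    by (rule lower_bound_image[OF nu r(1) ar t(1)]) (use t(2) ai r in auto)
  have pos: "c * (v - u) \<le> measure \<nu> {u<..v}" if uv: "0 < u" "u \<le> v" "v \<le> f r" for u v
  proof -
    have "\<forall>\<^sub>F w in at_right (a i). f w < u" using order_tendstoD(2)[OF f_lim uv(1)] .
    then have "\<forall>\<^sub>F w in at_right (a i). f w < u \<and> w \<in> branch i \<and> w < r"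
      using eventually_branch[OF r(1)] by eventually_elim auto
    then obtain w where w: "f w < u" "w \<in> branch i" "w < r"
      using eventually_happens'[of "at_right (a i)"] by auto
    obtain x where x: "w \<le> x" "x \<le> r" "f x = u" using branch_IVT[OF w(2) r(1), of u] uv w by auto
    then have xb: "x \<in> branch i" using w r by auto
    obtain y where y: "x \<le> y" "y \<le> r" "f y = v" using branch_IVT[OF xb r(1), of v] uv x by auto
    show ?thesis using c(2)[OF xb _ y(1,2)] x xb y by simp
  qed
  have fr: "0 < f r" "f r \<le> 1" using f_pos[OF r(1)] f_range[OF branch_in_unit[OF r(1)]] by auto
  have "c * (v - u) \<le> measure \<nu> {u<..v}" if uv: "0 \<le> u" "u \<le> v" "v \<le> f r" for u v
  proof (cases "0 < u \<or> v = 0")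
    case False
    then have u: "u = 0" "0 < v" using uv by auto
    \<comment> \<open>On the branch \<open>f\<close> is positive, so intervals starting at 0 are
      exhausted from the right by intervals starting at \<open>w > 0\<close>.\<close>
    have "c * v \<le> measure \<nu> {0<..v}"
    proof (rule field_le_epsilon)
      fix e :: real assume e: "0 < e"
      define w where "w = min v (e / c)"
      have w: "0 < w" "w \<le> v" "c * w \<le> e" using e c u by (auto simp: w_def min_def field_simps)
      have "c * (v - w) \<le> measure \<nu> {w<..v}" using w uv by (intro pos) auto
      also have "\<dots> \<le> measure \<nu> {0<..v}"
        by (rule finite_measure_mono) (use w uv fr in \<open>auto simp: nu(2) sets_unit_leb_iff\<close>)
      finally show "c * v \<le> measure \<nu> {0<..v} + e" using w by (simp add: algebra_simps)
    qed
    then show ?thesis using u by simp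
  qed (use pos uv in auto)
  then show ?thesis unfolding lower_bounded_on_def using c(1) fr by (intro exI[of _ "f r"]) auto
qed

text \<open>A supremum replaces the iteration. If no interval starting at 0 carried a lower bound,
  every interval that carries one would lie in a single branch up to its right end, and its image
  would carry one again and be longer by the factor \<open>k\<close>. The supremum \<sigma> of the
  logarithmic lengths, finite and positive, would then satisfy \<sigma> <= \<sigma> /
  \<open>k\<close>.\<close>

lemma lower_bounded_near_zero:
  assumes nu: "finite_measure \<nu>" "sets \<nu> = sets unit_leb" "distr \<nu> unit_leb f = \<nu>"
    and "lower_bounded_on \<nu> p0 q0"
  shows "\<exists>s. lower_bounded_on \<nu> 0 s"
proof (rule ccontr)
  assume no: "\<not> ?thesis"
  obtain e k :: real where ek: "0 < e" "1 < k"
    "\<And>i p q. p \<in> branch i \<Longrightarrow> q \<in> branch i \<Longrightarrow> p < q \<Longrightarrow>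
       k * (ln (q + e) - ln (p + e)) \<le> ln (f q + e) - ln (f p + e)"
    by (rule log_expansion) blast
  define S where "S = {ln (q + e) - ln (p + e) | p q. lower_bounded_on \<nu> p q}"
  have bdd: "bdd_above S"
  proof (rule bdd_aboveI)
    fix x assume "x \<in> S"
    then obtain p q where x: "x = ln (q + e) - ln (p + e)" and pq: "0 \<le> p" "p < q" "q \<le> 1"
      by (auto simp: S_def lower_bounded_on_def)
    have "ln (q + e) \<le> ln (1 + e)" "ln e \<le> ln (p + e)" using pq ek by auto
    then show "x \<le> ln (1 + e) - ln e" by (simp add: x)
  qed
  define \<sigma> where "\<sigma> = Sup S"
  have up: "ln (q + e) - ln (p + e) \<le> \<sigma>" if "lower_bounded_on \<nu> p q" for p q
    unfolding \<sigma>_def by (rule cSup_upper[OF _ bdd]) (use that in \<open>auto simp: S_def\<close>)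
  have "0 < ln (q0 + e) - ln (p0 + e)" using assms ek by (auto simp: lower_bounded_on_def)
  then have \<sigma>: "0 < \<sigma>" using up[OF assms(4)] by linarith
  have "ln (q + e) - ln (p + e) \<le> \<sigma> / k" if g: "lower_bounded_on \<nu> p q" for p q
  proof -
    have pq: "0 \<le> p" "p < q" "q \<le> 1" using g by (auto simp: lower_bounded_on_def)
    \<comment> \<open>Under the assumption to be refuted, no branch starts inside
      \<open>[p, q)\<close>.\<close>
    have na: "a i < p \<or> q \<le> a i" for i using no lower_bounded_on_zero[OF nu g, of i] by force
    obtain i x where x: "x \<in> branch i" "p < x" "x < q" using branch_meets[of p q] pq by blast
    then have ai: "a i < p" using na[of i] by auto
    \<comment> \<open>If branch \<open>i\<close> ended before \<open>q\<close>, some branch would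
      meet the gap between \<open>b i\<close> and \<open>q\<close>. It could not start in
      \<open>[p, q)\<close>, so it would start before \<open>p\<close> and contain
      \<open>b i\<close>.\<close>
    have bi: "q \<le> b i"
    proof (rule ccontr)
      assume "\<not> q \<le> b i"
      then obtain j y where y: "y \<in> branch j" "b i < y" "y < q"
        using branch_meets[of "b i" q] pq a_ge_0[of i] a_less_b[of i] by (metis linorder_not_le order_less_imp_le order_trans)
      then have "a j < p" using na[of j] by auto
      then have "b i \<in> branch j" using y x by auto
      then show False using endpoint_notin_branch by blast
    qed
    have p: "p \<in> branch i" using ai pq bi by auto
    have less: "k * (ln (q' + e) - ln (p + e)) \<le> \<sigma>" if q': "p < q'" "q' < q" for q'
    proof -
      have q'b: "q' \<in> branch i" using q' ai bi by auto
      have "lower_bounded_on \<nu> p q'" using g q' by (auto simp: lower_bounded_on_def)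
      then have "lower_bounded_on \<nu> (f p) (f q')" by (rule lower_bounded_on_image[OF nu _ p q'b])
      then show ?thesis using up[of "f p" "f q'"] ek(3)[OF p q'b q'(1)] by simp
    qed
    \<comment> \<open>The end \<open>q\<close> may equal \<open>b i\<close>, which is outside the
      branch, so the estimate is first obtained for \<open>q' < q\<close>.\<close>
    have "((\<lambda>q'. k * (ln (q' + e) - ln (p + e))) \<longlongrightarrow> k * (ln (q + e) - ln (p + e))) (at_left q)"
      using pq ek by (intro tendsto_intros) auto
    then have "k * (ln (q + e) - ln (p + e)) \<le> \<sigma>"
    proof (rule tendsto_upperbound)
      show "\<forall>\<^sub>F q' in at_left q. k * (ln (q' + e) - ln (p + e)) \<le> \<sigma>"
        by (subst eventually_at_left[of p]) (use pq less in \<open>auto intro!: exI[of _ p]\<close>)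
    qed simp
    then show ?thesis using ek by (simp add: field_simps)
  qed
  then have "\<sigma> \<le> \<sigma> / k"
    unfolding \<sigma>_def by (intro cSup_least) (use assms in \<open>auto simp: S_def\<close>)
  then have "\<sigma> * k \<le> \<sigma>" using ek by (simp add: field_simps)
  then show False using \<sigma> ek by simp
qed

section \<open>Differences of invariant densities, and uniqueness\<close>

text \<open>As \<open>ennreal\<close> sends negative numbers to 0, \<open>D\<close> is the positive
  part of the difference of the two invariant measures. It can only grow under preimages; applied to
  a set and to its complement, with the same finite total mass, this forces equality.\<close>

lemma density_diff_invariant:
  fixes g1 g2 :: "real \<Rightarrow> real"
  assumes meas [measurable]: "g1 \<in> borel_measurable unit_leb" "g2 \<in> borel_measurable unit_leb"
    and nonneg: "\<And>x. 0 \<le> g1 x" "\<And>x. 0 \<le> g2 x"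
    and fin: "finite_measure (density unit_leb (\<lambda>x. ennreal (g1 x)))" "finite_measure (density unit_leb (\<lambda>x. ennreal (g2 x)))"
    and inv: "distr (density unit_leb (\<lambda>x. ennreal (g1 x))) unit_leb f = density unit_leb (\<lambda>x. ennreal (g1 x))"
      "distr (density unit_leb (\<lambda>x. ennreal (g2 x))) unit_leb f = density unit_leb (\<lambda>x. ennreal (g2 x))"
  defines "D \<equiv> density unit_leb (\<lambda>x. ennreal (g1 x - g2 x))"
  shows "finite_measure D" "distr D unit_leb f = D"
proof -
  define N1 where "N1 = density unit_leb (\<lambda>x. ennreal (g1 x))"
  define N2 where "N2 = density unit_leb (\<lambda>x. ennreal (g2 x))"
  have sets: "sets N1 = sets unit_leb" "sets N2 = sets unit_leb" "sets D = sets unit_leb"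
    "space N1 = {0..1}" "space N2 = {0..1}" "space D = {0..1}"
    by (simp_all add: N1_def N2_def D_def)
  interpret N1: finite_measure N1 using fin by (simp add: N1_def)
  interpret N2: finite_measure N2 using fin by (simp add: N2_def)
  have em: "emeasure N1 B = (\<integral>\<^sup>+x. ennreal (g1 x) * indicator B x \<partial>unit_leb)"
    "emeasure N2 B = (\<integral>\<^sup>+x. ennreal (g2 x) * indicator B x \<partial>unit_leb)"
    "emeasure D B = (\<integral>\<^sup>+x. ennreal (g1 x - g2 x) * indicator B x \<partial>unit_leb)" if "B \<in> sets unit_leb" for B
    using that by (simp_all add: N1_def N2_def D_def emeasure_density)
  have D_le: "emeasure D B \<le> emeasure N1 B" if "B \<in> sets unit_leb" for B
    unfolding em[OF that] by (intro nn_integral_mono mult_right_mono ennreal_leI) (use nonneg in auto)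
  have sp: "{0..1} \<in> sets unit_leb" using sets.top[of unit_leb] by simp
  have fin_D: "emeasure D {0..1} < \<infinity>"
  proof (rule le_less_trans[OF D_le[OF sp]])
    show "emeasure N1 {0..1} < \<infinity>" using N1.emeasure_finite[of "{0..1}"] by (simp add: less_top[symmetric])
  qed
  show fD: "finite_measure D" by (rule finite_measureI) (use fin_D sets in simp)
  interpret D: finite_measure D by fact
  have N1_le: "emeasure N1 B \<le> emeasure D B + emeasure N2 B" if B: "B \<in> sets unit_leb" for B
  proof -
    have [measurable]: "B \<in> sets unit_leb" by fact
    have "emeasure N1 B \<le> (\<integral>\<^sup>+x. ennreal (g1 x - g2 x) * indicator B x + ennreal (g2 x) * indicator B x \<partial>unit_leb)"
      unfolding em[OF that]
    proof (rule nn_integral_mono)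
      fix x
      have "ennreal (g1 x) \<le> ennreal (g1 x - g2 x) + ennreal (g2 x)"
      proof (cases "g2 x \<le> g1 x")
        case True
        then show ?thesis using nonneg by (subst ennreal_plus[symmetric]) auto
      next
        case False
        then show ?thesis using nonneg by (simp add: ennreal_neg ennreal_leI)
      qed
      then show "ennreal (g1 x) * indicator B x \<le> ennreal (g1 x - g2 x) * indicator B x + ennreal (g2 x) * indicator B x"
        by (simp add: indicator_def)
    qed
    also have "\<dots> = emeasure D B + emeasure N2 B"
      unfolding em[OF that] by (rule nn_integral_add) measurable
    finally show ?thesis .
  qed
  define A where "A = {x \<in> space unit_leb. g2 x < g1 x}"
  have A[measurable]: "A \<in> sets unit_leb" unfolding A_def by measurable
  have N1_eq: "emeasure N1 (B \<inter> A) = emeasure D B + emeasure N2 (B \<inter> A)" if B: "B \<in> sets unit_leb" for B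
  proof -
    have [measurable]: "B \<in> sets unit_leb" by fact
    have BA: "B \<inter> A \<in> sets unit_leb" by measurable
    have "emeasure N1 (B \<inter> A) = (\<integral>\<^sup>+x. ennreal (g1 x - g2 x) * indicator B x + ennreal (g2 x) * indicator (B \<inter> A) x \<partial>unit_leb)"
      unfolding em[OF BA]
    proof (rule nn_integral_cong)
      fix x assume "x \<in> space unit_leb"
      then show "ennreal (g1 x) * indicator (B \<inter> A) x = ennreal (g1 x - g2 x) * indicator B x + ennreal (g2 x) * indicator (B \<inter> A) x"
        using nonneg by (cases "g2 x < g1 x") (auto simp: A_def indicator_def ennreal_neg simp flip: ennreal_plus)
    qed
    also have "\<dots> = emeasure D B + emeasure N2 (B \<inter> A)"
      unfolding em[OF B] em[OF BA] by (rule nn_integral_add) measurable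
    finally show ?thesis .
  qed
  have pre: "f -` B \<inter> {0..1} \<in> sets unit_leb" if "B \<in> sets unit_leb" for B
    using measurable_sets[OF f_measurable that] by simp
  have fm: "f \<in> N1 \<rightarrow>\<^sub>M unit_leb" "f \<in> N2 \<rightarrow>\<^sub>M unit_leb" "f \<in> D \<rightarrow>\<^sub>M unit_leb"
    using f_measurable by (simp_all add: measurable_cong_sets[OF sets(1) refl] measurable_cong_sets[OF sets(2) refl] measurable_cong_sets[OF sets(3) refl])
  have inv1: "emeasure N1 (f -` B \<inter> {0..1}) = emeasure N1 B" if "B \<in> sets unit_leb" for B
    using arg_cong[OF inv(1), of "\<lambda>M. emeasure M B"] emeasure_distr[OF fm(1) that] by (simp add: N1_def)
  have inv2: "emeasure N2 (f -` B \<inter> {0..1}) = emeasure N2 B" if "B \<in> sets unit_leb" for B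
    using arg_cong[OF inv(2), of "\<lambda>M. emeasure M B"] emeasure_distr[OF fm(2) that] by (simp add: N2_def)
  \<comment> \<open>On \<open>A\<close>, where \<open>g1\<close> exceeds \<open>g2\<close>, the
    measure \<open>D\<close> is the difference N1 - N2, which is invariant; on every other set it is
    at least that difference.\<close>
  have sub: "emeasure D B \<le> emeasure D (f -` B \<inter> {0..1})" if B: "B \<in> sets unit_leb" for B
  proof -
    have BA: "B \<inter> A \<in> sets unit_leb" using B A by auto
    have "emeasure D B + emeasure N2 (B \<inter> A) = emeasure N1 (f -` (B \<inter> A) \<inter> {0..1})"
      by (simp only: N1_eq[OF B] inv1[OF BA])
    also have "\<dots> \<le> emeasure D (f -` (B \<inter> A) \<inter> {0..1}) + emeasure N2 (f -` (B \<inter> A) \<inter> {0..1})"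
      by (rule N1_le[OF pre[OF BA]])
    also have "\<dots> \<le> emeasure D (f -` B \<inter> {0..1}) + emeasure N2 (B \<inter> A)"
      unfolding inv2[OF BA] by (intro add_right_mono emeasure_mono) (use pre[OF B] sets in auto)
    finally show ?thesis
      using N2.emeasure_finite[of "B \<inter> A"] by (simp add: add.commute[of _ "emeasure N2 (B \<inter> A)"] ennreal_add_left_cancel_le)
  qed
  show "distr D unit_leb f = D"
  proof (rule measure_eqI)
    show "sets (distr D unit_leb f) = sets D" by (simp add: sets)
    fix B assume "B \<in> sets (distr D unit_leb f)"
    then have B: "B \<in> sets unit_leb" by simp
    have B': "{0..1} - B \<in> sets unit_leb" using B sp by auto
    have eq: "measure D ({0..1} - E) = measure D {0..1} - measure D E" if "E \<in> sets unit_leb" for E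
      using D.finite_measure_compl[of E] that by (simp add: sets)
    have vi: "f -` ({0..1} - B) \<inter> {0..1} = {0..1} - (f -` B \<inter> {0..1})" using f_range by auto
    have "measure D B \<le> measure D (f -` B \<inter> {0..1})"
      using sub[OF B] by (simp add: D.emeasure_eq_measure)
    moreover have "measure D ({0..1} - B) \<le> measure D ({0..1} - (f -` B \<inter> {0..1}))"
      using sub[OF B'] unfolding vi by (simp add: D.emeasure_eq_measure)
    ultimately have "measure D B = measure D (f -` B \<inter> {0..1})"
      using eq[OF B] eq[OF pre[OF B]] by simp
    then show "emeasure (distr D unit_leb f) B = emeasure D B"
      using emeasure_distr[OF fm(3) B] by (simp add: sets D.emeasure_eq_measure)
  qed
qed

end

text \<open>Some common continuity point of the representatives \<open>k1\<close>, \<open>k2\<close>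
  has \<open>k2 x < k1 x\<close>, and half of that gap persists in a neighbourhood.\<close>

lemma density_diff_lower_bounded:
  fixes g1 g2 :: "real \<Rightarrow> real"
  assumes meas [measurable]: "g1 \<in> borel_measurable unit_leb" "g2 \<in> borel_measurable unit_leb"
    and rep1: "AE x in unit_leb. k1 x = g1 x" "AE x in unit_leb. isCont k1 x"
    and rep2: "AE x in unit_leb. k2 x = g2 x" "AE x in unit_leb. isCont k2 x"
    and not_le: "\<not> (AE x in unit_leb. g1 x \<le> g2 x)"
    and fin: "finite_measure (density unit_leb (\<lambda>x. ennreal (g1 x - g2 x)))"
  shows "\<exists>p q. lower_bounded_on (density unit_leb (\<lambda>x. ennreal (g1 x - g2 x))) p q"
proof -
  define D where "D = density unit_leb (\<lambda>x. ennreal (g1 x - g2 x))"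
  interpret D: finite_measure D using fin by (simp add: D_def)
  have "{0, 1} \<in> null_sets unit_leb"
    using countable_imp_null_set_lborel[of "{0, 1}"]
    by (auto simp: null_sets_def sets_unit_leb_iff emeasure_unit_leb)
  then have ne01: "AE x in unit_leb. x \<notin> {0, 1}" by (rule AE_not_in)
  have "\<exists>x\<in>{0<..<1}. isCont k1 x \<and> isCont k2 x \<and> k2 x < k1 x"
    using not_le
  proof (rule contrapos_np)
    assume no: "\<not> (\<exists>x\<in>{0<..<1}. isCont k1 x \<and> isCont k2 x \<and> k2 x < k1 x)"
    show "AE x in unit_leb. g1 x \<le> g2 x"
      using rep1 rep2 AE_space ne01
    proof eventually_elim
      case (elim x)
      then have "x \<in> {0<..<1}" by auto
      then show ?case using no elim by force
    qed
  qed
  then obtain x where x: "0 < x" "x < 1" "isCont k1 x" "isCont k2 x" "k2 x < k1 x" by auto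
  define t where "t = (k1 x - k2 x) / 2"
  have t: "0 < t" "t < k1 x - k2 x" using x by (auto simp: t_def field_simps)
  have "isCont (\<lambda>y. k1 y - k2 y) x" using x by (intro continuous_intros)
  then have "\<forall>\<^sub>F y in nhds x. t < k1 y - k2 y"
    using t order_tendstoD(1)[of "\<lambda>y. k1 y - k2 y" "k1 x - k2 x" "nhds x" t]
      tendsto_at_iff_tendsto_nhds[of "\<lambda>y. k1 y - k2 y" x] unfolding isCont_def by blast
  moreover have "\<forall>\<^sub>F y in nhds x. y \<in> {0<..<1}" using x by (intro eventually_nhds_in_open) auto
  ultimately have "\<forall>\<^sub>F y in nhds x. t < k1 y - k2 y \<and> y \<in> {0<..<1}" by (rule eventually_conj)
  then obtain d where d: "0 < d" "\<And>y. dist y x < d \<Longrightarrow> t < k1 y - k2 y \<and> y \<in> {0<..<1}"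
    unfolding eventually_nhds_metric by blast
  define p where "p = x - d / 2"
  define q where "q = x + d / 2"
  have near: "t < k1 y - k2 y \<and> y \<in> {0<..<1}" if "p \<le> y" "y \<le> q" for y
    using that d by (intro d(2)) (auto simp: p_def q_def dist_real_def abs_le_iff)
  have pq: "p < q" "0 \<le> p" "q \<le> 1" using near[of p] near[of q] d by (auto simp: p_def q_def)
  have "t * (v - u) \<le> measure D {u<..v}" if uv: "p \<le> u" "u \<le> v" "v \<le> q" for u v
  proof -
    have B[measurable]: "{u<..v} \<in> sets unit_leb" using uv pq by (auto simp: sets_unit_leb_iff)
    have "ennreal (t * (v - u)) = ennreal t * emeasure unit_leb {u<..v}"
      using t uv pq by (subst emeasure_unit_leb) (auto simp: ennreal_mult)
    also have "\<dots> = (\<integral>\<^sup>+x. ennreal t * indicator {u<..v} x \<partial>unit_leb)"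
      by (simp add: nn_integral_cmult_indicator)
    also have "\<dots> \<le> (\<integral>\<^sup>+x. ennreal (g1 x - g2 x) * indicator {u<..v} x \<partial>unit_leb)"
    proof (rule nn_integral_mono_AE)
      show "AE x in unit_leb. ennreal t * indicator {u<..v} x \<le> ennreal (g1 x - g2 x) * indicator {u<..v} x"
        using rep1(1) rep2(1)
      proof eventually_elim
        case (elim y)
        then show ?case using near[of y] uv by (auto simp: indicator_def intro!: ennreal_leI)
      qed
    qed
    also have "\<dots> = emeasure D {u<..v}" by (simp add: D_def emeasure_density)
    finally show ?thesis by (simp add: D.emeasure_eq_measure)
  qed
  then show ?thesis using pq t unfolding lower_bounded_on_def D_def by blast
qed

text \<open>Near 0 both measures dominate a positive multiple of Lebesgue measure. A set carrying
  one of them and missed by the other would, together with its complement, cover an interval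
  \<open>{0<..r}\<close> by Lebesgue null sets.\<close>

lemma lower_bounded_not_singular:
  assumes M: "finite_measure M" "sets M = sets unit_leb" and N: "finite_measure N" "sets N = sets unit_leb"
    and lb: "lower_bounded_on M 0 s" "lower_bounded_on N 0 s'"
    and A: "A \<in> sets unit_leb" "emeasure M ({0..1} - A) = 0" "emeasure N A = 0"
  shows False
proof -
  have null: "emeasure lborel (B \<inter> {0<..r}) = 0"
    if fin: "finite_measure P" and sets: "sets P = sets unit_leb" and lb: "lower_bounded_on P 0 s" and r: "0 < r" "r \<le> s"
      and B: "B \<in> sets unit_leb" "emeasure P B = 0" for P s r B
  proof -
    interpret P: finite_measure P by fact
    obtain t where t: "0 < t" "\<And>u v. 0 \<le> u \<Longrightarrow> u \<le> v \<Longrightarrow> v \<le> s \<Longrightarrow> t * (v - u) \<le> measure P {u<..v}" and s: "s \<le> 1"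
      using lb by (auto simp: lower_bounded_on_def)
    \<comment> \<open>The multiple of Lebesgue measure that is compared with \<open>P\<close>;
      \<open>measure_unit_leI\<close> extends the comparison from intervals to the null set
      \<open>B\<close>.\<close>
    define Q where "Q = density unit_leb (\<lambda>x. ennreal t * indicator {0<..r} x)"
    have R[measurable]: "{0<..r} \<in> sets unit_leb" using r s by (auto simp: sets_unit_leb_iff)
    have Q: "emeasure Q C = ennreal t * emeasure unit_leb (C \<inter> {0<..r})" if [measurable]: "C \<in> sets unit_leb" for C
    proof -
      have "emeasure Q C = (\<integral>\<^sup>+x. ennreal t * indicator (C \<inter> {0<..r}) x \<partial>unit_leb)"
        unfolding Q_def
        by (subst emeasure_density) (measurable, auto intro!: nn_integral_cong split: split_indicator)
      then show ?thesis by (simp add: nn_integral_cmult_indicator)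
    qed
    have setsQ: "sets Q = sets unit_leb" by (simp add: Q_def)
    have spQ: "space Q = {0..1}" by (simp add: Q_def)
    have finQ: "finite_measure Q"
    proof (rule finite_measureI)
      have "emeasure unit_leb ({0..1} \<inter> {0<..r}) \<le> emeasure unit_leb (space unit_leb)"
        by (rule emeasure_space)
      then have "emeasure unit_leb ({0..1} \<inter> {0<..r}) < \<infinity>"
        using prob_space.emeasure_space_1[OF prob_space_unit_leb] by (metis ennreal_one_less_top infinity_ennreal_def le_less_trans)
      then show "emeasure Q (space Q) \<noteq> \<infinity>"
        unfolding spQ using Q[of "{0..1}"] sets.top[of unit_leb] by (simp add: ennreal_mult_eq_top_iff)
    qed
    have "measure Q B \<le> measure P B"
    proof (rule measure_unit_leI[OF finQ setsQ fin sets _ _ B(1)])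
      have z: "{0} \<in> sets unit_leb" by (simp add: sets_unit_leb_iff)
      have "{0} \<inter> {0<..r} = {}" by auto
      then show "measure Q {0} \<le> measure P {0}" using Q[OF z] by (simp add: measure_def)
      fix u v :: real assume uv: "0 \<le> u" "u \<le> v" "v \<le> 1"
      have B: "{u<..v} \<in> sets unit_leb" using uv by (auto simp: sets_unit_leb_iff)
      show "measure Q {u<..v} \<le> measure P {u<..v}"
      proof (cases "u \<le> min v r")
        case True
        have "{u<..v} \<inter> {0<..r} = {u<..min v r}" using uv by auto
        then have "emeasure Q {u<..v} = ennreal t * ennreal (min v r - u)"
          using Q[OF B] True uv by (simp add: emeasure_unit_leb subset_iff)
        then have "measure Q {u<..v} = t * (min v r - u)" using t True by (simp add: measure_def enn2real_mult)
        also have "\<dots> \<le> measure P {u<..min v r}" using uv True r by (intro t(2)) auto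
        also have "\<dots> \<le> measure P {u<..v}" by (rule P.finite_measure_mono) (use B sets in auto)
        finally show ?thesis .
      next
        case False
        then have disj: "{u<..v} \<inter> {0<..r} = {}" using uv by auto
        have "emeasure Q {u<..v} = 0" unfolding Q[OF B] disj by simp
        then show ?thesis by (simp add: measure_def)
      qed
    qed
    moreover have "measure P B = 0" using B by (simp add: measure_def)
    ultimately have "measure Q B = 0" using measure_nonneg[of Q B] by linarith
    then have "emeasure Q B = 0" by (simp add: finite_measure.emeasure_eq_measure[OF finQ])
    then have "emeasure unit_leb (B \<inter> {0<..r}) = 0" using Q[OF B(1)] t by simp
    then show ?thesis using r s by (subst emeasure_unit_leb[symmetric]) auto
  qed
  have s: "0 < s" "0 < s'" "s \<le> 1" using lb by (auto simp: lower_bounded_on_def)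
  define r where "r = min s s'"
  have r: "0 < r" "r \<le> s" "r \<le> s'" using s by (auto simp: r_def)
  have A': "{0..1} - A \<in> sets unit_leb" using A sets.top[of unit_leb] by auto
  have "emeasure lborel (({0..1} - A) \<inter> {0<..r} \<union> A \<inter> {0<..r}) \<le> emeasure lborel (({0..1} - A) \<inter> {0<..r}) + emeasure lborel (A \<inter> {0<..r})"
    using A A' by (intro emeasure_subadditive) (auto simp: sets_unit_leb_iff)
  also have "\<dots> = 0"
    using null[OF M lb(1) r(1,2) A' A(2)] null[OF N lb(2) r(1,3) A(1,3)] by simp
  also have "({0..1} - A) \<inter> {0<..r} \<union> A \<inter> {0<..r} = {0<..r}" using r s by auto
  finally show False using r by simp
qed

context branched_map
begin

lemma acim_unique:
  fixes g1 g2 :: "real \<Rightarrow> real"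
  assumes meas [measurable]: "g1 \<in> borel_measurable unit_leb" "g2 \<in> borel_measurable unit_leb"
    and nonneg: "\<And>x. 0 \<le> g1 x" "\<And>x. 0 \<le> g2 x"
    and prob: "prob_space (density unit_leb (\<lambda>x. ennreal (g1 x)))" "prob_space (density unit_leb (\<lambda>x. ennreal (g2 x)))"
    and inv: "distr (density unit_leb (\<lambda>x. ennreal (g1 x))) unit_leb f = density unit_leb (\<lambda>x. ennreal (g1 x))"
      "distr (density unit_leb (\<lambda>x. ennreal (g2 x))) unit_leb f = density unit_leb (\<lambda>x. ennreal (g2 x))"
    and rep1: "AE x in unit_leb. k1 x = g1 x" "AE x in unit_leb. isCont k1 x"
    and rep2: "AE x in unit_leb. k2 x = g2 x" "AE x in unit_leb. isCont k2 x"
  shows "AE x in unit_leb. g1 x = g2 x"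
proof -
  define M where "M = density unit_leb (\<lambda>x. ennreal (g1 x - g2 x))"
  define N where "N = density unit_leb (\<lambda>x. ennreal (g2 x - g1 x))"
  note fin = prob[THEN prob_space.axioms(1)]
  have M: "finite_measure M" "distr M unit_leb f = M"
    unfolding M_def using density_diff_invariant[OF meas nonneg fin inv] by auto
  have N: "finite_measure N" "distr N unit_leb f = N"
    unfolding N_def using density_diff_invariant[OF meas(2,1) nonneg(2,1) fin(2,1) inv(2,1)] by auto
  have sets: "sets M = sets unit_leb" "sets N = sets unit_leb" by (simp_all add: M_def N_def)
  \<comment> \<open>Both densities have integral 1, so the positive and the negative part of their
    difference have the same integral: if one part is nonzero, so is the other.\<close>
  have le_total: "(AE x in unit_leb. g1 x \<le> g2 x) \<longleftrightarrow> (AE x in unit_leb. g2 x \<le> g1 x)"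
  proof -
    have sp: "{0..1} \<in> sets unit_leb" using sets.top[of unit_leb] by simp
    have tot: "(\<integral>\<^sup>+x. ennreal (g x) \<partial>unit_leb) = emeasure (density unit_leb (\<lambda>x. ennreal (g x))) {0..1}"
      if "g \<in> borel_measurable unit_leb" for g :: "real \<Rightarrow> real"
      using that by (subst emeasure_density[OF _ sp]) (auto intro!: nn_integral_cong)
    have int1: "(\<integral>\<^sup>+x. ennreal (g1 x) \<partial>unit_leb) = 1" "(\<integral>\<^sup>+x. ennreal (g2 x) \<partial>unit_leb) = 1"
      using prob[THEN prob_space.emeasure_space_1] by (simp_all add: tot[OF meas(1)] tot[OF meas(2)])
    have "(\<integral>\<^sup>+x. ennreal (g1 x) \<partial>unit_leb) + (\<integral>\<^sup>+x. ennreal (g2 x - g1 x) \<partial>unit_leb) =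
        (\<integral>\<^sup>+x. ennreal (g1 x) + ennreal (g2 x - g1 x) \<partial>unit_leb)"
      by (rule nn_integral_add[symmetric]) measurable
    also have "\<dots> = (\<integral>\<^sup>+x. ennreal (g2 x) + ennreal (g1 x - g2 x) \<partial>unit_leb)"
    proof (rule nn_integral_cong)
      fix x
      show "ennreal (g1 x) + ennreal (g2 x - g1 x) = ennreal (g2 x) + ennreal (g1 x - g2 x)"
        using nonneg[of x] by (cases "g1 x \<le> g2 x") (auto simp: ennreal_neg simp flip: ennreal_plus)
    qed
    also have "\<dots> = (\<integral>\<^sup>+x. ennreal (g2 x) \<partial>unit_leb) + (\<integral>\<^sup>+x. ennreal (g1 x - g2 x) \<partial>unit_leb)"
      by (rule nn_integral_add) measurable
    finally have "(\<integral>\<^sup>+x. ennreal (g2 x - g1 x) \<partial>unit_leb) = (\<integral>\<^sup>+x. ennreal (g1 x - g2 x) \<partial>unit_leb)"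
      by (simp add: int1)
    moreover have "(\<integral>\<^sup>+x. ennreal (g2 x - g1 x) \<partial>unit_leb) = 0 \<longleftrightarrow> (AE x in unit_leb. g2 x \<le> g1 x)"
      by (subst nn_integral_0_iff_AE) (auto simp: ennreal_eq_0_iff)
    moreover have "(\<integral>\<^sup>+x. ennreal (g1 x - g2 x) \<partial>unit_leb) = 0 \<longleftrightarrow> (AE x in unit_leb. g1 x \<le> g2 x)"
      by (subst nn_integral_0_iff_AE) (auto simp: ennreal_eq_0_iff)
    ultimately show ?thesis by simp
  qed
  have "AE x in unit_leb. g1 x \<le> g2 x"
  proof (rule ccontr)
    assume no: "\<not> (AE x in unit_leb. g1 x \<le> g2 x)"
    then have no': "\<not> (AE x in unit_leb. g2 x \<le> g1 x)" using le_total by simp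
    obtain s where s: "lower_bounded_on M 0 s"
      using density_diff_lower_bounded[OF meas rep1 rep2 no] M lower_bounded_near_zero[OF M(1) sets(1) M(2)]
      unfolding M_def by blast
    obtain s' where s': "lower_bounded_on N 0 s'"
      using density_diff_lower_bounded[OF meas(2,1) rep2 rep1 no'] N lower_bounded_near_zero[OF N(1) sets(2) N(2)]
      unfolding N_def by blast
    define A where "A = {x \<in> space unit_leb. g2 x < g1 x}"
    have A[measurable]: "A \<in> sets unit_leb" unfolding A_def by measurable
    have A': "{0..1} - A \<in> sets unit_leb" using sets.compl_sets[OF A] by simp
    have "emeasure N A = (\<integral>\<^sup>+x. ennreal (g2 x - g1 x) * indicator A x \<partial>unit_leb)"
      unfolding N_def by (rule emeasure_density) measurable
    also have "\<dots> = (\<integral>\<^sup>+x. 0 \<partial>unit_leb)"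
      by (rule nn_integral_cong) (auto simp: A_def indicator_def ennreal_neg)
    finally have "emeasure N A = 0" by simp
    moreover have "emeasure M ({0..1} - A) = (\<integral>\<^sup>+x. ennreal (g1 x - g2 x) * indicator ({0..1} - A) x \<partial>unit_leb)"
      unfolding M_def by (rule emeasure_density[OF _ A']) measurable
    moreover have "\<dots> = (\<integral>\<^sup>+x. 0 \<partial>unit_leb)"
      by (rule nn_integral_cong) (auto simp: A_def indicator_def ennreal_neg)
    moreover have "\<dots> = 0" by simp
    ultimately show False using lower_bounded_not_singular[OF M(1) sets(1) N(1) sets(2) s s' A] by simp
  qed
  moreover from this have "AE x in unit_leb. g2 x \<le> g1 x" using le_total by simp
  ultimately show ?thesis by eventually_elim simp
qed

end

section \<open>Skew products\<close>

lemma compact_UNIV_countable_dense: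
  assumes "compact (UNIV :: 'k::metric_space set)"
  obtains D :: "'k::metric_space set" where "countable D" "\<And>x e. 0 < e \<Longrightarrow> \<exists>d\<in>D. dist d x < e"
proof -
  have "\<forall>n. \<exists>k::'k set. finite k \<and> UNIV \<subseteq> (\<Union>x\<in>k. ball x (1 / real (Suc n)))"
    using assms unfolding compact_eq_totally_bounded by simp
  then obtain k :: "nat \<Rightarrow> 'k set" where k: "\<And>n. finite (k n)" "\<And>n. UNIV \<subseteq> (\<Union>x\<in>k n. ball x (1 / real (Suc n)))"
    by metis
  show thesis
  proof
    show "countable (\<Union>n. k n)" using k(1) by (auto intro: countable_finite)
    fix x :: 'k and e :: real assume "0 < e"
    then obtain n where n: "1 / real (Suc n) < e" using nat_approx_posE by blast
    then obtain d where "d \<in> k n" "dist d x < 1 / real (Suc n)" using k(2)[of n] by force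
    then show "\<exists>d\<in>\<Union>n. k n. dist d x < e" using n by (intro bexI[of _ d]) auto
  qed
qed

text \<open>The type \<open>'k\<close> is merely a metric space. Compactness makes it separable, so
  open sets of the product are countable unions of products of balls.\<close>

lemma sets_borel_prod_compact:
  assumes "compact (UNIV :: 'k::metric_space set)"
  shows "sets (borel :: (real \<times> 'k) measure) = sets (borel \<Otimes>\<^sub>M borel)"
proof
  have fst: "fst \<in> (borel :: (real \<times> 'k) measure) \<rightarrow>\<^sub>M borel"
    by (intro borel_measurable_continuous_onI continuous_on_fst continuous_on_id)
  have snd: "snd \<in> (borel :: (real \<times> 'k) measure) \<rightarrow>\<^sub>M borel"
    by (intro borel_measurable_continuous_onI continuous_on_snd continuous_on_id)
  have "(\<lambda>p. (fst p, snd p)) \<in> (borel :: (real \<times> 'k) measure) \<rightarrow>\<^sub>M borel \<Otimes>\<^sub>M borel"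
    by (rule measurable_Pair[OF fst snd])
  then have id: "(\<lambda>p. p) \<in> (borel :: (real \<times> 'k) measure) \<rightarrow>\<^sub>M borel \<Otimes>\<^sub>M borel" by simp
  show "sets (borel \<Otimes>\<^sub>M borel) \<subseteq> sets (borel :: (real \<times> 'k) measure)"
    using measurable_sets[OF id] by (auto simp: space_pair_measure)
  obtain D :: "'k set" where D: "countable D" "\<And>x e. 0 < e \<Longrightarrow> \<exists>d\<in>D. dist d x < e"
    by (rule compact_UNIV_countable_dense[OF assms]) blast
  have "S \<in> sets (borel \<Otimes>\<^sub>M borel)" if S: "open S" for S :: "(real \<times> 'k) set"
  proof -
    define I where "I = {(q, d, n::nat). q \<in> \<rat> \<and> d \<in> D \<and> ball q (1 / real (Suc n)) \<times> ball d (1 / real (Suc n)) \<subseteq> S}"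
    define B where "B = (\<lambda>(q::real, d::'k, n::nat). ball q (1 / real (Suc n)) \<times> ball d (1 / real (Suc n)))"
    have "I \<subseteq> \<rat> \<times> D \<times> UNIV" by (auto simp: I_def)
    then have "countable I" by (rule countable_subset) (intro countable_SIGMA D countable_rat countableI_type)
    moreover have "B i \<in> sets (borel \<Otimes>\<^sub>M borel)" for i by (cases i) (auto simp: B_def)
    ultimately have "(\<Union>i\<in>I. B i) \<in> sets (borel \<Otimes>\<^sub>M borel)" by (intro sets.countable_UN') auto
    moreover have "(\<Union>i\<in>I. B i) = S"
    proof
      show "(\<Union>i\<in>I. B i) \<subseteq> S" by (auto simp: I_def B_def)
      show "S \<subseteq> (\<Union>i\<in>I. B i)"
      proof
        fix p assume p: "p \<in> S"
        obtain x y where xy: "p = (x, y)" by (cases p)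
        from open_prod_elim[OF S p] obtain V W where "open V" "open W" "p \<in> V \<times> W" "V \<times> W \<subseteq> S"
          by blast
        then have VW: "open V" "open W" "x \<in> V" "y \<in> W" "V \<times> W \<subseteq> S" using xy by auto
        obtain e1 where e1: "0 < e1" "ball x e1 \<subseteq> V" using VW(1,3) by (meson openE)
        obtain e2 where e2: "0 < e2" "ball y e2 \<subseteq> W" using VW(2,4) by (meson openE)
        obtain n where n: "1 / real (Suc n) < min e1 e2 / 2" using nat_approx_posE[of "min e1 e2 / 2"] e1 e2 by auto
        obtain d where d: "d \<in> D" "dist d y < 1 / real (Suc n)" using D(2)[of "1 / real (Suc n)" y] by auto
        obtain q where q: "q \<in> \<rat>" "dist q x < 1 / real (Suc n)"
        proof -
          have "x < x + 1 / real (Suc n)" by simp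
          from Rats_dense_in_real[OF this] obtain q where "q \<in> \<rat>" "x < q" "q < x + 1 / real (Suc n)" by blast
          then show thesis by (intro that[of q]) (auto simp: dist_real_def simp del: of_nat_Suc)
        qed
        have "ball q (1 / real (Suc n)) \<subseteq> ball x e1"
        proof
          fix z assume "z \<in> ball q (1 / real (Suc n))"
          then show "z \<in> ball x e1"
            using q n dist_triangle[of x z q] by (auto simp: dist_commute simp del: of_nat_Suc)
        qed
        moreover have "ball d (1 / real (Suc n)) \<subseteq> ball y e2"
        proof
          fix z assume "z \<in> ball d (1 / real (Suc n))"
          then show "z \<in> ball y e2"
            using d n dist_triangle[of y z d] by (auto simp: dist_commute simp del: of_nat_Suc)
        qed
        ultimately have "ball q (1 / real (Suc n)) \<times> ball d (1 / real (Suc n)) \<subseteq> V \<times> W"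
          using e1 e2 by blast
        then have "(q, d, n) \<in> I" using q d VW(5) unfolding I_def by blast
        moreover have "p \<in> B (q, d, n)" using q d xy by (simp add: B_def del: of_nat_Suc)
        ultimately show "p \<in> (\<Union>i\<in>I. B i)" by blast
      qed
    qed
    ultimately show ?thesis by simp
  qed
  then have "sigma_sets UNIV {S :: (real \<times> 'k) set. open S} \<subseteq> sets (borel \<Otimes>\<^sub>M borel)"
    by (intro sets.sigma_sets_subset') (auto simp: space_pair_measure intro!: sets.top[of "borel \<Otimes>\<^sub>M borel", unfolded space_pair_measure, simplified])
  then show "sets (borel :: (real \<times> 'k) measure) \<subseteq> sets (borel \<Otimes>\<^sub>M borel)"
    by (simp add: borel_def)
qed

lemma space_skew_space: "space (skew_space :: (real \<times> 'k::metric_space) measure) = {0..1} \<times> UNIV"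
  by (simp add: skew_space_def space_restrict_space)

lemma sets_skew_space:
  assumes "compact (UNIV :: 'k::metric_space set)"
  shows "sets (skew_space :: (real \<times> 'k) measure) = sets (unit_leb \<Otimes>\<^sub>M borel)"
proof
  have R: "({0..1} :: real set) \<times> (UNIV :: 'k set) \<in> sets borel"
    unfolding sets_borel_prod_compact[OF assms] by auto
  have in_skew: "E \<in> sets (skew_space :: (real \<times> 'k) measure) \<longleftrightarrow> E \<in> sets (borel \<Otimes>\<^sub>M borel) \<and> E \<subseteq> {0..1} \<times> UNIV" for E
    unfolding skew_space_def by (subst sets_restrict_space_iff) (use R in \<open>auto simp: sets_borel_prod_compact[OF assms]\<close>)
  have m1: "(\<lambda>p. p) \<in> (unit_leb \<Otimes>\<^sub>M (borel :: 'k measure)) \<rightarrow>\<^sub>M borel \<Otimes>\<^sub>M borel"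
  proof -
    have "(\<lambda>p. (fst p, snd p)) \<in> (unit_leb \<Otimes>\<^sub>M (borel :: 'k measure)) \<rightarrow>\<^sub>M borel \<Otimes>\<^sub>M borel"
      by (intro measurable_Pair measurable_compose[OF measurable_fst id_measurable_unit_leb] measurable_snd)
    then show ?thesis by simp
  qed
  show "sets (skew_space :: (real \<times> 'k) measure) \<subseteq> sets (unit_leb \<Otimes>\<^sub>M borel)"
  proof
    fix E assume "E \<in> sets (skew_space :: (real \<times> 'k) measure)"
    then have E: "E \<in> sets (borel \<Otimes>\<^sub>M borel)" "E \<subseteq> {0..1} \<times> UNIV" by (auto simp: in_skew)
    moreover have "(\<lambda>p. p) -` E \<inter> space (unit_leb \<Otimes>\<^sub>M (borel :: 'k measure)) = E"
      using E by (auto simp: space_pair_measure)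
    ultimately show "E \<in> sets (unit_leb \<Otimes>\<^sub>M borel)" using measurable_sets[OF m1 E(1)] by simp
  qed
  show "sets (unit_leb \<Otimes>\<^sub>M borel) \<subseteq> sets (skew_space :: (real \<times> 'k) measure)"
    unfolding sets_pair_measure
  proof (rule sets.sigma_sets_subset', clarify)
    fix A and B :: "'k set" assume A: "A \<in> sets unit_leb" and B: "B \<in> sets borel"
    then show "A \<times> B \<in> sets skew_space" unfolding in_skew by (auto simp: sets_unit_leb_iff)
  next
    show "space unit_leb \<times> space (borel :: 'k measure) \<in> sets skew_space"
      using sets.top[of "skew_space :: (real \<times> 'k) measure"] by (simp add: space_skew_space)
  qed
qed

section \<open>Fiber contraction: an invariant measure is determined by its marginal\<close>

lemma distr_funpow:
  fixes F :: "'a \<Rightarrow> 'a"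
  assumes "distr M N F = M" "sets M = sets N" "F \<in> N \<rightarrow>\<^sub>M N"
  shows "(F ^^ n) \<in> N \<rightarrow>\<^sub>M N \<and> distr M N (F ^^ n) = M"
proof (induction n)
  case 0
  show ?case using assms by (simp add: distr_id2 id_def)
next
  case (Suc n)
  have F: "F \<in> M \<rightarrow>\<^sub>M N" "(F ^^ n) \<in> M \<rightarrow>\<^sub>M N"
    using assms Suc by (simp_all add: measurable_cong_sets[OF assms(2) refl])
  have "distr M N (F ^^ Suc n) = distr (distr M N (F ^^ n)) N F"
    using F(2) assms(3) by (subst distr_distr) (auto simp: comp_def)
  then show ?case using Suc assms by (auto simp: comp_def intro: measurable_compose)
qed

lemma funpow_skew:
  fixes F :: "real \<times> 'k::metric_space \<Rightarrow> real \<times> 'k"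
  assumes F: "F = (\<lambda>(x, y). (f x, G (x, y)))"
    and contr: "\<And>x z1 z2. dist (G (x, z1)) (G (x, z2)) \<le> \<alpha> * dist z1 z2" and \<alpha>: "0 \<le> \<alpha>"
  shows "fst ((F ^^ n) (x, y)) = (f ^^ n) x"
    and "dist (snd ((F ^^ n) (x, y))) (snd ((F ^^ n) (x, z))) \<le> \<alpha> ^ n * dist y z"
proof -
  show *: "fst ((F ^^ n) (x, y)) = (f ^^ n) x" for n x y
    by (induction n) (auto simp: F case_prod_beta)
  show "dist (snd ((F ^^ n) (x, y))) (snd ((F ^^ n) (x, z))) \<le> \<alpha> ^ n * dist y z"
  proof (induction n)
    case (Suc n)
    have "dist (snd ((F ^^ Suc n) (x, y))) (snd ((F ^^ Suc n) (x, z))) =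
      dist (G ((f ^^ n) x, snd ((F ^^ n) (x, y)))) (G ((f ^^ n) x, snd ((F ^^ n) (x, z))))"
      using *[of n x y] *[of n x z] by (simp add: F case_prod_beta)
    also have "\<dots> \<le> \<alpha> * dist (snd ((F ^^ n) (x, y))) (snd ((F ^^ n) (x, z)))" by (rule contr)
    also have "\<dots> \<le> \<alpha> * (\<alpha> ^ n * dist y z)" using Suc \<alpha> by (intro mult_left_mono)
    finally show ?case by simp
  qed simp
qed

text \<open>By invariance a test function may be replaced by its composition with
  \<open>F ^^ n\<close>, which depends on the fiber coordinate only up to an error of order
  \<open>\<alpha> ^ n\<close>. Fixing that coordinate leaves an integral against the marginal,
  common to both measures.\<close>

lemma invariant_measure_determined_by_marginal:
  fixes F :: "real \<times> 'k::metric_space \<Rightarrow> real \<times> 'k"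
  assumes cpt: "compact (UNIV :: 'k set)"
    and F: "F = (\<lambda>(x, y). (f x, G (x, y)))" and F_meas: "F \<in> skew_space \<rightarrow>\<^sub>M skew_space"
    and contr: "\<And>x z1 z2. dist (G (x, z1)) (G (x, z2)) \<le> \<alpha> * dist z1 z2" and \<alpha>: "0 \<le> \<alpha>" "\<alpha> < 1"
    and \<mu>: "prob_space \<mu>" "sets \<mu> = sets skew_space" "distr \<mu> skew_space F = \<mu>"
    and \<nu>: "prob_space \<nu>" "sets \<nu> = sets skew_space" "distr \<nu> skew_space F = \<nu>"
    and marg: "marginal \<mu> = marginal \<nu>"
  shows "\<mu> = \<nu>"
proof -
  note sk = sets_skew_space[OF cpt]
  interpret \<mu>: prob_space \<mu> by fact
  interpret \<nu>: prob_space \<nu> by fact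
  have fst_meas: "(fst :: real \<times> 'k \<Rightarrow> real) \<in> skew_space \<rightarrow>\<^sub>M unit_leb"
    by (simp add: measurable_cong_sets[OF sk refl])
  have fiber_meas: "(\<lambda>x. (x, y)) \<in> unit_leb \<rightarrow>\<^sub>M skew_space" for y :: 'k
    by (simp add: measurable_cong_sets[OF refl sk])
  obtain B where B: "\<And>y z :: 'k. dist y z \<le> B"
    using compact_imp_bounded[OF cpt] unfolding bounded_two_points by auto
  have lip: "(\<integral>p. indicator A (fst p) * h (snd p) \<partial>\<mu>) = (\<integral>p. indicator A (fst p) * h (snd p) \<partial>\<nu>)"
    if A: "A \<in> sets unit_leb" and h: "L-lipschitz_on UNIV h" "\<And>y. \<bar>h y\<bar> \<le> 1" for A and h :: "'k \<Rightarrow> real" and L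
  proof -
    define \<phi> where "\<phi> p = indicator A (fst p) * h (snd p)" for p :: "real \<times> 'k"
    have [measurable]: "h \<in> borel_measurable borel"
      by (intro borel_measurable_continuous_onI lipschitz_on_continuous_on[OF h(1)])
    have \<phi>_meas: "\<phi> \<in> borel_measurable skew_space"
      unfolding \<phi>_def using A by (simp add: measurable_cong_sets[OF sk refl])
    have \<phi>_bdd: "\<bar>\<phi> p\<bar> \<le> 1" for p using h(2) by (auto simp: \<phi>_def indicator_def)
    define y0 :: 'k where "y0 = undefined"
    have L: "0 \<le> L" using h(1) by (rule lipschitz_on_nonneg)
    \<comment> \<open>The points compared lie on the same fiber and stay on the same fiber under
      iteration. The factor in the base coordinate can therefore be any measurable indicator; only
      \<open>h\<close> has to be Lipschitz.\<close>
    have near: "\<bar>(\<integral>p. \<phi> p \<partial>M) - (\<integral>x. \<phi> ((F ^^ n) (x, y0)) \<partial>marginal M)\<bar> \<le> L * (\<alpha> ^ n * B)"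
      if M: "prob_space M" "sets M = sets skew_space" "distr M skew_space F = M" for M n
    proof -
      interpret M: prob_space M by fact
      have Fn: "F ^^ n \<in> skew_space \<rightarrow>\<^sub>M skew_space" "distr M skew_space (F ^^ n) = M"
        using distr_funpow[OF M(3,2) F_meas] by auto
      have FnM: "F ^^ n \<in> M \<rightarrow>\<^sub>M skew_space" and fstM: "fst \<in> M \<rightarrow>\<^sub>M unit_leb"
        using Fn(1) fst_meas by (simp_all add: measurable_cong_sets[OF M(2) refl])
      have fib: "(\<lambda>x. \<phi> ((F ^^ n) (x, y0))) \<in> borel_measurable unit_leb"
        using measurable_compose[OF measurable_compose[OF fiber_meas Fn(1)] \<phi>_meas] by simp
      have m1: "(\<lambda>p. \<phi> ((F ^^ n) p)) \<in> borel_measurable M"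
        by (rule measurable_compose[OF FnM \<phi>_meas])
      have m2: "(\<lambda>p. \<phi> ((F ^^ n) (fst p, y0))) \<in> borel_measurable M"
        using measurable_compose[OF fstM fib] by simp
      have i1: "integrable M (\<lambda>p. \<phi> ((F ^^ n) p))"
        by (rule M.integrable_const_bound[where B = 1]) (use m1 \<phi>_bdd in auto)
      have i2: "integrable M (\<lambda>p. \<phi> ((F ^^ n) (fst p, y0)))"
        by (rule M.integrable_const_bound[where B = 1]) (use m2 \<phi>_bdd in auto)
      have "(\<integral>p. \<phi> p \<partial>M) = (\<integral>p. \<phi> ((F ^^ n) p) \<partial>M)"
        using integral_distr[OF FnM \<phi>_meas] Fn(2) by simp
      moreover have "(\<integral>x. \<phi> ((F ^^ n) (x, y0)) \<partial>marginal M) = (\<integral>p. \<phi> ((F ^^ n) (fst p, y0)) \<partial>M)"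
        unfolding marginal_def by (rule integral_distr[OF fstM fib])
      ultimately have "(\<integral>p. \<phi> p \<partial>M) - (\<integral>x. \<phi> ((F ^^ n) (x, y0)) \<partial>marginal M) =
          (\<integral>p. \<phi> ((F ^^ n) p) - \<phi> ((F ^^ n) (fst p, y0)) \<partial>M)"
        using i1 i2 by simp
      also have "\<bar>\<dots>\<bar> \<le> L * (\<alpha> ^ n * B)"
      proof -
        have bd: "\<bar>\<phi> ((F ^^ n) p) - \<phi> ((F ^^ n) (fst p, y0))\<bar> \<le> L * (\<alpha> ^ n * B)" for p
        proof -
          obtain x y where p: "p = (x, y)" by (cases p)
          have "\<phi> ((F ^^ n) p) - \<phi> ((F ^^ n) (fst p, y0)) =
             indicator A ((f ^^ n) x) * (h (snd ((F ^^ n) (x, y))) - h (snd ((F ^^ n) (x, y0))))"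
            using funpow_skew(1)[OF F contr \<alpha>(1)] by (simp add: \<phi>_def p right_diff_distrib)
          also have "\<bar>\<dots>\<bar> \<le> \<bar>h (snd ((F ^^ n) (x, y))) - h (snd ((F ^^ n) (x, y0)))\<bar>"
            by (simp add: indicator_def)
          also have "\<dots> \<le> L * dist (snd ((F ^^ n) (x, y))) (snd ((F ^^ n) (x, y0)))"
            using lipschitz_onD[OF h(1)] by (simp add: dist_real_def)
          also have "\<dots> \<le> L * (\<alpha> ^ n * dist y y0)"
            using funpow_skew(2)[OF F contr \<alpha>(1)] L by (intro mult_left_mono) auto
          also have "\<dots> \<le> L * (\<alpha> ^ n * B)" using B L \<alpha> by (intro mult_left_mono) auto
          finally show ?thesis .
        qed
        have "\<bar>\<integral>p. \<phi> ((F ^^ n) p) - \<phi> ((F ^^ n) (fst p, y0)) \<partial>M\<bar> \<le> (\<integral>p. \<bar>\<phi> ((F ^^ n) p) - \<phi> ((F ^^ n) (fst p, y0))\<bar> \<partial>M)"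
          using integral_norm_bound[of M "\<lambda>p. \<phi> ((F ^^ n) p) - \<phi> ((F ^^ n) (fst p, y0))"] by simp
        also have "\<dots> \<le> (\<integral>p. L * (\<alpha> ^ n * B) \<partial>M)"
          using i1 i2 bd by (intro integral_mono) auto
        finally show ?thesis by (simp add: M.prob_space)
      qed
      finally show ?thesis .
    qed
    have "\<bar>(\<integral>p. \<phi> p \<partial>\<mu>) - (\<integral>p. \<phi> p \<partial>\<nu>)\<bar> \<le> 2 * (L * (\<alpha> ^ n * B))" for n
      using near[OF \<mu>, of n] near[OF \<nu>, of n] marg by simp
    moreover have "(\<lambda>n. 2 * (L * (\<alpha> ^ n * B))) \<longlonglongrightarrow> 2 * (L * (0 * B))"
      using \<alpha> by (intro tendsto_intros LIMSEQ_realpow_zero) auto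
    ultimately have "\<bar>(\<integral>p. \<phi> p \<partial>\<mu>) - (\<integral>p. \<phi> p \<partial>\<nu>)\<bar> \<le> 2 * (L * (0 * B))"
      by (meson LIMSEQ_le_const)
    then show ?thesis by (simp add: \<phi>_def)
  qed
  have closed_eq: "emeasure \<mu> (A \<times> C) = emeasure \<nu> (A \<times> C)" if A: "A \<in> sets unit_leb" and C: "closed C" for A and C :: "'k set"
  proof (cases "C = {}")
    case False
    \<comment> \<open>Lipschitz functions decreasing to the indicator of the closed set
      \<open>C\<close>; their constants grow with \<open>k\<close>, which is harmless because
      equality is known for every Lipschitz constant.\<close>
    define h where "h k y = max 0 (1 - real k * infdist y C)" for k y
    have h_lip: "(real k)-lipschitz_on UNIV (h k)" for k
    proof (rule lipschitz_onI)
      fix y z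
      have "\<bar>h k y - h k z\<bar> \<le> \<bar>real k * infdist y C - real k * infdist z C\<bar>" by (auto simp: h_def)
      also have "\<dots> = real k * \<bar>infdist y C - infdist z C\<bar>" by (simp add: abs_mult flip: right_diff_distrib)
      also have "\<dots> \<le> real k * dist y z" by (intro mult_left_mono infdist_triangle_abs) auto
      finally show "dist (h k y) (h k z) \<le> real k * dist y z" by (simp add: dist_real_def)
    qed simp
    have h_bdd: "\<bar>h k y\<bar> \<le> 1" for k y by (auto simp: h_def infdist_nonneg)
    have h_lim: "(\<lambda>k. h k y) \<longlonglongrightarrow> indicator C y" for y
    proof (cases "y \<in> C")
      case True
      then show ?thesis by (simp add: h_def)
    next
      case no: False
      then have d: "0 < infdist y C" using C False by (simp add: infdist_pos_not_in_closed)
      obtain N where N: "1 < real N * infdist y C" using reals_Archimedean3[OF d] by blast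
      have "h k y = 0" if "N \<le> k" for k
      proof -
        have "real N * infdist y C \<le> real k * infdist y C" using that d by (intro mult_right_mono) auto
        then show ?thesis using N by (simp add: h_def)
      qed
      then have "\<forall>\<^sub>F k in sequentially. h k y = indicator C y"
        using no unfolding eventually_sequentially by (intro exI[of _ N]) simp
      then show ?thesis by (rule tendsto_eventually)
    qed
    have C_meas: "C \<in> sets borel" using C by simp
    have conv: "(\<lambda>k. \<integral>p. indicator A (fst p) * h k (snd p) \<partial>M) \<longlonglongrightarrow> measure M (A \<times> C)"
      if M: "prob_space M" "sets M = sets skew_space" for M
    proof -
      interpret M: prob_space M by fact
      have sM: "sets M = sets (unit_leb \<Otimes>\<^sub>M borel)" using M sk by simp
      have AC: "A \<times> C \<in> sets M" unfolding sM using A C_meas by auto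
      have [measurable]: "h k \<in> borel_measurable borel" for k
        by (intro borel_measurable_continuous_onI lipschitz_on_continuous_on[OF h_lip])
      have "(\<lambda>k. \<integral>p. indicator A (fst p) * h k (snd p) \<partial>M) \<longlonglongrightarrow> (\<integral>p. indicator (A \<times> C) p \<partial>M)"
      proof (rule integral_dominated_convergence[where w = "\<lambda>_. 1"])
        show "indicator (A \<times> C) \<in> borel_measurable M" using AC by simp
        show "(\<lambda>p. indicator A (fst p) * h k (snd p)) \<in> borel_measurable M" for k
          using A by (simp add: measurable_cong_sets[OF sM refl])
        show "AE p in M. (\<lambda>k. indicator A (fst p) * h k (snd p)) \<longlonglongrightarrow> indicator (A \<times> C) p"
        proof (rule AE_I2)
          fix p :: "real \<times> 'k"
          have "(\<lambda>k. indicator A (fst p) * h k (snd p)) \<longlonglongrightarrow> indicator A (fst p) * indicator C (snd p)"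
            by (intro tendsto_intros h_lim)
          then show "(\<lambda>k. indicator A (fst p) * h k (snd p)) \<longlonglongrightarrow> indicator (A \<times> C) p"
            by (simp add: indicator_times)
        qed
        show "AE p in M. norm (indicator A (fst p) * h k (snd p)) \<le> 1" for k
          using h_bdd by (auto simp: indicator_def)
      qed simp
      then show ?thesis using AC by simp
    qed
    have "measure \<mu> (A \<times> C) = measure \<nu> (A \<times> C)"
      using conv[OF \<mu>(1,2)] conv[OF \<nu>(1,2)] lip[OF A h_lip h_bdd] LIMSEQ_unique by auto
    then show ?thesis by (simp add: \<mu>.emeasure_eq_measure \<nu>.emeasure_eq_measure)
  qed simp
  define E where "E = {A \<times> C | A C. A \<in> sets unit_leb \<and> closed (C :: 'k set)}"
  have sE: "sets skew_space = sigma_sets ({0..1} \<times> UNIV) E"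
  proof -
    have s1: "sets unit_leb = sets (sigma {0..1} (sets unit_leb))"
      using sets.sets_measure_of_eq[of unit_leb] by simp
    have "sets (unit_leb \<Otimes>\<^sub>M (borel :: 'k measure)) = sets (sigma {0..1} (sets unit_leb) \<Otimes>\<^sub>M sigma UNIV (Collect closed))"
      by (rule sets_pair_measure_cong[OF s1]) (simp add: borel_eq_closed)
    also have "sigma {0..1} (sets unit_leb) \<Otimes>\<^sub>M sigma UNIV (Collect closed) =
       sigma ({0..1} \<times> (UNIV :: 'k set)) {a \<times> b | a b. a \<in> sets unit_leb \<and> b \<in> Collect closed}"
    proof (rule sigma_prod)
      show "\<exists>E\<subseteq>sets unit_leb. countable E \<and> {0..1} = \<Union>E"
        by (rule exI[of _ "{{0..1}}"]) (use sets.top[of unit_leb] in auto)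
      show "sets unit_leb \<subseteq> Pow {0..1}" using sets.sets_into_space[of _ unit_leb] by auto
      show "\<exists>E\<subseteq>Collect closed. countable E \<and> (UNIV :: 'k set) = \<Union>E"
        by (rule exI[of _ "{UNIV}"]) auto
    qed simp
    also have "sets \<dots> = sigma_sets ({0..1} \<times> UNIV) E"
      unfolding E_def by (subst sets_measure_of) (auto simp: sets_unit_leb_iff)
    finally show ?thesis using sk by simp
  qed
  show ?thesis
  proof (rule measure_eqI_generator_eq[where E = E and \<Omega> = "{0..1} \<times> UNIV" and A = "\<lambda>_. {0..1} \<times> UNIV"])
    show "Int_stable E"
    proof (rule Int_stableI)
      fix P Q assume "P \<in> E" "Q \<in> E"
      then obtain A C A' C' where *: "P = A \<times> C" "Q = A' \<times> C'" "A \<in> sets unit_leb" "A' \<in> sets unit_leb" "closed C" "closed C'"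
        by (auto simp: E_def)
      then have "P \<inter> Q = (A \<inter> A') \<times> (C \<inter> C')" by auto
      then show "P \<inter> Q \<in> E" using * by (auto simp: E_def)
    qed
    show "E \<subseteq> Pow ({0..1} \<times> UNIV)" by (auto simp: E_def sets_unit_leb_iff)
    show "sets \<mu> = sigma_sets ({0..1} \<times> UNIV) E" "sets \<nu> = sigma_sets ({0..1} \<times> UNIV) E"
      using \<mu>(2) \<nu>(2) sE by simp_all
    show "range (\<lambda>_::nat. {0..1} \<times> UNIV) \<subseteq> E"
      using sets.top[of unit_leb] by (auto simp: E_def)
    show "emeasure \<mu> X = emeasure \<nu> X" if "X \<in> E" for X
      using that closed_eq by (auto simp: E_def)
  qed auto
qed

section \<open>Random backward orbits and the invariant measure of the skew product\<close>

context branched_map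
begin

lemma psi_measurable: "psi i \<in> unit_leb \<rightarrow>\<^sub>M unit_leb"
proof -
  have psi_borel: "psi i \<in> borel_measurable borel"
    by (rule borel_measurable_mono) (simp add: mono_def psi_mono)
  show ?thesis
  proof (rule measurableI)
    fix A assume "A \<in> sets unit_leb"
    then have "psi i -` A \<in> sets borel" using measurable_sets[OF psi_borel, of A] by (simp add: sets_unit_leb_iff)
    moreover have "psi i -` A \<inter> {0..1} \<in> sets borel" using calculation by auto
    ultimately show "psi i -` A \<inter> space unit_leb \<in> sets unit_leb" by (simp add: sets_unit_leb_iff)
  qed (use psi_in_unit in simp)
qed

text \<open>
  The sampling map draws from the conditional distribution, given its image under \<open>f\<close>, of a point
  with law \<open>\<nu>\<close>: the branch is chosen by inverting the distribution function of the weights.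
\<close>

lemma inverse_branch_sampling:
  assumes prob: "prob_space \<nu>" and sets: "sets \<nu> = sets unit_leb"
    and ac: "absolutely_continuous unit_leb \<nu>" and inv: "distr \<nu> unit_leb f = \<nu>"
  obtains \<Phi> :: "real \<times> real \<Rightarrow> real" where "\<Phi> \<in> unit_leb \<Otimes>\<^sub>M unit_leb \<rightarrow>\<^sub>M unit_leb"
    "\<And>q. q \<in> borel_measurable (unit_leb \<Otimes>\<^sub>M unit_leb) \<Longrightarrow>
      (\<integral>\<^sup>+x. \<integral>\<^sup>+u. q (x, \<Phi> (x, u)) \<partial>unit_leb \<partial>\<nu>) = (\<integral>\<^sup>+t. q (f t, t) \<partial>\<nu>)"
proof -
  interpret \<nu>: prob_space \<nu> by fact
  have sp: "space \<nu> = {0..1}" using sets_eq_imp_space_eq[OF sets] by simp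
  note [measurable_cong] = sets
  have br[measurable]: "branch i \<in> sets unit_leb" for i
    using branch_subset[of i] by (simp add: sets_unit_leb_iff)
  \<comment> \<open>The law of \<open>f t\<close> restricted to the event that \<open>t\<close> lies
    in branch \<open>i\<close>. These laws add up to the image of \<nu> under \<open>f\<close>, that
    is to \<nu>.\<close>
  define \<nu>i where "\<nu>i i = distr (density \<nu> (indicator (branch i))) unit_leb f" for i
  have int_\<nu>i: "(\<integral>\<^sup>+x. g x \<partial>\<nu>i i) = (\<integral>\<^sup>+t. indicator (branch i) t * g (f t) \<partial>\<nu>)"
    if [measurable]: "g \<in> borel_measurable unit_leb" for g i
  proof -
    have "(\<integral>\<^sup>+x. g x \<partial>\<nu>i i) = (\<integral>\<^sup>+t. g (f t) \<partial>density \<nu> (indicator (branch i)))"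
      unfolding \<nu>i_def by (rule nn_integral_distr) measurable
    also have "\<dots> = (\<integral>\<^sup>+t. indicator (branch i) t * g (f t) \<partial>\<nu>)"
      by (rule nn_integral_density) measurable
    finally show ?thesis .
  qed
  \<comment> \<open>The conditional probability, given that the image is \<open>x\<close>, that the
    preimage was taken in branch \<open>i\<close>.\<close>
  define w where "w i = RN_deriv \<nu> (\<nu>i i)" for i
  have w_meas[measurable]: "w i \<in> borel_measurable unit_leb" for i
    unfolding w_def using borel_measurable_RN_deriv[of \<nu> "\<nu>i i"] by (simp add: measurable_cong_sets[OF sets refl])
  have em_le: "emeasure (\<nu>i i) E \<le> emeasure \<nu> E" if E: "E \<in> sets unit_leb" for i E
  proof -
    have [measurable]: "E \<in> sets unit_leb" by fact
    have "emeasure (\<nu>i i) E = (\<integral>\<^sup>+x. indicator E x \<partial>\<nu>i i)" using E by (simp add: \<nu>i_def)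
    also have "\<dots> = (\<integral>\<^sup>+t. indicator (branch i) t * indicator E (f t) \<partial>\<nu>)" by (rule int_\<nu>i) measurable
    also have "\<dots> \<le> (\<integral>\<^sup>+t. indicator E (f t) \<partial>\<nu>)" by (intro nn_integral_mono) (auto simp: indicator_def)
    also have "\<dots> = (\<integral>\<^sup>+x. indicator E x \<partial>distr \<nu> unit_leb f)" by (rule nn_integral_distr[symmetric]) measurable
    also have "\<dots> = emeasure \<nu> E" unfolding inv using E sets by simp
    finally show ?thesis .
  qed
  have dens: "density \<nu> (w i) = \<nu>i i" for i
    unfolding w_def
  proof (rule \<nu>.density_RN_deriv)
    show "absolutely_continuous \<nu> (\<nu>i i)"
      unfolding absolutely_continuous_def
    proof
      fix N assume N: "N \<in> null_sets \<nu>"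
      then have "emeasure (\<nu>i i) N \<le> 0" using em_le[of N i] by (auto simp: null_sets_def sets)
      then show "N \<in> null_sets (\<nu>i i)" using N by (auto simp: null_sets_def sets \<nu>i_def)
    qed
  qed (simp add: \<nu>i_def sets)
  have int_w: "(\<integral>\<^sup>+x. w i x * g x \<partial>\<nu>) = (\<integral>\<^sup>+t. indicator (branch i) t * g (f t) \<partial>\<nu>)"
    if g[measurable]: "g \<in> borel_measurable unit_leb" for g i
    using nn_integral_density[of "w i" \<nu> g] int_\<nu>i[OF g, of i] by (simp add: dens)
  have AE_branch: "AE t in \<nu>. (\<Sum>i. indicator (branch i) t :: ennreal) = 1"
  proof -
    have U: "(\<Union>i. branch i) \<in> sets unit_leb" using br by auto
    have null: "{0..1} - (\<Union>i. branch i) \<in> null_sets unit_leb"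
      using branch_full sets.compl_sets[OF U] by (auto simp: null_sets_def emeasure_unit_leb)
    then have "{0..1} - (\<Union>i. branch i) \<in> null_sets \<nu>" using ac by (auto simp: absolutely_continuous_def)
    then have "AE t in \<nu>. t \<notin> {0..1} - (\<Union>i. branch i)" by (rule AE_not_in)
    then show ?thesis using AE_space
    proof eventually_elim
      case (elim t)
      then have "t \<in> (\<Union>i. branch i)" by (auto simp: sp)
      then show ?case by (simp add: suminf_indicator[OF branch_disjoint])
    qed
  qed
  have sum_int: "(\<Sum>i. \<integral>\<^sup>+t. indicator (branch i) t * g t \<partial>\<nu>) = (\<integral>\<^sup>+t. g t \<partial>\<nu>)"
    if [measurable]: "g \<in> borel_measurable unit_leb" for g :: "real \<Rightarrow> ennreal"
  proof -
    have "(\<Sum>i. \<integral>\<^sup>+t. indicator (branch i) t * g t \<partial>\<nu>) = (\<integral>\<^sup>+t. (\<Sum>i. indicator (branch i) t * g t) \<partial>\<nu>)"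
      by (rule nn_integral_suminf[symmetric]) measurable
    also have "\<dots> = (\<integral>\<^sup>+t. g t \<partial>\<nu>)"
      by (rule nn_integral_cong_AE) (use AE_branch in \<open>auto elim!: eventually_mono simp: ennreal_suminf_multc\<close>)
    finally show ?thesis .
  qed
  \<comment> \<open>Almost every point lies in exactly one branch, so by invariance the sum of the
    weights has the same integral as 1 over every Borel set.\<close>
  have AE_w: "AE x in \<nu>. (\<Sum>i. w i x) = 1"
  proof -
    have "density \<nu> (\<lambda>x. \<Sum>i. w i x) = density \<nu> (\<lambda>x. 1)"
    proof (rule measure_eqI)
      fix E assume "E \<in> sets (density \<nu> (\<lambda>x. \<Sum>i. w i x))"
      then have E[measurable]: "E \<in> sets unit_leb" by (simp add: sets)
      then have E': "E \<in> sets \<nu>" by (simp add: sets)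
      have "emeasure (density \<nu> (\<lambda>x. \<Sum>i. w i x)) E = (\<integral>\<^sup>+x. (\<Sum>i. w i x) * indicator E x \<partial>\<nu>)"
        by (rule emeasure_density[OF _ E']) measurable
      also have "\<dots> = (\<integral>\<^sup>+x. (\<Sum>i. w i x * indicator E x) \<partial>\<nu>)" by (simp add: ennreal_suminf_multc)
      also have "\<dots> = (\<Sum>i. \<integral>\<^sup>+x. w i x * indicator E x \<partial>\<nu>)" by (rule nn_integral_suminf) measurable
      also have "\<dots> = (\<Sum>i. \<integral>\<^sup>+t. indicator (branch i) t * indicator E (f t) \<partial>\<nu>)"
        by (intro suminf_cong int_w) measurable
      also have "\<dots> = (\<integral>\<^sup>+t. indicator E (f t) \<partial>\<nu>)" by (rule sum_int) measurable
      also have "\<dots> = (\<integral>\<^sup>+x. indicator E x \<partial>distr \<nu> unit_leb f)" by (rule nn_integral_distr[symmetric]) measurable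
      also have "\<dots> = emeasure \<nu> E" unfolding inv using E' by simp
      finally show "emeasure (density \<nu> (\<lambda>x. \<Sum>i. w i x)) E = emeasure (density \<nu> (\<lambda>x. 1)) E"
        by (simp add: density_1)
    qed simp
    then show ?thesis by (subst (asm) \<nu>.density_unique_iff) (auto simp: measurable_cong_sets[OF sets refl])
  qed
  define S where "S x n = (\<Sum>j<n. w j x)" for x n
  \<comment> \<open>The branch is \<open>i\<close> when \<open>u\<close> lies between the partial
    sums number \<open>i\<close> and \<open>i + 1\<close>. Where the weights sum to 1,
    \<open>LEAST\<close> finds an index for all \<open>u < 1\<close>; the remaining arguments form a
    null set and their index is arbitrary.\<close>
  define idx where "idx p = (LEAST i. ennreal (snd p) < S (fst p) (Suc i))" for p :: "real \<times> real"
  define \<Phi> where "\<Phi> p = psi (idx p) (fst p)" for p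
  have S_meas: "(\<lambda>x. S x n) \<in> borel_measurable unit_leb" for n unfolding S_def by measurable
  have idx_meas[measurable]: "idx \<in> unit_leb \<Otimes>\<^sub>M unit_leb \<rightarrow>\<^sub>M count_space UNIV"
    unfolding idx_def
  proof (rule measurable_Least)
    fix i
    have "(\<lambda>p. ennreal (snd p)) \<in> borel_measurable (unit_leb \<Otimes>\<^sub>M unit_leb)"
      by (intro measurable_compose[OF _ measurable_ennreal] measurable_compose[OF measurable_snd id_measurable_unit_leb])
    moreover have "(\<lambda>p. S (fst p) (Suc i)) \<in> borel_measurable (unit_leb \<Otimes>\<^sub>M unit_leb)"
      by (rule measurable_compose[OF measurable_fst S_meas])
    ultimately show "Measurable.pred (unit_leb \<Otimes>\<^sub>M unit_leb) (\<lambda>p. ennreal (snd p) < S (fst p) (Suc i))"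
      by measurable
  qed
  have \<Phi>_meas: "\<Phi> \<in> unit_leb \<Otimes>\<^sub>M unit_leb \<rightarrow>\<^sub>M unit_leb"
    unfolding \<Phi>_def
    by (rule measurable_compose_countable[OF measurable_compose[OF measurable_fst psi_measurable] idx_meas])
  \<comment> \<open>For fixed \<open>x\<close> the unit interval splits into pieces of length
    \<open>w i x\<close>, on which the sampled point is constantly \<open>psi i x\<close>.\<close>
  have fiber: "(\<integral>\<^sup>+u. q (x, \<Phi> (x, u)) \<partial>unit_leb) = (\<Sum>i. w i x * q (x, psi i x))"
    if sum1: "(\<Sum>i. w i x) = 1" and x: "x \<in> {0..1}" for x and q :: "real \<times> real \<Rightarrow> ennreal"
  proof -
    have S_le: "S x n \<le> 1" for n
      unfolding S_def sum1[symmetric] by (rule sum_le_suminf) auto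
    have S_inc: "S x m \<le> S x n" if "m \<le> n" for m n
      unfolding S_def by (rule sum_mono2) (use that in auto)
    define r where "r n = enn2real (S x n)" for n
    have r: "S x n = ennreal (r n)" "0 \<le> r n" "r n \<le> 1" for n
    proof -
      have fin: "S x n < \<top>" using S_le[of n] by (rule le_less_trans) simp
      then show e: "S x n = ennreal (r n)" by (simp add: r_def)
      show "0 \<le> r n" by (simp add: r_def)
      then show "r n \<le> 1" using S_le[of n] e by simp
    qed
    have r_inc: "r m \<le> r n" if "m \<le> n" for m n using S_inc[OF that] r by simp
    have w_r: "w i x = ennreal (r (Suc i) - r i)" for i
    proof -
      have "ennreal (r i) + w i x = ennreal (r (Suc i))" unfolding r(1)[symmetric] by (simp add: S_def)
      then have "w i x = ennreal (r (Suc i)) - ennreal (r i)"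
        by (metis ennreal_add_diff_cancel_left ennreal_neq_top)
      then show ?thesis using r(2) by (simp add: ennreal_minus)
    qed
    have S_lim: "(\<lambda>n. S x n) \<longlonglongrightarrow> 1" unfolding S_def sum1[symmetric] by (rule summable_LIMSEQ) simp
    have idx_iff: "idx (x, u) = i \<longleftrightarrow> r i \<le> u \<and> u < r (Suc i)" if u: "0 \<le> u" "u < 1" for u i
    proof -
      have "ennreal u < 1" using u by simp
      then have "\<forall>\<^sub>F n in sequentially. ennreal u < S x n" by (rule order_tendstoD(1)[OF S_lim])
      then obtain n where "ennreal u < S x n" by (auto simp: eventually_sequentially)
      then have ex: "ennreal u < S x (Suc n)" using S_inc[of n "Suc n"] by (auto intro: less_le_trans)
      have less: "ennreal u < S x k \<longleftrightarrow> u < r k" for k using u r(1)[of k] by (simp add: ennreal_less_iff)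
      have id: "idx (x, u) = (LEAST i. u < r (Suc i))" by (simp add: idx_def less)
      have ex': "u < r (Suc n)" using ex less by simp
      show ?thesis
      proof
        assume i: "idx (x, u) = i"
        have "u < r (Suc i)" using LeastI[of "\<lambda>i. u < r (Suc i)", OF ex'] i id by simp
        moreover have "r i \<le> u"
        proof (cases i)
          case 0
          then show ?thesis using u by (simp add: r_def S_def)
        next
          case (Suc j)
          then have "\<not> u < r (Suc j)" using not_less_Least[of j "\<lambda>i. u < r (Suc i)"] i id by simp
          then show ?thesis using Suc by simp
        qed
        ultimately show "r i \<le> u \<and> u < r (Suc i)" by simp
      next
        assume i: "r i \<le> u \<and> u < r (Suc i)"
        show "idx (x, u) = i"
          unfolding id
        proof (rule Least_equality)
          show "i \<le> j" if "u < r (Suc j)" for j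
          proof (rule ccontr)
            assume "\<not> i \<le> j"
            then have "r (Suc j) \<le> r i" by (intro r_inc) simp
            then show False using that i by simp
          qed
        qed (use i in simp)
      qed
    qed
    have piece: "{r i..<r (Suc i)} \<in> sets unit_leb" "emeasure unit_leb {r i..<r (Suc i)} = w i x" for i
    proof -
      have sub: "{r i..<r (Suc i)} \<subseteq> {0..1}" using r(2)[of i] r(3)[of "Suc i"] by auto
      then show "{r i..<r (Suc i)} \<in> sets unit_leb" by (simp add: sets_unit_leb_iff)
      show "emeasure unit_leb {r i..<r (Suc i)} = w i x"
        using r_inc[of i "Suc i"] by (simp add: emeasure_unit_leb[OF sub] w_r)
    qed
    have "{1} \<in> null_sets unit_leb" by (auto simp: null_sets_def sets_unit_leb_iff emeasure_unit_leb)
    then have ne1: "AE u in unit_leb. u \<notin> {1}" by (rule AE_not_in)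
    have "(\<integral>\<^sup>+u. q (x, \<Phi> (x, u)) \<partial>unit_leb) = (\<integral>\<^sup>+u. (\<Sum>i. q (x, psi i x) * indicator {r i..<r (Suc i)} u) \<partial>unit_leb)"
    proof (rule nn_integral_cong_AE)
      show "AE u in unit_leb. q (x, \<Phi> (x, u)) = (\<Sum>i. q (x, psi i x) * indicator {r i..<r (Suc i)} u)"
        using ne1 AE_space
      proof eventually_elim
        case (elim u)
        then have u: "0 \<le> u" "u < 1" by auto
        have "(\<lambda>i. q (x, psi i x) * indicator {r i..<r (Suc i)} u) = (\<lambda>i. if i = idx (x, u) then q (x, psi i x) else 0)"
        proof
          fix i
          show "q (x, psi i x) * indicator {r i..<r (Suc i)} u = (if i = idx (x, u) then q (x, psi i x) else 0)"
            using idx_iff[OF u, of i] by (auto simp: indicator_def)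
        qed
        then show ?case
          using sums_unique[OF sums_single[of "idx (x, u)" "\<lambda>i. q (x, psi i x)"]] by (simp add: \<Phi>_def)
      qed
    qed
    also have "\<dots> = (\<Sum>i. \<integral>\<^sup>+u. q (x, psi i x) * indicator {r i..<r (Suc i)} u \<partial>unit_leb)"
      using piece(1) by (intro nn_integral_suminf) simp
    also have "\<dots> = (\<Sum>i. w i x * q (x, psi i x))"
      by (simp only: nn_integral_cmult_indicator[OF piece(1)] piece(2)) (simp only: mult.commute)
    finally show ?thesis .
  qed
  show thesis
  proof (rule that[OF \<Phi>_meas])
    fix q :: "real \<times> real \<Rightarrow> ennreal" assume q[measurable]: "q \<in> borel_measurable (unit_leb \<Otimes>\<^sub>M unit_leb)"
    note psi_measurable[measurable]
    have "(\<integral>\<^sup>+x. \<integral>\<^sup>+u. q (x, \<Phi> (x, u)) \<partial>unit_leb \<partial>\<nu>) = (\<integral>\<^sup>+x. (\<Sum>i. w i x * q (x, psi i x)) \<partial>\<nu>)"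
      by (rule nn_integral_cong_AE) (use AE_w AE_space in \<open>eventually_elim, simp add: fiber sp\<close>)
    also have "\<dots> = (\<Sum>i. \<integral>\<^sup>+x. w i x * q (x, psi i x) \<partial>\<nu>)"
      by (rule nn_integral_suminf) measurable
    also have "\<dots> = (\<Sum>i. \<integral>\<^sup>+t. indicator (branch i) t * q (f t, psi i (f t)) \<partial>\<nu>)"
      by (intro suminf_cong int_w) measurable
    \<comment> \<open>Inside branch \<open>i\<close> the map \<open>psi i\<close> inverts
      \<open>f\<close>, so the sampled pair has the law of \<open>(f t, t)\<close>.\<close>
    also have "\<dots> = (\<Sum>i. \<integral>\<^sup>+t. indicator (branch i) t * q (f t, t) \<partial>\<nu>)"
      by (intro suminf_cong nn_integral_cong) (auto simp: indicator_def psi_f)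
    also have "\<dots> = (\<integral>\<^sup>+t. q (f t, t) \<partial>\<nu>)" by (rule sum_int) measurable
    finally show "(\<integral>\<^sup>+x. \<integral>\<^sup>+u. q (x, \<Phi> (x, u)) \<partial>unit_leb \<partial>\<nu>) = (\<integral>\<^sup>+t. q (f t, t) \<partial>\<nu>)" .
  qed
qed

end

text \<open>The nested value G(x_1, G(x_2, ... G(x_n, y))) along the backward orbit generated from
  \<open>x\<close> by the stream \<open>w\<close>. The innermost \<open>y\<close> is
  \<open>undefined\<close>; the contraction makes the limit independent of it.\<close>

primrec pullback :: "(real \<times> real \<Rightarrow> real) \<Rightarrow> (real \<times> 'k \<Rightarrow> 'k) \<Rightarrow> nat \<Rightarrow> real \<Rightarrow> real stream \<Rightarrow> 'k" where
  "pullback \<Phi> G 0 x w = undefined"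
| "pullback \<Phi> G (Suc n) x w = G (\<Phi> (x, shd w), pullback \<Phi> G n (\<Phi> (x, shd w)) (stl w))"

text \<open>Going back in time inserts new maps innermost: the values at depth \<open>n\<close> and
  \<open>n + k\<close> share their \<open>n\<close> outer contractions. Hence the sequence converges
  for every starting point and every stream, and not merely in law.\<close>

lemma pullback_limit:
  fixes G :: "real \<times> 'k::metric_space \<Rightarrow> 'k"
  assumes cpt: "compact (UNIV :: 'k set)"
    and G: "G \<in> unit_leb \<Otimes>\<^sub>M borel \<rightarrow>\<^sub>M borel"
    and contr: "\<And>x z1 z2. dist (G (x, z1)) (G (x, z2)) \<le> \<alpha> * dist z1 z2" and \<alpha>: "0 \<le> \<alpha>" "\<alpha> < 1"
    and \<Phi>: "\<Phi> \<in> unit_leb \<Otimes>\<^sub>M unit_leb \<rightarrow>\<^sub>M unit_leb"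
  obtains Y :: "real \<times> real stream \<Rightarrow> 'k" where "Y \<in> unit_leb \<Otimes>\<^sub>M stream_space unit_leb \<rightarrow>\<^sub>M borel"
    "\<And>x w. Y (x, w) = G (\<Phi> (x, shd w), Y (\<Phi> (x, shd w), stl w))"
proof -
  obtain B where B: "\<And>y z :: 'k. dist y z \<le> B"
    using compact_imp_bounded[OF cpt] unfolding bounded_two_points by auto
  have close: "dist (pullback \<Phi> G (n + k) x w) (pullback \<Phi> G n x w) \<le> \<alpha> ^ n * B" for n k x w
  proof (induction n arbitrary: x w)
    case 0
    then show ?case using B by simp
  next
    case (Suc n)
    have "dist (pullback \<Phi> G (Suc n + k) x w) (pullback \<Phi> G (Suc n) x w) \<le>
       \<alpha> * dist (pullback \<Phi> G (n + k) (\<Phi> (x, shd w)) (stl w)) (pullback \<Phi> G n (\<Phi> (x, shd w)) (stl w))"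
      by (simp add: contr)
    also have "\<dots> \<le> \<alpha> * (\<alpha> ^ n * B)" using Suc \<alpha> by (intro mult_left_mono) auto
    finally show ?case by simp
  qed
  have Cauchy: "Cauchy (\<lambda>n. pullback \<Phi> G n x w)" for x w
  proof (rule metric_CauchyI)
    fix e :: real assume e: "0 < e"
    have "(\<lambda>n. \<alpha> ^ n * B) \<longlonglongrightarrow> 0 * B" using \<alpha> by (intro tendsto_intros LIMSEQ_realpow_zero) auto
    then have "\<forall>\<^sub>F n in sequentially. \<alpha> ^ n * B < e / 2" using e by (intro order_tendstoD(2)) auto
    then obtain N where N: "\<alpha> ^ N * B < e / 2" by (auto simp: eventually_sequentially)
    have "dist (pullback \<Phi> G m x w) (pullback \<Phi> G n x w) < e" if "N \<le> m" "N \<le> n" for m n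
    proof -
      have "dist (pullback \<Phi> G k x w) (pullback \<Phi> G N x w) < e / 2" if "N \<le> k" for k
        using close[of N "k - N" x w] N that by simp
      then show ?thesis using that dist_triangle_half_r by (metis dist_commute)
    qed
    then show "\<exists>N. \<forall>m\<ge>N. \<forall>n\<ge>N. dist (pullback \<Phi> G m x w) (pullback \<Phi> G n x w) < e" by blast
  qed
  define Y where "Y p = lim (\<lambda>n. pullback \<Phi> G n (fst p) (snd p))" for p
  have lim: "(\<lambda>n. pullback \<Phi> G n x w) \<longlonglongrightarrow> Y (x, w)" for x w
  proof -
    obtain l where "(\<lambda>n. pullback \<Phi> G n x w) \<longlonglongrightarrow> l"
      by (rule completeE[OF compact_imp_complete[OF cpt] _ Cauchy]) auto
    then show ?thesis unfolding Y_def by (simp add: limI)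
  qed
  have meas: "(\<lambda>p. pullback \<Phi> G n (fst p) (snd p)) \<in> unit_leb \<Otimes>\<^sub>M stream_space unit_leb \<rightarrow>\<^sub>M borel" for n
  proof (induction n)
    case (Suc n)
    have m1: "(\<lambda>p. \<Phi> (fst p, shd (snd p))) \<in> unit_leb \<Otimes>\<^sub>M stream_space unit_leb \<rightarrow>\<^sub>M unit_leb"
      by (rule measurable_compose[OF _ \<Phi>]) measurable
    have m2: "(\<lambda>p. (\<Phi> (fst p, shd (snd p)), stl (snd p))) \<in> unit_leb \<Otimes>\<^sub>M stream_space unit_leb \<rightarrow>\<^sub>M unit_leb \<Otimes>\<^sub>M stream_space unit_leb"
      by (intro measurable_Pair m1) measurable
    have m3: "(\<lambda>p. pullback \<Phi> G n (\<Phi> (fst p, shd (snd p))) (stl (snd p))) \<in> unit_leb \<Otimes>\<^sub>M stream_space unit_leb \<rightarrow>\<^sub>M borel"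
      using measurable_compose[OF m2 Suc] by simp
    show ?case
      using measurable_compose[OF measurable_Pair[OF m1 m3] G] by simp
  qed simp
  have Y_meas: "Y \<in> unit_leb \<Otimes>\<^sub>M stream_space unit_leb \<rightarrow>\<^sub>M borel"
    by (rule borel_measurable_LIMSEQ_metric[OF meas]) (use lim in auto)
  have "Y (x, w) = G (\<Phi> (x, shd w), Y (\<Phi> (x, shd w), stl w))" for x w
  proof -
    define t where "t = \<Phi> (x, shd w)"
    have "\<alpha>-lipschitz_on UNIV (\<lambda>z. G (t, z))" using contr \<alpha> by (auto intro: lipschitz_onI)
    then have "continuous_on UNIV (\<lambda>z. G (t, z))" by (rule lipschitz_on_continuous_on)
    \<comment> \<open>Continuity of the fiber map carries the one-step recursion of
      \<open>pullback\<close> to the limit \<open>Y\<close>.\<close>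
    then have "isCont (\<lambda>z. G (t, z)) (Y (t, stl w))" by (simp add: continuous_on_eq_continuous_at)
    from isCont_tendsto_compose[OF this lim]
    have "(\<lambda>n. pullback \<Phi> G (Suc n) x w) \<longlonglongrightarrow> G (t, Y (t, stl w))" by (simp add: t_def)
    moreover have "(\<lambda>n. pullback \<Phi> G (Suc n) x w) \<longlonglongrightarrow> Y (x, w)" by (rule LIMSEQ_Suc[OF lim])
    ultimately show ?thesis unfolding t_def by (rule LIMSEQ_unique[rotated])
  qed
  then show thesis using that Y_meas by blast
qed

context branched_map
begin

text \<open>Let x_1 be the first sampled preimage of \<open>x\<close>. It has law \<nu> and is
  independent of the tail of the stream, so (x_1, Y(x_1, tail)) has the same law as (x, Y(x, w)).
  The recursion for \<open>Y\<close> shows that \<open>F\<close> maps the former pair to the latter,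
  almost surely.\<close>

lemma skew_invariant_exists:
  fixes G :: "real \<times> 'k::metric_space \<Rightarrow> 'k"
  assumes cpt: "compact (UNIV :: 'k set)"
    and F: "F = (\<lambda>(x, y). (f x, G (x, y)))"
    and G: "G \<in> unit_leb \<Otimes>\<^sub>M borel \<rightarrow>\<^sub>M borel"
    and contr: "\<And>x z1 z2. dist (G (x, z1)) (G (x, z2)) \<le> \<alpha> * dist z1 z2" and \<alpha>: "0 \<le> \<alpha>" "\<alpha> < 1"
    and prob: "prob_space \<nu>" and sets: "sets \<nu> = sets unit_leb"
    and ac: "absolutely_continuous unit_leb \<nu>" and inv: "distr \<nu> unit_leb f = \<nu>"
  obtains \<mu> \<kappa> where "prob_space \<mu>" "sets \<mu> = sets skew_space" "distr \<mu> skew_space F = \<mu>"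
    "\<kappa> \<in> unit_leb \<rightarrow>\<^sub>M prob_algebra borel"
    "\<And>E. E \<in> sets skew_space \<Longrightarrow> emeasure \<mu> E = (\<integral>\<^sup>+x. emeasure (\<kappa> x) {y. (x, y) \<in> E} \<partial>\<nu>)"
proof -
  note sk = sets_skew_space[OF cpt]
  interpret \<nu>: prob_space \<nu> by fact
  have sp: "space \<nu> = {0..1}" using sets_eq_imp_space_eq[OF sets] by simp
  note [measurable_cong] = sets
  interpret U: prob_space unit_leb by (rule prob_space_unit_leb)
  define S where "S = stream_space unit_leb"
  interpret S: prob_space S unfolding S_def by (rule U.prob_space_stream_space)
  interpret P: pair_prob_space \<nu> S ..
  note G[measurable]
  obtain \<Phi> :: "real \<times> real \<Rightarrow> real" where \<Phi>[measurable]: "\<Phi> \<in> unit_leb \<Otimes>\<^sub>M unit_leb \<rightarrow>\<^sub>M unit_leb"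
    and int_\<Phi>: "\<And>q. q \<in> borel_measurable (unit_leb \<Otimes>\<^sub>M unit_leb) \<Longrightarrow>
      (\<integral>\<^sup>+x. \<integral>\<^sup>+u. q (x, \<Phi> (x, u)) \<partial>unit_leb \<partial>\<nu>) = (\<integral>\<^sup>+t. q (f t, t) \<partial>\<nu>)"
    by (rule inverse_branch_sampling[OF prob sets ac inv]) blast
  obtain Y :: "real \<times> real stream \<Rightarrow> 'k" where Y[measurable]: "Y \<in> unit_leb \<Otimes>\<^sub>M S \<rightarrow>\<^sub>M borel"
    and Y_eq: "\<And>x w. Y (x, w) = G (\<Phi> (x, shd w), Y (\<Phi> (x, shd w), stl w))"
    unfolding S_def by (rule pullback_limit[OF cpt G contr \<alpha> \<Phi>]) blast
  define T where "T p = (fst p, Y p)" for p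
  have T: "T \<in> \<nu> \<Otimes>\<^sub>M S \<rightarrow>\<^sub>M skew_space"
    unfolding T_def measurable_cong_sets[OF refl sk] by measurable
  define \<mu> where "\<mu> = distr (\<nu> \<Otimes>\<^sub>M S) skew_space T"
  define \<kappa> where "\<kappa> x = distr S borel (\<lambda>w. Y (x, w))" for x
  have F_meas: "F \<in> skew_space \<rightarrow>\<^sub>M skew_space"
    unfolding F measurable_cong_sets[OF sk sk] by measurable
  have int_\<mu>: "(\<integral>\<^sup>+p. g p \<partial>\<mu>) = (\<integral>\<^sup>+x. \<integral>\<^sup>+w. g (x, Y (x, w)) \<partial>S \<partial>\<nu>)"
    if g: "g \<in> borel_measurable skew_space" for g
  proof -
    have "(\<integral>\<^sup>+p. g p \<partial>\<mu>) = (\<integral>\<^sup>+p. g (T p) \<partial>(\<nu> \<Otimes>\<^sub>M S))" unfolding \<mu>_def by (rule nn_integral_distr[OF T]) (use g in simp)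
    also have "\<dots> = (\<integral>\<^sup>+x. \<integral>\<^sup>+w. g (T (x, w)) \<partial>S \<partial>\<nu>)"
      by (rule S.nn_integral_fst[symmetric]) (rule measurable_compose[OF T g])
    finally show ?thesis by (simp add: T_def)
  qed
  have pr: "prob_space \<mu>" unfolding \<mu>_def by (rule P.prob_space_distr[OF T])
  have sets_\<mu>: "sets \<mu> = sets skew_space" by (simp add: \<mu>_def)
  have inv_\<mu>: "distr \<mu> skew_space F = \<mu>"
  proof (rule measure_eqI)
    fix E assume "E \<in> sets (distr \<mu> skew_space F)"
    then have E: "E \<in> sets skew_space" by simp
    then have E'[measurable]: "E \<in> sets (unit_leb \<Otimes>\<^sub>M borel)" by (simp add: sk)
    \<comment> \<open>The base point and its preimage are kept as separate arguments, because
      \<open>f (\<Phi> (x, u)) = x\<close> is available only through the joint law provided by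
      \<open>int_\<Phi>\<close>.\<close>
    define \<Psi> where "\<Psi> p = (\<integral>\<^sup>+w. indicator E (fst p, G (snd p, Y (snd p, w))) \<partial>S)" for p
    have \<Psi>: "\<Psi> \<in> borel_measurable (unit_leb \<Otimes>\<^sub>M unit_leb)"
      unfolding \<Psi>_def by (rule S.borel_measurable_nn_integral) measurable
    have "emeasure \<mu> E = (\<integral>\<^sup>+p. indicator E p \<partial>\<mu>)" using E sets_\<mu> by simp
    also have "\<dots> = (\<integral>\<^sup>+x. \<integral>\<^sup>+w. indicator E (x, Y (x, w)) \<partial>S \<partial>\<nu>)" by (rule int_\<mu>) (use E in simp)
    also have "\<dots> = (\<integral>\<^sup>+x. \<integral>\<^sup>+u. \<Psi> (x, \<Phi> (x, u)) \<partial>unit_leb \<partial>\<nu>)"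
    proof (rule nn_integral_cong)
      fix x assume "x \<in> space \<nu>"
      then have x[measurable]: "x \<in> space unit_leb" using sp by simp
      have "(\<lambda>w. indicator E (x, Y (x, w)) :: ennreal) \<in> borel_measurable S" by measurable
      \<comment> \<open>The first letter of the stream selects the preimage; its tail has again the
        law \<open>S\<close>.\<close>
      then have "(\<integral>\<^sup>+w. indicator E (x, Y (x, w)) \<partial>S) = (\<integral>\<^sup>+u. \<integral>\<^sup>+w. indicator E (x, Y (x, u ## w)) \<partial>S \<partial>unit_leb)"
        unfolding S_def by (rule U.nn_integral_stream_space)
      also have "\<dots> = (\<integral>\<^sup>+u. \<Psi> (x, \<Phi> (x, u)) \<partial>unit_leb)"
        unfolding \<Psi>_def by (simp add: Y_eq[of x])
      finally show "(\<integral>\<^sup>+w. indicator E (x, Y (x, w)) \<partial>S) = (\<integral>\<^sup>+u. \<Psi> (x, \<Phi> (x, u)) \<partial>unit_leb)" .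
    qed
    also have "\<dots> = (\<integral>\<^sup>+t. \<Psi> (f t, t) \<partial>\<nu>)" by (rule int_\<Phi>[OF \<Psi>])
    also have "\<dots> = (\<integral>\<^sup>+t. \<integral>\<^sup>+w. indicator E (F (t, Y (t, w))) \<partial>S \<partial>\<nu>)"
      by (simp add: \<Psi>_def F)
    also have "\<dots> = (\<integral>\<^sup>+p. indicator E (F p) \<partial>\<mu>)"
      using E F_meas by (intro int_\<mu>[symmetric]) (rule measurable_compose[OF F_meas], simp)
    also have "\<dots> = (\<integral>\<^sup>+p. indicator E p \<partial>distr \<mu> skew_space F)"
      using F_meas E by (intro nn_integral_distr[symmetric]) (simp_all add: measurable_cong_sets[OF sets_\<mu> refl])
    also have "\<dots> = emeasure (distr \<mu> skew_space F) E" using E by simp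
    finally show "emeasure (distr \<mu> skew_space F) E = emeasure \<mu> E" by simp
  qed (simp add: \<mu>_def)
  have Yx: "(\<lambda>w. Y (x, w)) \<in> S \<rightarrow>\<^sub>M borel" if "x \<in> {0..1}" for x
    using that by (intro measurable_compose[OF measurable_Pair1' Y]) simp
  have \<kappa>: "\<kappa> \<in> unit_leb \<rightarrow>\<^sub>M prob_algebra borel"
  proof (rule measurable_prob_algebraI)
    show "prob_space (\<kappa> x)" if "x \<in> space unit_leb" for x
      unfolding \<kappa>_def using Yx[of x] that by (intro S.prob_space_distr) simp
    have "S \<in> space (subprob_algebra S)" using S.prob_space_axioms
      by (simp add: space_subprob_algebra prob_space_imp_subprob_space)
    then show "\<kappa> \<in> unit_leb \<rightarrow>\<^sub>M subprob_algebra borel"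
      unfolding \<kappa>_def by (intro measurable_distr2[where M = S]) (simp_all add: Y)
  qed
  have dis: "emeasure \<mu> E = (\<integral>\<^sup>+x. emeasure (\<kappa> x) {y. (x, y) \<in> E} \<partial>\<nu>)" if E: "E \<in> sets skew_space" for E
  proof -
    have E'[measurable]: "E \<in> sets (unit_leb \<Otimes>\<^sub>M borel)" using E by (simp add: sk)
    have "emeasure \<mu> E = (\<integral>\<^sup>+p. indicator E p \<partial>\<mu>)" using E sets_\<mu> by simp
    also have "\<dots> = (\<integral>\<^sup>+x. \<integral>\<^sup>+w. indicator E (x, Y (x, w)) \<partial>S \<partial>\<nu>)" by (rule int_\<mu>) (use E in simp)
    also have "\<dots> = (\<integral>\<^sup>+x. emeasure (\<kappa> x) {y. (x, y) \<in> E} \<partial>\<nu>)"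
    proof (rule nn_integral_cong)
      fix x assume "x \<in> space \<nu>"
      then have x: "x \<in> {0..1}" using sp by simp
      have sec: "{y. (x, y) \<in> E} \<in> sets borel"
        using sets_Pair1[OF E', of x] by (simp add: vimage_def)
      have "emeasure (\<kappa> x) {y. (x, y) \<in> E} = (\<integral>\<^sup>+y. indicator {y. (x, y) \<in> E} y \<partial>\<kappa> x)" using sec by (simp add: \<kappa>_def)
      also have "\<dots> = (\<integral>\<^sup>+w. indicator {y. (x, y) \<in> E} (Y (x, w)) \<partial>S)"
        unfolding \<kappa>_def using sec by (intro nn_integral_distr Yx[OF x]) simp
      finally show "(\<integral>\<^sup>+w. indicator E (x, Y (x, w)) \<partial>S) = emeasure (\<kappa> x) {y. (x, y) \<in> E}"
        by (simp add: indicator_def)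
    qed
    finally show ?thesis .
  qed
  show thesis by (rule that[OF pr sets_\<mu> inv_\<mu> \<kappa> dis])
qed

end

section \<open>Positive measures as elements of the signed spaces\<close>

text \<open>Gives the \<open>THE\<close> in \<open>pos_part\<close> and \<open>neg_part\<close> a
  determined value. Off \<open>D\<close> the measure \<open>P\<close> vanishes, so positivity of M =
  P - N forces \<open>N\<close> to vanish there, and on \<open>D\<close> it vanishes anyway.\<close>

lemma jordan_decomposition_positive:
  assumes M: "finite_measure M" "sets M = sets \<Omega>"
  shows "jordan_decomposition \<Omega> (measure M) P N \<longleftrightarrow> P = M \<and> N = null_measure \<Omega>"
proof
  have sp: "space M = space \<Omega>" using sets_eq_imp_space_eq[OF M(2)] .
  show "jordan_decomposition \<Omega> (measure M) P N" if "P = M \<and> N = null_measure \<Omega>"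
    unfolding jordan_decomposition_def
  proof (intro conjI ballI bexI)
    show "finite_measure N" by (rule finite_measureI) (use that in simp)
    show "emeasure P (space \<Omega> - space \<Omega>) = 0" "emeasure N (space \<Omega>) = 0" using that by simp_all
  qed (use that M in \<open>auto simp: measure_def\<close>)
  assume J: "jordan_decomposition \<Omega> (measure M) P N"
  then have P: "finite_measure P" "sets P = sets \<Omega>" and N: "finite_measure N" "sets N = sets \<Omega>"
    and eq: "\<And>E. E \<in> sets \<Omega> \<Longrightarrow> measure M E = measure P E - measure N E"
    by (auto simp: jordan_decomposition_def)
  obtain D where D: "D \<in> sets \<Omega>" "emeasure P (space \<Omega> - D) = 0" "emeasure N D = 0"
    using J by (auto simp: jordan_decomposition_def)
  interpret P: finite_measure P by fact
  interpret N: finite_measure N by fact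
  interpret M: finite_measure M by fact
  have N0: "measure N E = 0" if E: "E \<in> sets \<Omega>" for E
  proof -
    have ED: "E - D \<in> sets \<Omega>" using E D by auto
    have "measure P (E - D) \<le> measure P (space \<Omega> - D)"
      by (rule P.finite_measure_mono) (use E D P sets.sets_into_space in auto)
    then have "measure P (E - D) \<le> 0" using D by (simp add: measure_def)
    moreover have "0 \<le> measure M (E - D)" by simp
    ultimately have "measure N (E - D) \<le> 0" using eq[OF ED] by linarith
    moreover have "measure N (E - D) = measure N E"
      by (rule measure_Diff_null_set) (use E D N in \<open>auto simp: null_sets_def\<close>)
    ultimately show ?thesis using measure_nonneg[of N E] by linarith
  qed
  show "P = M \<and> N = null_measure \<Omega>"
  proof
    show "P = M"
      by (rule measure_eqI) (use P M eq N0 in \<open>auto simp: P.emeasure_eq_measure M.emeasure_eq_measure\<close>)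
    show "N = null_measure \<Omega>"
      by (rule measure_eqI) (use N N0 in \<open>auto simp: N.emeasure_eq_measure\<close>)
  qed
qed

lemma pos_part_positive: "finite_measure M \<Longrightarrow> sets M = sets \<Omega> \<Longrightarrow> pos_part \<Omega> (measure M) = M"
  and neg_part_positive: "finite_measure M \<Longrightarrow> sets M = sets \<Omega> \<Longrightarrow> neg_part \<Omega> (measure M) = null_measure \<Omega>"
  by (simp_all add: pos_part_def neg_part_def jordan_decomposition_positive)

lemma signed_measure_on_positive:
  assumes "finite_measure M" "sets M = sets \<Omega>"
  shows "signed_measure_on \<Omega> (measure M)"
  unfolding signed_measure_on_def
  using finite_measure.finite_measure_UNION[OF assms(1)] assms(2) by auto

lemma total_variation_antimono:
  assumes anti: "antimono_on {0..1} h" and bd: "\<And>x. 0 \<le> h x" "\<And>x. h x \<le> R"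
  shows "total_variation h \<le> ennreal R"
  unfolding total_variation_def
proof (rule SUP_least, clarify)
  fix n and t :: "nat \<Rightarrow> real" assume t: "incseq t" "range t \<subseteq> {0..1}"
  have t01: "t k \<in> {0..1}" for k using subsetD[OF t(2) rangeI[of t k]] .
  have "\<bar>h (t (Suc k)) - h (t k)\<bar> = h (t k) - h (t (Suc k))" for k
  proof -
    have "h (t (Suc k)) \<le> h (t k)"
      by (rule monotone_onD[OF anti t01 t01]) (rule incseq_SucD[OF t(1)])
    then show ?thesis by simp
  qed
  then have "(\<Sum>k<n. ennreal \<bar>h (t (Suc k)) - h (t k)\<bar>) = ennreal (\<Sum>k<n. h (t k) - h (t (Suc k)))"
    by (subst sum_ennreal[symmetric]) (metis abs_ge_zero, simp)
  also have "(\<Sum>k<n. h (t k) - h (t (Suc k))) = h (t 0) - h (t n)" by (rule sum_lessThan_telescope')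
  also have "ennreal \<dots> \<le> ennreal R" using bd[of "t 0"] bd[of "t n"] by (intro ennreal_leI) auto
  finally show "(\<Sum>k<n. ennreal \<bar>h (t (Suc k)) - h (t k)\<bar>) \<le> ennreal R" .
qed

lemma fst_measurable_skew:
  assumes "compact (UNIV :: 'k::metric_space set)"
  shows "fst \<in> (skew_space :: (real \<times> 'k) measure) \<rightarrow>\<^sub>M unit_leb"
  by (simp add: measurable_cong_sets[OF sets_skew_space[OF assms] refl])

lemma sets_marginal [simp]: "sets (marginal \<mu>) = sets unit_leb"
  by (simp add: marginal_def)

lemma marginal_density_measurable: "marginal_density \<mu> \<in> borel_measurable unit_leb"
  unfolding marginal_density_def by (rule borel_measurable_RN_deriv)

lemma marginal_density_AE:
  assumes "g \<in> borel_measurable unit_leb" "marginal \<mu> = density unit_leb g"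
  shows "AE x in unit_leb. marginal_density \<mu> x = g x"
proof -
  interpret prob_space unit_leb by (rule prob_space_unit_leb)
  show ?thesis
    using RN_deriv_unique[OF assms(1) assms(2)[symmetric]] by (auto simp: marginal_density_def elim!: eventually_mono)
qed

lemma marginal_null:
  assumes "compact (UNIV :: 'k::metric_space set)"
  shows "marginal (null_measure (skew_space :: (real \<times> 'k) measure)) = density unit_leb (\<lambda>_. 0)"
proof (rule measure_eqI)
  fix A assume "A \<in> sets (marginal (null_measure (skew_space :: (real \<times> 'k) measure)))"
  then have A: "A \<in> sets unit_leb" by simp
  then show "emeasure (marginal (null_measure (skew_space :: (real \<times> 'k) measure))) A = emeasure (density unit_leb (\<lambda>_. 0)) A"
    unfolding marginal_def using fst_measurable_skew[OF assms]
    by (subst emeasure_distr) (auto simp: emeasure_density measurable_cong_sets[OF sets_null_measure refl])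
qed simp

lemma signed_density_AE:
  fixes \<mu> :: "(real \<times> 'k::metric_space) measure"
  assumes cpt: "compact (UNIV :: 'k set)" and \<mu>: "finite_measure \<mu>" "sets \<mu> = sets skew_space"
  shows "AE x in unit_leb. signed_density (measure \<mu>) x = enn2real (marginal_density \<mu> x)"
proof -
  have "AE x in unit_leb. marginal_density (null_measure (skew_space :: (real \<times> 'k) measure)) x = 0"
    by (rule marginal_density_AE[OF _ marginal_null[OF cpt]]) simp
  then show ?thesis
    by (auto simp: signed_density_def pos_part_positive[OF \<mu>] neg_part_positive[OF \<mu>] elim!: eventually_mono)
qed

lemma marginal_eq_density:
  assumes ac: "absolutely_continuous unit_leb (marginal \<mu>)" and fin: "finite_measure (marginal \<mu>)"
  shows "marginal \<mu> = density unit_leb (\<lambda>x. ennreal (enn2real (marginal_density \<mu> x)))"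
proof -
  interpret prob_space unit_leb by (rule prob_space_unit_leb)
  have "density unit_leb (marginal_density \<mu>) = marginal \<mu>"
    unfolding marginal_density_def by (rule density_RN_deriv[OF ac]) simp
  moreover have "AE x in unit_leb. marginal_density \<mu> x \<noteq> \<infinity>"
    unfolding marginal_density_def
    by (rule RN_deriv_finite[OF _ ac]) (use fin in \<open>auto intro: finite_measure.axioms(1)\<close>)
  then have "density unit_leb (marginal_density \<mu>) = density unit_leb (\<lambda>x. ennreal (enn2real (marginal_density \<mu> x)))"
  proof (intro density_cong)
    note marginal_density_measurable[measurable]
    show "marginal_density \<mu> \<in> borel_measurable unit_leb" "(\<lambda>x. ennreal (enn2real (marginal_density \<mu> x))) \<in> borel_measurable unit_leb"
      by measurable
  qed (auto elim!: eventually_mono simp: less_top)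
  ultimately show ?thesis by simp
qed

lemma integral_scale_prob_le:
  fixes h :: "'k::metric_space \<Rightarrow> real"
  assumes \<kappa>: "prob_space \<kappa>" "sets \<kappa> = sets borel" and c: "c < \<infinity>"
    and h: "1-lipschitz_on UNIV h" "\<And>y. \<bar>h y\<bar> \<le> 1"
  shows "ennreal \<bar>\<integral>y. h y \<partial>scale_measure c \<kappa>\<bar> \<le> c"
proof -
  interpret prob_space \<kappa> by fact
  have sp: "space \<kappa> = UNIV" using sets_eq_imp_space_eq[OF \<kappa>(2)] by simp
  have em: "emeasure (scale_measure c \<kappa>) (space (scale_measure c \<kappa>)) = c"
    using emeasure_space_1 by (simp add: space_scale_measure)
  interpret Q: finite_measure "scale_measure c \<kappa>" by (rule finite_measureI) (use em c in simp)
  have "h \<in> borel_measurable borel"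
    by (intro borel_measurable_continuous_onI lipschitz_on_continuous_on[OF h(1)])
  then have hm: "h \<in> borel_measurable (scale_measure c \<kappa>)"
    by (simp add: measurable_cong_sets[OF trans[OF sets_scale_measure \<kappa>(2)] refl])
  then have int: "integrable (scale_measure c \<kappa>) h"
    by (intro Q.integrable_const_bound[where B = 1]) (use h in auto)
  have "\<bar>\<integral>y. h y \<partial>scale_measure c \<kappa>\<bar> \<le> (\<integral>y. \<bar>h y\<bar> \<partial>scale_measure c \<kappa>)"
    using integral_norm_bound[of "scale_measure c \<kappa>" h] by simp
  also have "\<dots> \<le> (\<integral>y. 1 \<partial>scale_measure c \<kappa>)"
    using int h by (intro integral_mono) auto
  also have "\<dots> = enn2real c" using em by (simp add: measure_def)
  finally have "ennreal \<bar>\<integral>y. h y \<partial>scale_measure c \<kappa>\<bar> \<le> ennreal (enn2real c)" by (rule ennreal_leI)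
  also have "\<dots> = c" using c by simp
  finally show ?thesis .
qed

text \<open>\<open>fiber_measure\<close> rests on a \<open>SOME\<close>, so its value is known only
  once a disintegration exists. Given one, the W-norm on a fiber is almost everywhere at most the
  marginal density, whose integral is the total mass.\<close>

lemma disintegrable_positive_in_L1:
  fixes \<mu> :: "(real \<times> 'k::metric_space) measure"
  assumes cpt: "compact (UNIV :: 'k set)"
    and \<mu>: "finite_measure \<mu>" "sets \<mu> = sets skew_space"
    and ac: "absolutely_continuous unit_leb (marginal \<mu>)"
    and dis: "disintegration \<mu> \<kappa>"
  shows "measure \<mu> \<in> L1_space"
proof -
  interpret \<mu>: finite_measure \<mu> by fact
  interpret U: prob_space unit_leb by (rule prob_space_unit_leb)
  let ?null = "null_measure (skew_space :: (real \<times> 'k) measure)"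
  have null0: "AE x in unit_leb. marginal_density ?null x = 0"
    by (rule marginal_density_AE[OF _ marginal_null[OF cpt]]) simp
  have ac_null: "absolutely_continuous unit_leb (marginal ?null)"
    unfolding marginal_null[OF cpt] by (rule absolutely_continuousI_density) simp
  \<comment> \<open>The zero negative part needs a disintegration as well. The same kernel serves,
    because the density of the zero marginal vanishes almost everywhere.\<close>
  have "disintegration ?null \<kappa>"
    unfolding disintegration_def
  proof (intro conjI ballI)
    show "\<kappa> \<in> unit_leb \<rightarrow>\<^sub>M prob_algebra borel" using dis by (simp add: disintegration_def)
    fix E :: "(real \<times> 'k) set"
    have "(\<integral>\<^sup>+x. emeasure (\<kappa> x) {y. (x, y) \<in> E} * marginal_density ?null x \<partial>unit_leb) = (\<integral>\<^sup>+x. 0 \<partial>unit_leb)"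
      by (rule nn_integral_cong_AE) (use null0 in \<open>auto elim!: eventually_mono\<close>)
    then show "emeasure ?null E = (\<integral>\<^sup>+x. emeasure (\<kappa> x) {y. (x, y) \<in> E} * marginal_density ?null x \<partial>unit_leb)"
      by simp
  qed
  then have some_null: "disintegration ?null (SOME \<kappa>. disintegration ?null \<kappa>)"
    by (rule someI[of "disintegration ?null"])
  have some_\<mu>: "disintegration \<mu> (SOME \<kappa>. disintegration \<mu> \<kappa>)"
    using dis by (rule someI[of "disintegration \<mu>"])
  have pr: "prob_space (\<kappa>' x)" "sets (\<kappa>' x) = sets borel"
    if "disintegration M \<kappa>'" "x \<in> {0..1}" for M :: "(real \<times> 'k) measure" and \<kappa>' x
    using that measurable_space[of \<kappa>' unit_leb "prob_algebra borel" x]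
    by (auto simp: disintegration_def space_prob_algebra)
  have fin_marg: "finite_measure (marginal \<mu>)"
    unfolding marginal_def using fst_measurable_skew[OF cpt]
    by (intro \<mu>.finite_measure_distr) (simp add: measurable_cong_sets[OF \<mu>(2) refl])
  have dens: "density unit_leb (marginal_density \<mu>) = marginal \<mu>"
    unfolding marginal_density_def by (rule U.density_RN_deriv[OF ac]) simp
  have fin: "AE x in unit_leb. marginal_density \<mu> x \<noteq> \<infinity>"
    unfolding marginal_density_def
    by (rule U.RN_deriv_finite[OF _ ac]) (use fin_marg in \<open>auto intro: finite_measure.axioms(1)\<close>)
  have "L1_norm (measure \<mu>) \<le> (\<integral>\<^sup>+x. marginal_density \<mu> x \<partial>unit_leb)"
    unfolding L1_norm_def pos_part_positive[OF \<mu>] neg_part_positive[OF \<mu>]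
  proof (rule nn_integral_mono_AE)
    show "AE x in unit_leb. W_norm (fiber_measure \<mu> x) (fiber_measure ?null x) \<le> marginal_density \<mu> x"
      using null0 fin AE_space
    proof eventually_elim
      case (elim x)
      then have x: "x \<in> {0..1}" by simp
      show ?case
        unfolding W_norm_def
      proof (rule SUP_least)
        fix h :: "'k \<Rightarrow> real" assume "h \<in> {h. 1-lipschitz_on UNIV h \<and> (\<forall>y. \<bar>h y\<bar> \<le> 1)}"
        then have h: "1-lipschitz_on UNIV h" "\<And>y. \<bar>h y\<bar> \<le> 1" by auto
        have "ennreal \<bar>\<integral>y. h y \<partial>fiber_measure ?null x\<bar> \<le> 0"
          unfolding fiber_measure_def elim(1)
          by (rule integral_scale_prob_le[OF pr[OF some_null x] _ h]) simp
        then have "(\<integral>y. h y \<partial>fiber_measure ?null x) = 0" by (simp add: ennreal_eq_0_iff)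
        moreover have "ennreal \<bar>\<integral>y. h y \<partial>fiber_measure \<mu> x\<bar> \<le> marginal_density \<mu> x"
          unfolding fiber_measure_def
          by (rule integral_scale_prob_le[OF pr[OF some_\<mu> x] _ h]) (use elim in \<open>simp add: less_top\<close>)
        ultimately show "ennreal \<bar>(\<integral>y. h y \<partial>fiber_measure \<mu> x) - (\<integral>y. h y \<partial>fiber_measure ?null x)\<bar> \<le> marginal_density \<mu> x"
          by simp
      qed
    qed
  qed
  also have "\<dots> = emeasure (marginal \<mu>) (space unit_leb)"
    unfolding dens[symmetric] using marginal_density_measurable sets.top[of unit_leb]
    by (subst emeasure_density) (auto intro!: nn_integral_cong)
  also have "\<dots> < \<infinity>" using finite_measure.emeasure_finite[OF fin_marg] by (simp add: less_top[symmetric])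
  finally have "L1_norm (measure \<mu>) < \<infinity>" .
  then show ?thesis
    using signed_measure_on_positive[OF \<mu>] ac ac_null
    by (simp add: L1_space_def AB_def pos_part_positive[OF \<mu>] neg_part_positive[OF \<mu>])
qed

section \<open>Assembly of existence and uniqueness\<close>

text \<open>Replacing \<open>G\<close> by a constant on the exceptional fibers, and outside the unit
  interval, makes the contraction hold at every point. Orbits can then be iterated without
  exceptional sets.\<close>

lemma fiber_contraction_everywhere:
  fixes G :: "real \<times> 'k::metric_space \<Rightarrow> 'k"
  assumes cpt: "compact (UNIV :: 'k set)" and G: "fiber_contraction G"
    and meas: "G \<in> skew_space \<rightarrow>\<^sub>M borel"
  obtains G' \<alpha> N where "N \<in> null_sets unit_leb" "\<And>x z. x \<in> {0..1} - N \<Longrightarrow> G' (x, z) = G (x, z)"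
    "G' \<in> unit_leb \<Otimes>\<^sub>M borel \<rightarrow>\<^sub>M borel" "0 \<le> \<alpha>" "\<alpha> < 1"
    "\<And>x z1 z2. dist (G' (x, z1)) (G' (x, z2)) \<le> \<alpha> * dist z1 z2"
proof -
  obtain \<alpha> where \<alpha>: "0 \<le> \<alpha>" "\<alpha> < 1"
    and "AE x in unit_leb. \<forall>z1 z2. dist (G (x, z1)) (G (x, z2)) \<le> \<alpha> * dist z1 z2"
    using G by (auto simp: fiber_contraction_def)
  then obtain N where N: "N \<in> null_sets unit_leb"
    "\<And>x. x \<in> {0..1} - N \<Longrightarrow> \<forall>z1 z2. dist (G (x, z1)) (G (x, z2)) \<le> \<alpha> * dist z1 z2"
    by (auto elim!: AE_E3)
  define G' where "G' p = (if fst p \<in> {0..1} - N then G p else undefined)" for p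
  have A: "{0..1} - N \<in> sets unit_leb" using null_setsD2[OF N(1)] sets.top[of unit_leb] by auto
  have "fst -` ({0..1} - N) \<inter> space (unit_leb \<Otimes>\<^sub>M (borel :: 'k measure)) \<in> sets (unit_leb \<Otimes>\<^sub>M borel)"
    by (rule measurable_sets[OF measurable_fst A])
  also have "fst -` ({0..1} - N) \<inter> space (unit_leb \<Otimes>\<^sub>M (borel :: 'k measure)) =
      {p \<in> space (unit_leb \<Otimes>\<^sub>M borel). fst p \<in> {0..1} - N}" by auto
  finally have "G' \<in> unit_leb \<Otimes>\<^sub>M borel \<rightarrow>\<^sub>M borel"
    unfolding G'_def using meas
    by (intro measurable_If) (simp_all add: measurable_cong_sets[OF sets_skew_space[OF cpt] refl])
  moreover have "dist (G' (x, z1)) (G' (x, z2)) \<le> \<alpha> * dist z1 z2" for x z1 z2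
    using N(2)[of x] \<alpha> by (auto simp: G'_def)
  ultimately show thesis using that[of N G' \<alpha>] N(1) \<alpha> by (auto simp: G'_def)
qed

lemma class_T_branched_map:
  assumes "f \<in> class_T" and f: "f \<in> unit_leb \<rightarrow>\<^sub>M unit_leb"
  shows "\<exists>a b. branched_map f a b"
proof -
  obtain a b :: "nat \<Rightarrow> real" where ab: "\<forall>i. a i < b i \<and> {a i<..<b i} \<subseteq> {0..1}"
     "disjoint_family (\<lambda>i. {a i<..<b i})"
     "emeasure lborel ({0..1} - (\<Union>i. {a i<..<b i})) = 0"
     "\<forall>i. mono_on {a i<..<b i} f \<and> convex_on {a i<..<b i} f \<and>
          (\<forall>x\<in>{a i<..<b i}. f differentiable (at x)) \<and>
          (f \<longlongrightarrow> 0) (at_right (a i))"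
     "\<forall>i. 0 < left_end_deriv f (a i)" "summable (\<lambda>i. 1 / left_end_deriv f (a i))"
     "\<not> 0 islimpt (range a \<union> range b) \<longrightarrow>
        (\<exists>\<beta>. 0 < \<beta> \<and> \<beta> < 1 \<and> left_end_deriv f 0 = 1 / \<beta>)"
    using assms(1) unfolding class_T_def mem_Collect_eq by (elim exE conjE) (rule that)
  have "branched_map f a b"
    by (rule branched_map.intro) (use ab f in \<open>blast+\<close>)
  then show ?thesis by blast
qed

theorem theoremA:
  fixes f :: "real \<Rightarrow> real"
    and G :: "real \<times> 'k::metric_space \<Rightarrow> 'k"
    and F :: "real \<times> 'k \<Rightarrow> real \<times> 'k"
  assumes "compact (UNIV :: 'k set)"
    and "diameter (UNIV :: 'k set) = 1"
    and "F = (\<lambda>(x, y). (f x, G (x, y)))"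
    and "F \<in> skew_space \<rightarrow>\<^sub>M skew_space"
    and "f \<in> class_T"
    and "fiber_contraction G"
  shows "\<exists>!\<mu> :: (real \<times> 'k) measure.
           prob_space \<mu> \<and> sets \<mu> = sets skew_space \<and>
           measure \<mu> \<in> S1_space \<and> distr \<mu> skew_space F = \<mu>"
proof -
  note cpt = assms(1) and F = assms(3)
  note sk = sets_skew_space[OF cpt]
  have fst_meas: "(fst :: real \<times> 'k \<Rightarrow> real) \<in> skew_space \<rightarrow>\<^sub>M unit_leb"
    by (rule fst_measurable_skew[OF cpt])
  have snd_meas: "(snd :: real \<times> 'k \<Rightarrow> 'k) \<in> skew_space \<rightarrow>\<^sub>M borel"
    by (simp add: measurable_cong_sets[OF sk refl])
  have f_meas: "f \<in> unit_leb \<rightarrow>\<^sub>M unit_leb"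
  proof -
    have "(\<lambda>x. (x, undefined :: 'k)) \<in> unit_leb \<rightarrow>\<^sub>M skew_space"
      by (simp add: measurable_cong_sets[OF refl sk])
    from measurable_compose[OF measurable_compose[OF this assms(4)] fst_meas]
    show ?thesis by (simp add: F)
  qed
  have G_meas: "G \<in> skew_space \<rightarrow>\<^sub>M borel"
    using measurable_compose[OF assms(4) snd_meas] by (simp add: F case_prod_beta)
  obtain a b where bm: "branched_map f a b"
    using class_T_branched_map[OF assms(5) f_meas] by blast
  obtain G' \<alpha> N where N: "N \<in> null_sets unit_leb" "\<And>x z. x \<in> {0..1} - N \<Longrightarrow> G' (x, z) = G (x, z)"
    and G': "G' \<in> unit_leb \<Otimes>\<^sub>M borel \<rightarrow>\<^sub>M borel" and \<alpha>: "0 \<le> \<alpha>" "\<alpha> < 1"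
    and contr: "\<And>x z1 z2. dist (G' (x, z1)) (G' (x, z2)) \<le> \<alpha> * dist z1 z2"
    by (rule fiber_contraction_everywhere[OF cpt assms(6) G_meas]) blast
  define F' where "F' = (\<lambda>(x, y). (f x, G' (x, y)))"
  have F'_meas: "F' \<in> skew_space \<rightarrow>\<^sub>M skew_space"
    unfolding F'_def measurable_cong_sets[OF sk sk] using f_meas G' by measurable
  \<comment> \<open>The modified fibers project to a Lebesgue null set, which any measure with
    absolutely continuous marginal ignores; for such measures invariance under \<open>F\<close> and
    under \<open>F'\<close> agree.\<close>
  have distr_F': "distr \<mu> skew_space F = distr \<mu> skew_space F'"
    if \<mu>: "sets \<mu> = sets skew_space" and ac: "absolutely_continuous unit_leb (marginal \<mu>)" for \<mu> :: "(real \<times> 'k) measure"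
  proof (rule distr_cong_AE)
    have fst\<mu>: "fst \<in> \<mu> \<rightarrow>\<^sub>M unit_leb" using fst_meas by (simp add: measurable_cong_sets[OF \<mu> refl])
    have sp: "space \<mu> = {0..1} \<times> UNIV" using sets_eq_imp_space_eq[OF \<mu>] by (simp add: space_skew_space)
    have "N \<in> null_sets (marginal \<mu>)" using ac N(1) by (auto simp: absolutely_continuous_def)
    then have "AE x in marginal \<mu>. x \<notin> N" by (rule AE_not_in)
    then have "AE p in \<mu>. fst p \<notin> N"
      unfolding marginal_def by (rule AE_distrD[OF fst\<mu>])
    then show "AE p in \<mu>. F p = F' p"
      using AE_space by eventually_elim (auto simp: F F'_def sp N(2))
  qed (use assms(4) F'_meas in \<open>simp_all add: measurable_cong_sets[OF \<mu> refl]\<close>)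
  show ?thesis
  proof (rule ex_ex1I)
    obtain h R where h: "h \<in> borel_measurable borel" "\<And>x. 0 \<le> h x" "\<And>x. h x \<le> R" "antimono_on {0..1} h"
      and prob_h: "prob_space (density unit_leb (\<lambda>x. ennreal (h x)))"
      and inv_h: "distr (density unit_leb (\<lambda>x. ennreal (h x))) unit_leb f = density unit_leb (\<lambda>x. ennreal (h x))"
      by (rule branched_map.acim_exists[OF bm]) blast
    define \<nu> where "\<nu> = density unit_leb (\<lambda>x. ennreal (h x))"
    have h_unit: "h \<in> borel_measurable unit_leb"
      using measurable_compose[OF id_measurable_unit_leb h(1)] by simp
    then have h_enn: "(\<lambda>x. ennreal (h x)) \<in> borel_measurable unit_leb" by simp
    have sets_\<nu>: "sets \<nu> = sets unit_leb" by (simp add: \<nu>_def)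
    have ac: "absolutely_continuous unit_leb \<nu>"
      unfolding \<nu>_def by (rule absolutely_continuousI_density[OF h_enn])
    obtain \<mu> \<kappa> where \<mu>: "prob_space \<mu>" "sets \<mu> = sets skew_space" "distr \<mu> skew_space F' = \<mu>"
      and \<kappa>: "\<kappa> \<in> unit_leb \<rightarrow>\<^sub>M prob_algebra borel"
      and dis: "\<And>E. E \<in> sets skew_space \<Longrightarrow> emeasure \<mu> E = (\<integral>\<^sup>+x. emeasure (\<kappa> x) {y. (x, y) \<in> E} \<partial>\<nu>)"
      by (rule branched_map.skew_invariant_exists[OF bm cpt F'_def G' contr \<alpha>, of \<nu>])
        (use prob_h inv_h sets_\<nu> ac in \<open>auto simp: \<nu>_def\<close>)
    have fin: "finite_measure \<mu>" using \<mu>(1) by (rule prob_space.axioms)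
    have kprob: "prob_space (\<kappa> x)" "sets (\<kappa> x) = sets borel" if "x \<in> {0..1}" for x
      using measurable_space[OF \<kappa>, of x] that by (auto simp: space_prob_algebra)
    have marg: "marginal \<mu> = \<nu>"
    proof (rule measure_eqI)
      fix A assume "A \<in> sets (marginal \<mu>)"
      then have A: "A \<in> sets unit_leb" by simp
      have fst\<mu>: "fst \<in> \<mu> \<rightarrow>\<^sub>M unit_leb" using fst_meas by (simp add: measurable_cong_sets[OF \<mu>(2) refl])
      have sp: "space \<mu> = {0..1} \<times> UNIV" using sets_eq_imp_space_eq[OF \<mu>(2)] by (simp add: space_skew_space)
      have pre: "fst -` A \<inter> space \<mu> \<in> sets skew_space" using measurable_sets[OF fst\<mu> A] \<mu>(2) by simp
      have "emeasure (marginal \<mu>) A = emeasure \<mu> (fst -` A \<inter> space \<mu>)"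
        unfolding marginal_def by (rule emeasure_distr[OF fst\<mu> A])
      also have "\<dots> = (\<integral>\<^sup>+x. indicator A x \<partial>\<nu>)"
        unfolding dis[OF pre]
      proof (rule nn_integral_cong)
        fix x assume "x \<in> space \<nu>"
        then have x: "x \<in> {0..1}" by (simp add: \<nu>_def)
        have "space (\<kappa> x) = UNIV" using sets_eq_imp_space_eq[OF kprob(2)[OF x]] by simp
        then show "emeasure (\<kappa> x) {y. (x, y) \<in> fst -` A \<inter> space \<mu>} = indicator A x"
          using prob_space.emeasure_space_1[OF kprob(1)[OF x]] x by (auto simp: sp indicator_def)
      qed
      also have "\<dots> = emeasure \<nu> A" using A sets_\<nu> by simp
      finally show "emeasure (marginal \<mu>) A = emeasure \<nu> A" .
    qed (simp add: sets_\<nu>)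
    \<comment> \<open>\<open>RN_deriv\<close> is determined only almost everywhere, so
      \<open>h\<close> and the marginal density are exchanged under integrals and in the essential
      variation, never pointwise.\<close>
    have dens: "AE x in unit_leb. marginal_density \<mu> x = ennreal (h x)"
      by (rule marginal_density_AE[OF h_enn]) (simp add: marg \<nu>_def)
    have "disintegration \<mu> \<kappa>"
      unfolding disintegration_def
    proof (intro conjI ballI \<kappa>)
      fix E :: "(real \<times> 'k) set" assume E: "E \<in> sets skew_space"
      have "(\<lambda>x. emeasure (\<kappa> x) {y. (x, y) \<in> E}) \<in> borel_measurable unit_leb"
      proof (rule emeasure_measurable_subprob_algebra2)
        show "\<kappa> \<in> unit_leb \<rightarrow>\<^sub>M subprob_algebra borel" by (rule measurable_prob_algebraD[OF \<kappa>])
        have "(SIGMA x:space unit_leb. {y. (x, y) \<in> E}) = E"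
          using sets.sets_into_space[OF E] by (auto simp: space_skew_space)
        then show "(SIGMA x:space unit_leb. {y. (x, y) \<in> E}) \<in> sets (unit_leb \<Otimes>\<^sub>M borel)" using E sk by simp
      qed
      then have "emeasure \<mu> E = (\<integral>\<^sup>+x. ennreal (h x) * emeasure (\<kappa> x) {y. (x, y) \<in> E} \<partial>unit_leb)"
        unfolding dis[OF E] \<nu>_def by (intro nn_integral_density h_enn)
      also have "\<dots> = (\<integral>\<^sup>+x. emeasure (\<kappa> x) {y. (x, y) \<in> E} * marginal_density \<mu> x \<partial>unit_leb)"
        by (rule nn_integral_cong_AE) (use dens in \<open>auto elim!: eventually_mono simp: mult.commute\<close>)
      finally show "emeasure \<mu> E = (\<integral>\<^sup>+x. emeasure (\<kappa> x) {y. (x, y) \<in> E} * marginal_density \<mu> x \<partial>unit_leb)" .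
    qed
    then have L1: "measure \<mu> \<in> L1_space"
      using ac marg by (intro disintegrable_positive_in_L1[OF cpt fin \<mu>(2)]) simp_all
    have sd: "AE x in unit_leb. signed_density (measure \<mu>) x = h x"
      using signed_density_AE[OF cpt fin \<mu>(2)] dens by eventually_elim (simp add: h(2))
    have "integrable unit_leb h"
      using prob_space_unit_leb[THEN prob_space.axioms(1)]
      by (intro finite_measure.integrable_const_bound[where B = R]) (use h h_unit in auto)
    moreover have "signed_density (measure \<mu>) \<in> borel_measurable unit_leb"
      unfolding signed_density_def using marginal_density_measurable by measurable
    ultimately have "integrable unit_leb (signed_density (measure \<mu>))"
      using h_unit sd by (subst integrable_cong_AE[where g = h]) auto
    \<comment> \<open>The function \<open>h\<close> is one of the representatives over which the
      infimum runs, and being decreasing and bounded it has finite variation.\<close>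
    moreover have "essential_variation (signed_density (measure \<mu>)) \<le> total_variation h"
      unfolding essential_variation_def
      by (rule INF_lower) (use sd in \<open>auto elim!: eventually_mono\<close>)
    then have "essential_variation (signed_density (measure \<mu>)) < \<infinity>"
      using total_variation_antimono[OF h(4,2,3)] ennreal_less_top[of R]
      by (metis infinity_ennreal_def le_less_trans)
    ultimately have "measure \<mu> \<in> S1_space" using L1 by (simp add: S1_space_def BV_m_def)
    moreover have "distr \<mu> skew_space F = \<mu>" using distr_F'[OF \<mu>(2)] \<mu>(3) ac marg by simp
    ultimately show "\<exists>\<mu>. prob_space \<mu> \<and> sets \<mu> = sets skew_space \<and> measure \<mu> \<in> S1_space \<and> distr \<mu> skew_space F = \<mu>"
      using \<mu> by blast
  next
    \<comment> \<open>Collects what uniqueness in the base and over the base require of a solution;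
      its marginal is invariant because \<open>fst\<close> intertwines \<open>F\<close> and
      \<open>f\<close>.\<close>
    have facts: "absolutely_continuous unit_leb (marginal \<mu>) \<and> prob_space (marginal \<mu>) \<and>
        distr (marginal \<mu>) unit_leb f = marginal \<mu> \<and> distr \<mu> skew_space F' = \<mu> \<and>
        marginal \<mu> = density unit_leb (\<lambda>x. ennreal (enn2real (marginal_density \<mu> x))) \<and>
        (\<exists>k. (AE x in unit_leb. k x = enn2real (marginal_density \<mu> x)) \<and> (AE x in unit_leb. isCont k x))"
      if \<mu>: "prob_space \<mu> \<and> sets \<mu> = sets skew_space \<and> measure \<mu> \<in> S1_space \<and> distr \<mu> skew_space F = \<mu>" for \<mu> :: "(real \<times> 'k) measure"
    proof -
      have fin: "finite_measure \<mu>" and s: "sets \<mu> = sets skew_space" using \<mu> by (auto intro: prob_space.axioms)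
      have ac: "absolutely_continuous unit_leb (marginal \<mu>)"
        using \<mu> by (simp add: S1_space_def L1_space_def AB_def pos_part_positive[OF fin s])
      have fst\<mu>: "fst \<in> \<mu> \<rightarrow>\<^sub>M unit_leb" using fst_meas by (simp add: measurable_cong_sets[OF s refl])
      have F\<mu>: "F \<in> \<mu> \<rightarrow>\<^sub>M skew_space" using assms(4) by (simp add: measurable_cong_sets[OF s refl])
      have pr: "prob_space (marginal \<mu>)"
        unfolding marginal_def using \<mu> by (intro prob_space.prob_space_distr fst\<mu>) simp
      have "distr (marginal \<mu>) unit_leb f = distr \<mu> unit_leb (\<lambda>p. f (fst p))"
        unfolding marginal_def using fst\<mu> f_meas by (subst distr_distr) (auto simp: comp_def)
      also have "\<dots> = distr (distr \<mu> skew_space F) unit_leb fst"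
        using F\<mu> fst_meas by (subst distr_distr) (auto simp: comp_def F case_prod_beta)
      also have "\<dots> = marginal \<mu>" using \<mu> by (simp add: marginal_def)
      finally have inv: "distr (marginal \<mu>) unit_leb f = marginal \<mu>" .
      have "signed_density (measure \<mu>) \<in> BV_m" using \<mu> by (simp add: S1_space_def)
      then obtain k where k: "AE x in unit_leb. k x = signed_density (measure \<mu>) x" "AE x in unit_leb. isCont k x"
        by (rule BV_m_AE_isCont)
      have "AE x in unit_leb. k x = enn2real (marginal_density \<mu> x)"
        using k(1) signed_density_AE[OF cpt fin s] by eventually_elim simp
      then show ?thesis
        using ac pr inv distr_F'[OF s ac] \<mu> k(2) marginal_eq_density[OF ac prob_space.axioms(1)[OF pr]] by auto
    qed
    fix \<mu>1 \<mu>2 :: "(real \<times> 'k) measure"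
    assume \<mu>1: "prob_space \<mu>1 \<and> sets \<mu>1 = sets skew_space \<and> measure \<mu>1 \<in> S1_space \<and> distr \<mu>1 skew_space F = \<mu>1"
      and \<mu>2: "prob_space \<mu>2 \<and> sets \<mu>2 = sets skew_space \<and> measure \<mu>2 \<in> S1_space \<and> distr \<mu>2 skew_space F = \<mu>2"
    define g1 where "g1 x = enn2real (marginal_density \<mu>1 x)" for x
    define g2 where "g2 x = enn2real (marginal_density \<mu>2 x)" for x
    have g_meas: "g1 \<in> borel_measurable unit_leb" "g2 \<in> borel_measurable unit_leb"
      unfolding g1_def g2_def using marginal_density_measurable by measurable
    have m1: "marginal \<mu>1 = density unit_leb (\<lambda>x. ennreal (g1 x))" and m2: "marginal \<mu>2 = density unit_leb (\<lambda>x. ennreal (g2 x))"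
      using facts[OF \<mu>1] facts[OF \<mu>2] unfolding g1_def g2_def by blast+
    obtain k1 where k1: "AE x in unit_leb. k1 x = g1 x" "AE x in unit_leb. isCont k1 x"
      using facts[OF \<mu>1] unfolding g1_def by blast
    obtain k2 where k2: "AE x in unit_leb. k2 x = g2 x" "AE x in unit_leb. isCont k2 x"
      using facts[OF \<mu>2] unfolding g2_def by blast
    have "AE x in unit_leb. g1 x = g2 x"
    proof (rule branched_map.acim_unique[OF bm g_meas _ _ _ _ _ _ k1 k2])
      show "prob_space (density unit_leb (\<lambda>x. ennreal (g1 x)))" "prob_space (density unit_leb (\<lambda>x. ennreal (g2 x)))"
        using facts[OF \<mu>1] facts[OF \<mu>2] m1 m2 by metis+
      show "distr (density unit_leb (\<lambda>x. ennreal (g1 x))) unit_leb f = density unit_leb (\<lambda>x. ennreal (g1 x))"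
        "distr (density unit_leb (\<lambda>x. ennreal (g2 x))) unit_leb f = density unit_leb (\<lambda>x. ennreal (g2 x))"
        using facts[OF \<mu>1] facts[OF \<mu>2] m1 m2 by metis+
    qed (simp_all add: g1_def g2_def)
    then have "marginal \<mu>1 = marginal \<mu>2"
      unfolding m1 m2 using g_meas by (intro density_cong) (auto elim!: eventually_mono)
    then show "\<mu>1 = \<mu>2"
      using invariant_measure_determined_by_marginal[OF cpt F'_def F'_meas contr \<alpha>, of \<mu>1 \<mu>2]
        facts[OF \<mu>1] facts[OF \<mu>2] \<mu>1 \<mu>2 by blast
  qed
qed

end
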